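(* (a) For every loop $\alpha:([0,1],\{0,1\})\to(\mathbb{E},\ast)\subseteq(\mathbb{T},\ast)$ and every covering projection $p:(E,e)\to(\mathbb{T},\ast)$, the lift $\alpha':([0,1],0)\to(E,e)$ with $p\circ\alpha'=\alpha$ is a loop, i.e. $\alpha'(1)=e$. (b) For every essential (i.e. not null-homotopic relative to endpoints) loop $\alpha:([0,1],\{0,1\})\to(\mathbb{T},\ast)$ there are two covering projections $p_1:(E_1,e_1)\to(\mathbb{T},\ast)$ and $p_2:(E_2,e_2)\to(E_1,e_1)$ such that the lift $\alpha'':([0,1],0)\to(E_2,e_2)$ with $p_1\circ p_2\circ\alpha''=\alpha$ is not a loop, i.e. $\alpha''(1)\neq e_2$.
   Context: For each $m\in\mathbb{N}=\{1,2,3,\dots\}$ let $C_m\subseteq\mathbb{R}^2$ be the circle of radius $\frac1m$ centered at $(\frac1m,0)$; let $\mathbb{E}=\bigcup_{m\in\mathbb{N}}C_m\subseteq\mathbb{R}^2$ (subspace topology) with basepoint $\ast=(0,0)$. Let $\ell_m:[0,1]\to C_m$ be the loop $\ell_m(t)=\left(\frac1m(1-\cos 2\pi t),\frac1m\sin 2\pi t\right)$. Let $f:\mathbb{E}\to\mathbb{E}$ be the unique continuous map with $f\circ\ell_m=\ell_{m+1}$ for all $m\in\mathbb{N}$. Let $\mathbb{T}$ be the mapping torus of $f$, i.e. the quotient space $\mathbb{E}\times[0,1]/\sim$ with $(x,1)\sim(f(x),0)$ for all $x\in\mathbb{E}$, and let $h:\mathbb{E}\times[0,1]\to\mathbb{T}$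 be the quotient map. Identify $\mathbb{E}$ with $h(\mathbb{E}\times\{0\})\subseteq\mathbb{T}$ via $x\mapsto h(x,0)$; in particular $\ast\in\mathbb{T}$ denotes $h(\ast,0)$. The notation $\alpha':([0,1],0)\to(E,e)$ means that $\alpha'$ is a path with $\alpha'(0)=e$, and $p:(E,e)\to(X,x)$ means $p(e)=x$. *)

theory Defs
  imports "HOL-Analysis.Analysis"
begin

section \<open>The Hawaiian earring and its shift\<close>

definition earring_circle :: "nat \<Rightarrow> (real \<times> real) set" where
  "earring_circle m = sphere (1 / real m, 0) (1 / real m)"

definition earring :: "(real \<times> real) set" where
  "earring = (\<Union>m\<in>{1..}. earring_circle m)"

definition earring_loop :: "nat \<Rightarrow> real \<Rightarrow> real \<times> real" where
  "earring_loop m t =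
     (1 / real m * (1 - cos (2 * pi * t)), 1 / real m * sin (2 * pi * t))"

abbreviation earring_top :: "(real \<times> real) topology" where
  "earring_top \<equiv> top_of_set earring"

text \<open>HOL functions are total, so uniqueness of the map \<open>f\<close> with \<open>f \<circ> \<ell>\<^sub>m = \<ell>\<^sub>m\<^sub>+\<^sub>1\<close> only
  holds once its values off the earring are fixed; this is what \<^const>\<open>extensional\<close> does.
  Existence and uniqueness are proved in \<open>earring_shift_ex1\<close> below.\<close>

definition earring_shift :: "real \<times> real \<Rightarrow> real \<times> real" where
  "earring_shift =
     (THE f. f \<in> extensional earring \<and> continuous_map earring_top earring_top f \<and>
             (\<forall>m\<ge>1. \<forall>t\<in>{0..1}. f (earring_loop m t) = earring_loop (Suc m) t))"

lemma earring_loop_in_circle: "earring_loop m t \<in> earring_circle m"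
proof -
  have "(cos (2*pi*t) / real m)\<^sup>2 + (sin (2*pi*t) / real m)\<^sup>2 = (1 / real m)\<^sup>2"
    by (simp add: power_divide flip: add_divide_distrib)
  moreover have "1 / real m - 1 / real m * (1 - cos (2*pi*t)) = cos (2*pi*t) / real m"
    by (simp add: algebra_simps diff_divide_distrib)
  ultimately show ?thesis
    by (simp add: earring_circle_def earring_loop_def dist_Pair_Pair dist_real_def power_divide
        real_sqrt_divide)
qed

lemma earring_loop_in_earring: "m \<ge> 1 \<Longrightarrow> earring_loop m t \<in> earring"
  using earring_loop_in_circle by (auto simp: earring_def)

lemma earring_circle_cases:
  assumes m: "m \<ge> 1" and z: "z \<in> earring_circle m"
  obtains t where "t \<in> {0..1}" "z = earring_loop m t"
proof -
  obtain x y where xy: "z = (x, y)" by (cases z)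
  have "sqrt ((1 / real m - x)\<^sup>2 + y\<^sup>2) = 1 / real m"
    using z by (simp add: earring_circle_def xy dist_Pair_Pair dist_real_def)
  then have "(1 / real m - x)\<^sup>2 + y\<^sup>2 = (1 / real m)\<^sup>2"
    by (metis real_sqrt_pow2 add_nonneg_nonneg zero_le_power2)
  then have "(1 - real m * x)\<^sup>2 + (real m * y)\<^sup>2 = 1"
    using m by (simp add: power2_eq_square field_simps)
  then obtain s where s: "0 \<le> s" "s \<le> 2 * pi" "1 - real m * x = cos s" "real m * y = sin s"
    by (metis sincos_total_2pi less_le)
  show ?thesis
  proof
    show "s / (2 * pi) \<in> {0..1}" using s by simp
    show "z = earring_loop m (s / (2 * pi))"
      using m by (simp add: xy earring_loop_def s(3)[symmetric] s(4)[symmetric])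
  qed
qed

lemma earring_cases:
  assumes "z \<in> earring"
  obtains m t where "m \<ge> 1" "t \<in> {0..1}" "z = earring_loop m t"
proof -
  obtain m where "m \<ge> 1" "z \<in> earring_circle m" using assms by (auto simp: earring_def)
  then show thesis using that by (metis earring_circle_cases)
qed

lemma earring_shift_ex1:
  "\<exists>!f. f \<in> extensional earring \<and> continuous_map earring_top earring_top f \<and>
        (\<forall>m\<ge>1. \<forall>t\<in>{0..1}. f (earring_loop m t) = earring_loop (Suc m) t)"
proof (rule ex_ex1I)
  define c where "c = (\<lambda>z::real\<times>real. 2 * fst z / (2 * fst z + (norm z)\<^sup>2))"
  define g where "g = (\<lambda>z. c z *\<^sub>R z)"
  have g_loop: "g (earring_loop m t) = earring_loop (Suc m) t" if m: "m \<ge> 1" for m t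
  proof -
    define C where "C = cos (2 * pi * t)"
    define S where "S = sin (2 * pi * t)"
    have SC: "S\<^sup>2 = 1 - C\<^sup>2" by (simp add: C_def S_def sin_squared_eq)
    have nrm: "(norm (earring_loop m t))\<^sup>2 = 2 * (1 - C) / (real m)\<^sup>2"
    proof -
      have "(norm (earring_loop m t))\<^sup>2 = (1 / real m * (1 - C))\<^sup>2 + (1 / real m * S)\<^sup>2"
        by (simp add: earring_loop_def norm_Pair C_def S_def power_divide)
      also have "\<dots> = ((1 - C)\<^sup>2 + S\<^sup>2) / (real m)\<^sup>2"
        by (simp add: power_divide add_divide_distrib)
      also have "(1 - C)\<^sup>2 + S\<^sup>2 = 2 * (1 - C)"
        using SC by (simp add: power2_eq_square algebra_simps)
      finally show ?thesis .
    qed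
    show ?thesis
    proof (cases "C = 1")
      case True
      then have "S = 0" using SC by simp
      with True show ?thesis by (simp add: g_def earring_loop_def C_def S_def)
    next
      case False
      have D: "2 * (1 - C) / real m + 2 * (1 - C) / (real m)\<^sup>2
               = 2 * (1 - C) / real m * ((1 + real m) / real m)"
        using m by (simp add: field_simps power2_eq_square)
      have "c (earring_loop m t) =
          (2 * (1 - C) / real m) / (2 * (1 - C) / real m + 2 * (1 - C) / (real m)\<^sup>2)"
        unfolding c_def nrm by (simp add: earring_loop_def C_def)
      also have "\<dots> = real m / (1 + real m)"
        unfolding D using m False by simp
      finally show ?thesis
        using m by (simp add: g_def earring_loop_def)
    qed
  qed
  have fst_nonneg: "fst z \<ge> 0" and fst_pos: "z \<noteq> 0 \<Longrightarrow> fst z > 0" if z: "z \<in> earring" for z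
  proof -
    obtain m t where mt: "m \<ge> 1" "t \<in> {0..1}" "z = earring_loop m t"
      using z by (rule earring_cases)
    show "fst z \<ge> 0" by (simp add: mt earring_loop_def)
    assume "z \<noteq> 0"
    have "cos (2 * pi * t) \<noteq> 1"
    proof
      assume "cos (2 * pi * t) = 1"
      then have "sin (2 * pi * t) = 0"
        by (metis cos_one_sin_zero)
      with \<open>cos (2 * pi * t) = 1\<close> \<open>z \<noteq> 0\<close> show False
        by (simp add: mt earring_loop_def zero_prod_def)
    qed
    then have "cos (2 * pi * t) < 1" by (simp add: order_less_le)
    then show "fst z > 0" using mt by (simp add: earring_loop_def)
  qed
  have "continuous_on earring g"
    unfolding continuous_on
  proof
    fix z assume z: "z \<in> earring"
    show "(g \<longlongrightarrow> g z) (at z within earring)"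
    proof (cases "z = 0")
      case True
      have "\<forall>\<^sub>F w in at z within earring. norm (g w) \<le> norm w"
        unfolding eventually_at_filter
      proof (intro always_eventually allI impI)
        fix w assume "w \<in> earring"
        then have "fst w \<ge> 0" by (rule fst_nonneg)
        moreover from this have "0 \<le> 2 * fst w + (norm w)\<^sup>2" by simp
        ultimately have "\<bar>c w\<bar> \<le> 1"
          by (auto simp: c_def divide_le_eq_1 order_le_less)
        then show "norm (g w) \<le> norm w"
          by (simp add: g_def mult_left_le_one_le)
      qed
      moreover have "((\<lambda>w. norm w) \<longlongrightarrow> 0) (at z within earring)"
        unfolding True using tendsto_norm_zero tendsto_ident_at by blast
      ultimately have "(g \<longlongrightarrow> 0) (at z within earring)"
        by (rule Lim_null_comparison)
      then show ?thesis by (simp add: True g_def)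
    next
      case False
      then have "2 * fst z + (norm z)\<^sup>2 \<noteq> 0"
        using fst_pos[OF z] by (smt (verit) zero_le_power2)
      then show ?thesis
        unfolding g_def c_def by (intro tendsto_intros) auto
    qed
  qed
  moreover have "g ` earring \<subseteq> earring"
    by (auto elim!: earring_cases simp: g_loop earring_loop_in_earring)
  ultimately have "continuous_map earring_top earring_top g"
    by (simp add: image_subset_iff_funcset)
  then have "continuous_map earring_top earring_top (restrict g earring)"
    by (rule continuous_map_eq) auto
  then show "\<exists>f. f \<in> extensional earring \<and> continuous_map earring_top earring_top f \<and>
        (\<forall>m\<ge>1. \<forall>t\<in>{0..1}. f (earring_loop m t) = earring_loop (Suc m) t)"
    using g_loop earring_loop_in_earring
    by (intro exI[of _ "restrict g earring"]) auto
next
  fix f f' :: "real \<times> real \<Rightarrow> real \<times> real"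
  assume f: "f \<in> extensional earring \<and> continuous_map earring_top earring_top f \<and>
        (\<forall>m\<ge>1. \<forall>t\<in>{0..1}. f (earring_loop m t) = earring_loop (Suc m) t)"
    and f': "f' \<in> extensional earring \<and> continuous_map earring_top earring_top f' \<and>
        (\<forall>m\<ge>1. \<forall>t\<in>{0..1}. f' (earring_loop m t) = earring_loop (Suc m) t)"
  show "f = f'"
  proof (rule extensionalityI[of _ earring])
    fix z assume "z \<in> earring"
    then obtain m t where "m \<ge> 1" "t \<in> {0..1}" "z = earring_loop m t" by (rule earring_cases)
    then show "f z = f' z" using f f' by simp
  qed (use f f' in auto)
qed

lemma continuous_map_earring_shift: "continuous_map earring_top earring_top earring_shift"
  and earring_shift_loop:
    "m \<ge> 1 \<Longrightarrow> t \<in> {0..1} \<Longrightarrow> earring_shift (earring_loop m t) = earring_loop (Suc m) t"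
  using theI'[OF earring_shift_ex1] by (auto simp: earring_shift_def)


section \<open>Quotient topologies and mapping tori\<close>

definition quotient_topology :: "'a topology \<Rightarrow> ('a \<times> 'a) set \<Rightarrow> 'a set topology" where
  "quotient_topology X r =
     topology (\<lambda>U. U \<subseteq> topspace X // r \<and> openin X {x \<in> topspace X. r `` {x} \<in> U})"

lemma openin_quotient_topology:
  "openin (quotient_topology X r) U \<longleftrightarrow>
     U \<subseteq> topspace X // r \<and> openin X {x \<in> topspace X. r `` {x} \<in> U}"
proof -
  have "istopology (\<lambda>U. U \<subseteq> topspace X // r \<and> openin X {x \<in> topspace X. r `` {x} \<in> U})"
    unfolding istopology_def
  proof (rule conjI; clarify)
    fix S T
    assume "openin X {x \<in> topspace X. r `` {x} \<in> S}" "openin X {x \<in> topspace X. r `` {x} \<in> T}"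
    then have "openin X ({x \<in> topspace X. r `` {x} \<in> S} \<inter> {x \<in> topspace X. r `` {x} \<in> T})"
      by (rule openin_Int)
    moreover have "{x \<in> topspace X. r `` {x} \<in> S} \<inter> {x \<in> topspace X. r `` {x} \<in> T}
        = {x \<in> topspace X. r `` {x} \<in> S \<inter> T}" by auto
    moreover assume "S \<subseteq> topspace X // r" "T \<subseteq> topspace X // r"
    ultimately show "S \<inter> T \<subseteq> topspace X // r \<and>
        openin X {x \<in> topspace X. r `` {x} \<in> S \<inter> T}" by auto
  next
    fix K
    assume K: "\<forall>S\<in>K. S \<subseteq> topspace X // r \<and> openin X {x \<in> topspace X. r `` {x} \<in> S}"
    then have "openin X (\<Union>S\<in>K. {x \<in> topspace X. r `` {x} \<in> S})" by blast
    moreover have "(\<Union>S\<in>K. {x \<in> topspace X. r `` {x} \<in> S})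
        = {x \<in> topspace X. r `` {x} \<in> \<Union>K}" by auto
    ultimately show "\<Union>K \<subseteq> topspace X // r \<and> openin X {x \<in> topspace X. r `` {x} \<in> \<Union>K}"
      using K by auto
  qed
  then show ?thesis
    by (simp add: quotient_topology_def topology_inverse')
qed

lemma topspace_quotient_topology: "topspace (quotient_topology X r) = topspace X // r"
proof
  show "topspace (quotient_topology X r) \<subseteq> topspace X // r"
    by (metis openin_quotient_topology openin_topspace)
  have "{x \<in> topspace X. r `` {x} \<in> topspace X // r} = topspace X"
    by (auto intro: quotientI)
  then have "openin (quotient_topology X r) (topspace X // r)"
    by (simp add: openin_quotient_topology)
  then show "topspace X // r \<subseteq> topspace (quotient_topology X r)"
    by (rule openin_subset)
qed

lemma quotient_map_quotient_topology: "quotient_map X (quotient_topology X r) (\<lambda>x. r `` {x})"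
  by (auto simp: quotient_map_def topspace_quotient_topology openin_quotient_topology quotient_def)

text \<open>The equivalence relation generated by \<open>(x, 1) \<sim> (f x, 0)\<close>.\<close>

definition mapping_torus_rel ::
    "'a topology \<Rightarrow> ('a \<Rightarrow> 'a) \<Rightarrow> (('a \<times> real) \<times> ('a \<times> real)) set" where
  "mapping_torus_rel X f =
     (let R = {((x, 1), (f x, 0)) | x. x \<in> topspace X} in (R \<union> R\<inverse>)\<^sup>*)"

definition mapping_torus :: "'a topology \<Rightarrow> ('a \<Rightarrow> 'a) \<Rightarrow> ('a \<times> real) set topology" where
  "mapping_torus X f =
     quotient_topology (prod_topology X (top_of_set {0..1})) (mapping_torus_rel X f)"

definition mapping_torus_proj :: "'a topology \<Rightarrow> ('a \<Rightarrow> 'a) \<Rightarrow> 'a \<times> real \<Rightarrow> ('a \<times> real) set" where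
  "mapping_torus_proj X f z = mapping_torus_rel X f `` {z}"

lemma quotient_map_mapping_torus_proj:
  "quotient_map (prod_topology X (top_of_set {0..1})) (mapping_torus X f) (mapping_torus_proj X f)"
  using quotient_map_quotient_topology
  unfolding mapping_torus_def mapping_torus_proj_def by blast


section \<open>Loops, coverings and lifts\<close>

definition loop_at :: "'a topology \<Rightarrow> 'a \<Rightarrow> (real \<Rightarrow> 'a) \<Rightarrow> bool" where
  "loop_at X b \<alpha> \<longleftrightarrow> pathin X \<alpha> \<and> \<alpha> 0 = b \<and> \<alpha> 1 = b"

definition null_homotopic_loop :: "'a topology \<Rightarrow> 'a \<Rightarrow> (real \<Rightarrow> 'a) \<Rightarrow> bool" where
  "null_homotopic_loop X b \<alpha> \<longleftrightarrow>
     homotopic_with (\<lambda>\<gamma>. \<gamma> 0 = b \<and> \<gamma> 1 = b) (top_of_set {0..1}) X \<alpha> (\<lambda>_. b)"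

text \<open>The library's \<^const>\<open>covering_space\<close> for abstract topologies; as there, covering
  projections are onto, and the total space is not required to be connected.\<close>

definition covering_projection :: "'a topology \<Rightarrow> 'b topology \<Rightarrow> ('a \<Rightarrow> 'b) \<Rightarrow> bool" where
  "covering_projection E X p \<longleftrightarrow>
     continuous_map E X p \<and> p ` topspace E = topspace X \<and>
     (\<forall>x\<in>topspace X. \<exists>U. x \<in> U \<and> openin X U \<and>
        (\<exists>\<V>. \<Union>\<V> = {e \<in> topspace E. p e \<in> U} \<and>
             (\<forall>V\<in>\<V>. openin E V) \<and> pairwise disjnt \<V> \<and>
             (\<forall>V\<in>\<V>. homeomorphic_map (subtopology E V) (subtopology X U) p)))"

lemma covering_projection_top_of_set:
  "covering_projection (top_of_set C) (top_of_set S) p \<longleftrightarrow> covering_space C p S"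
proof -
  have hom: "homeomorphic_map (subtopology (top_of_set C) V) (subtopology (top_of_set S) U) p
      \<longleftrightarrow> (\<exists>q. homeomorphism V U p q)"
    if "openin (top_of_set C) V" "openin (top_of_set S) U" for V U
  proof -
    have top: "subtopology (top_of_set C) V = top_of_set V"
      "subtopology (top_of_set S) U = top_of_set U"
      using that openin_imp_subset by (fastforce simp: subtopology_subtopology Int_absorb1)+
    have "homeomorphic_maps (top_of_set V) (top_of_set U) p q \<longleftrightarrow> homeomorphism V U p q" for q
    proof
      assume "homeomorphic_maps (top_of_set V) (top_of_set U) p q"
      then have "continuous_on V p" "continuous_on U q" "p ` V \<subseteq> U" "q ` U \<subseteq> V"
        "\<And>x. x \<in> V \<Longrightarrow> q (p x) = x" "\<And>y. y \<in> U \<Longrightarrow> p (q y) = y"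
        by (auto simp: homeomorphic_maps_def)
      then show "homeomorphism V U p q" by (intro homeomorphismI) auto
    qed (auto simp: homeomorphic_maps_def homeomorphism_def)
    then show ?thesis by (simp add: top homeomorphic_map_maps)
  qed
  have pre: "{e \<in> C. p e \<in> U} = C \<inter> p -` U" for U
    by auto
  have "(\<forall>V\<in>\<V>. openin (top_of_set C) V) \<and> pairwise disjnt \<V> \<and>
        (\<forall>V\<in>\<V>. homeomorphic_map (subtopology (top_of_set C) V) (subtopology (top_of_set S) U) p)
    \<longleftrightarrow> (\<forall>V\<in>\<V>. openin (top_of_set C) V) \<and> pairwise disjnt \<V> \<and>
        (\<forall>V\<in>\<V>. \<exists>q. homeomorphism V U p q)"
    if "openin (top_of_set S) U" for U \<V>
    using hom[OF _ that] by (auto 0 3)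
  then have sheets: "openin (top_of_set S) U \<and>
        (\<exists>\<V>. \<Union>\<V> = C \<inter> p -` U \<and> (\<forall>V\<in>\<V>. openin (top_of_set C) V) \<and> pairwise disjnt \<V> \<and>
          (\<forall>V\<in>\<V>. homeomorphic_map (subtopology (top_of_set C) V) (subtopology (top_of_set S) U) p))
    \<longleftrightarrow> openin (top_of_set S) U \<and>
        (\<exists>\<V>. \<Union>\<V> = C \<inter> p -` U \<and> (\<forall>V\<in>\<V>. openin (top_of_set C) V) \<and> pairwise disjnt \<V> \<and>
          (\<forall>V\<in>\<V>. \<exists>q. homeomorphism V U p q))" for U
    by (simp cong: conj_cong)
  have cont: "continuous_map (top_of_set C) (top_of_set S) p \<and> p ` C = S
      \<longleftrightarrow> continuous_on C p \<and> p ` C = S"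
    by auto
  have split: "A \<and> B \<and> P \<longleftrightarrow> A' \<and> B \<and> P" if "A \<and> B \<longleftrightarrow> A' \<and> B" for A A' B P
    using that by blast
  show ?thesis
    unfolding covering_projection_def covering_space_def topspace_euclidean_subtopology pre sheets
    by (rule split[OF cont])
qed

definition pointed_covering :: "'a topology \<Rightarrow> 'a \<Rightarrow> 'b topology \<Rightarrow> 'b \<Rightarrow> ('a \<Rightarrow> 'b) \<Rightarrow> bool" where
  "pointed_covering E e X x p \<longleftrightarrow> covering_projection E X p \<and> e \<in> topspace E \<and> p e = x"

definition is_lift ::
    "'a topology \<Rightarrow> 'a \<Rightarrow> ('a \<Rightarrow> 'b) \<Rightarrow> (real \<Rightarrow> 'b) \<Rightarrow> (real \<Rightarrow> 'a) \<Rightarrow> bool" where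
  "is_lift E e p \<alpha> \<alpha>' \<longleftrightarrow> pathin E \<alpha>' \<and> \<alpha>' 0 = e \<and> (\<forall>t\<in>{0..1}. p (\<alpha>' t) = \<alpha> t)"


section \<open>The mapping torus of the earring shift\<close>

type_synonym torus_point = "((real \<times> real) \<times> real) set"

definition earring_torus :: "torus_point topology" where
  "earring_torus = mapping_torus earring_top earring_shift"

definition earring_torus_incl :: "real \<times> real \<Rightarrow> torus_point" where
  "earring_torus_incl x = mapping_torus_proj earring_top earring_shift (x, 0)"

definition earring_torus_base :: torus_point where
  "earring_torus_base = earring_torus_incl (0, 0)"

text \<open>HOL cannot quantify existentially over types, so covering spaces whose existence is claimed
  need a fixed point type. A connected covering space of the torus, and a connected covering
  space of such a space, have at most continuum many points over each torus point, so
  up to homeomorphism their points are pairs of a torus point and a real label. The topology on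
  these pairs is arbitrary, so nothing is lost by this choice.\<close>

type_synonym cover_point = "torus_point \<times> real"

end

theory Submission
  imports Defs
begin

text \<open>
  The earring flows forward through the mapping torus, and after \<open>n\<close> turns it has shrunk into the union
  of the circles beyond the \<open>n\<close>-th. So a loop in the earring is freely homotopic, with its base point
  moving around the torus, to a loop inside an evenly covered set, whose lifts are closed; this gives (a).

  For (b), the first covering is the infinite cyclic one. If the lift of \<open>\<alpha>\<close> to it is closed, flow the lift
  up to a level \<open>K\<close> above its image; it becomes a loop \<open>\<beta>\<close> in the earring that is essential there. Since the
  shift has the left inverse \<open>collapse\<close>, this flow extends to a map from the whole infinite cyclic covering
  to the earring, along which coverings of the earring can be pulled back. For every \<open>n\<close>, use the covering
  whose fibre consists of the reduced words in the first \<open>n\<close> circles. If the lift of \<open>\<beta>\<close> is closed in each of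
  them, the finitely many passages of \<open>\<beta>\<close> through the first \<open>n\<close> circles have a noncrossing cancelling
  matching for every \<open>n\<close>; by compactness there is one for all circles at once, and sweeping out the strips
  between matched passages contracts \<open>\<beta>\<close>.
\<close>

section \<open>Lifting in covering projections\<close>

text \<open>Every covering of the torus is even over a neighbourhood of the base point, which
  contains all late circles, and the flow carries every loop of the earring there; so no single
  covering can separate a loop of \<open>earring\<close>. The infinite cyclic covering unwinds the
  flow, and its own coverings are free of this constraint. That is why two coverings are needed, and
  why the second one depends on the loop through \<open>K\<close> and \<open>n\<close>. The obstacle
  in contracting \<open>\<beta>\<close> is that it may leave the base point infinitely often, in an
  order as complicated as that of the gaps of a Cantor set, so its word cannot be reduced letter by
  letter. Two facts keep this under control: only finitely many excursions reach the middle half of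
  a given circle, and the \<open>m\<close>-th circle has diameter 2/m. The first makes compactness
  applicable, the second makes maps assembled circle by circle continuous. Matchings are used
  instead of cancellation sequences because they restrict to fewer circles unchanged and so pass to
  the limit. Excursions that stay near the base point are removed beforehand by stretching.\<close>

lemma evenly_covered:
  assumes p: "covering_projection E X p" and x: "x \<in> topspace X"
  obtains U \<V> where "x \<in> U" "openin X U" "\<Union>\<V> = {e \<in> topspace E. p e \<in> U}"
    "\<And>V. V \<in> \<V> \<Longrightarrow> openin E V" "pairwise disjnt \<V>"
    "\<And>V. V \<in> \<V> \<Longrightarrow> homeomorphic_map (subtopology E V) (subtopology X U) p"
proof -
  have "\<exists>U. x \<in> U \<and> openin X U \<and> (\<exists>\<V>. \<Union>\<V> = {e \<in> topspace E. p e \<in> U} \<and>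
       (\<forall>V\<in>\<V>. openin E V) \<and> pairwise disjnt \<V> \<and>
       (\<forall>V\<in>\<V>. homeomorphic_map (subtopology E V) (subtopology X U) p))"
    using p x unfolding covering_projection_def by simp
  then obtain U \<V> where "x \<in> U" "openin X U" "\<Union>\<V> = {e \<in> topspace E. p e \<in> U}"
    "\<forall>V\<in>\<V>. openin E V" "pairwise disjnt \<V>"
    "\<forall>V\<in>\<V>. homeomorphic_map (subtopology E V) (subtopology X U) p"
    by (elim exE conjE)
  then show thesis by (intro that) (assumption | erule (1) bspec)+
qed

lemma covering_projection_continuous: "covering_projection E X p \<Longrightarrow> continuous_map E X p"
  by (simp add: covering_projection_def)

lemma covering_projection_id: "covering_projection X X id"
proof -
  have "\<exists>U. x \<in> U \<and> openin X U \<and> (\<exists>\<V>. \<Union>\<V> = {e \<in> topspace X. id e \<in> U} \<and>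
       (\<forall>V\<in>\<V>. openin X V) \<and> pairwise disjnt \<V> \<and>
       (\<forall>V\<in>\<V>. homeomorphic_map (subtopology X V) (subtopology X U) id))"
    if "x \<in> topspace X" for x
    using that by (intro exI[of _ "topspace X"] conjI exI[of _ "{topspace X}"]) auto
  then show ?thesis unfolding covering_projection_def by simp
qed

lemma homeomorphic_map_subtopologyD:
  assumes "homeomorphic_map (subtopology E V) (subtopology X U) p" "openin E V" "openin X U"
  shows "inj_on p V" and "p ` V = U"
proof -
  have "topspace (subtopology E V) = V" "topspace (subtopology X U) = U"
    using assms(2,3) by (auto dest: openin_subset)
  then show "inj_on p V" "p ` V = U"
    using assms(1) by (auto simp: homeomorphic_map_def quotient_map_def)
qed

lemma covering_lift_unique:
  assumes p: "covering_projection E X p" and Y: "connected_space Y"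
    and g: "continuous_map Y E g" and g': "continuous_map Y E g'"
    and eq: "\<And>y. y \<in> topspace Y \<Longrightarrow> p (g y) = p (g' y)"
    and y0: "y0 \<in> topspace Y" "g y0 = g' y0" and y: "y \<in> topspace Y"
  shows "g y = g' y"
proof -
  let ?A = "{y \<in> topspace Y. g y = g' y}"
  \<comment> \<open>Agreement and disagreement are both open: on one sheet \<open>p\<close> is
    injective, and distinct sheets are disjoint.\<close>
  have nb: "\<exists>N. openin Y N \<and> y \<in> N \<and> (N \<subseteq> ?A \<or> N \<inter> ?A = {})" if y: "y \<in> topspace Y" for y
  proof -
    have gy: "g y \<in> topspace E" "g' y \<in> topspace E"
      using g g' y by (auto simp: continuous_map_def)
    then have py: "p (g y) \<in> topspace X"
      using covering_projection_continuous[OF p] by (auto simp: continuous_map_def)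
    obtain U \<V> where U: "p (g y) \<in> U" "openin X U" and V: "\<Union>\<V> = {e \<in> topspace E. p e \<in> U}"
      and ope: "\<And>V. V \<in> \<V> \<Longrightarrow> openin E V" and disj: "pairwise disjnt \<V>"
      and hom: "\<And>V. V \<in> \<V> \<Longrightarrow> homeomorphic_map (subtopology E V) (subtopology X U) p"
      using evenly_covered[OF p py] by blast
    have "g y \<in> \<Union>\<V>" "g' y \<in> \<Union>\<V>" using V U gy eq[OF y] by auto
    then obtain V V' where VV: "V \<in> \<V>" "V' \<in> \<V>" "g y \<in> V" "g' y \<in> V'" by blast
    define N where "N = {y \<in> topspace Y. g y \<in> V} \<inter> {y \<in> topspace Y. g' y \<in> V'}"
    have N: "openin Y N" unfolding N_def
      using g g' VV ope by (intro openin_Int openin_continuous_map_preimage) auto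
    have yN: "y \<in> N" using y VV by (simp add: N_def)
    show ?thesis
    proof (cases "V = V'")
      case True
      have "inj_on p V" using homeomorphic_map_subtopologyD(1)[OF hom[OF VV(1)] ope[OF VV(1)] U(2)] .
      then have "N \<subseteq> ?A" using True eq by (auto simp: N_def dest: inj_onD)
      then show ?thesis using N yN by blast
    next
      case False
      then have "disjnt V V'" using disj VV by (meson pairwiseD)
      then have "N \<inter> ?A = {}" by (auto simp: N_def disjnt_iff)
      then show ?thesis using N yN by blast
    qed
  qed
  have "openin Y ?A"
    by (subst openin_subopen) (use nb in blast)
  moreover have "openin Y (topspace Y - ?A)"
  proof (subst openin_subopen, intro ballI)
    fix y assume y: "y \<in> topspace Y - ?A"
    then obtain N where N: "openin Y N" "y \<in> N" "N \<subseteq> ?A \<or> N \<inter> ?A = {}" using nb by blast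
    then have "N \<subseteq> topspace Y - ?A" using y openin_subset[OF N(1)] by blast
    then show "\<exists>T. openin Y T \<and> y \<in> T \<and> T \<subseteq> topspace Y - ?A" using N by blast
  qed
  moreover have "?A \<subseteq> topspace Y" by blast
  ultimately have "?A = {} \<or> ?A = topspace Y"
    using Y unfolding connected_space_clopen_in closedin_def by blast
  then show ?thesis using y0 y by blast
qed

definition lifts_on :: "'e topology \<Rightarrow> ('e \<Rightarrow> 'x) \<Rightarrow> ('a::topological_space \<Rightarrow> 'x) \<Rightarrow> 'a set \<Rightarrow> bool" where
  "lifts_on E p H S \<longleftrightarrow> (\<forall>y\<in>S. \<forall>e\<in>topspace E. p e = H y \<longrightarrow>
     (\<exists>g. continuous_map (top_of_set S) E g \<and> g y = e \<and> (\<forall>z\<in>S. p (g z) = H z)))"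

lemma lifts_onE:
  assumes "lifts_on E p H S" "y \<in> S" "e \<in> topspace E" "p e = H y"
  obtains g where "continuous_map (top_of_set S) E g" "g y = e" "\<forall>z\<in>S. p (g z) = H z"
proof -
  have "\<exists>g. continuous_map (top_of_set S) E g \<and> g y = e \<and> (\<forall>z\<in>S. p (g z) = H z)"
    using assms(1)[unfolded lifts_on_def, THEN bspec, OF assms(2), THEN bspec, OF assms(3)] assms(4) ..
  then show thesis using that by (elim exE conjE) simp
qed

text \<open>The lift is the local section \<open>q\<close> belonging to the sheet through
  \<open>e\<close>, applied after \<open>H\<close>. The factorisation \<open>g = q \<circ> H\<close>
  is kept because it shows that a closed path inside an evenly covered set has closed lifts.\<close>

lemma lifts_on_evenly_covered:
  assumes V: "\<Union>\<V> = {e \<in> topspace E. p e \<in> U}" and U: "openin X U"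
    and ope: "\<And>V. V \<in> \<V> \<Longrightarrow> openin E V"
    and hom: "\<And>V. V \<in> \<V> \<Longrightarrow> homeomorphic_map (subtopology E V) (subtopology X U) p"
    and H: "continuous_map (top_of_set S) X H" "H ` S \<subseteq> U"
    and y: "y \<in> S" "e \<in> topspace E" "p e = H y"
  obtains g q where "continuous_map (top_of_set S) E g" "g y = e" "\<And>z. z \<in> S \<Longrightarrow> p (g z) = H z"
     "g = q \<circ> H"
proof -
  have HU: "H z \<in> U" if "z \<in> S" for z using H(2) that by blast
  then have "e \<in> \<Union>\<V>" using V y by simp
  then obtain W where W: "W \<in> \<V>" "e \<in> W" by blast
  have tops: "topspace (subtopology E W) = W" "topspace (subtopology X U) = U"
    using ope[OF W(1)] U by (auto dest: openin_subset)
  obtain q where "homeomorphic_maps (subtopology E W) (subtopology X U) p q"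
    using hom[OF W(1)] by (auto simp: homeomorphic_map_maps)
  then have q: "continuous_map (subtopology X U) (subtopology E W) q" "\<And>e. e \<in> W \<Longrightarrow> q (p e) = e"
     "\<And>x. x \<in> U \<Longrightarrow> p (q x) = x"
    by (auto simp: homeomorphic_maps_def tops simp del: topspace_subtopology)
  have "continuous_map (top_of_set S) (subtopology X U) H"
    using H by (auto simp: continuous_map_in_subtopology)
  from continuous_map_compose[OF this q(1)] have c: "continuous_map (top_of_set S) E (q \<circ> H)"
    by (simp add: continuous_map_in_subtopology)
  show thesis
  proof (rule that[OF c])
    show "(q \<circ> H) y = e" using q(2)[OF W(2)] y(3) by simp
    show "p ((q \<circ> H) z) = H z" if "z \<in> S" for z using q(3) HU that by simp
  qed simp
qed

lemma lifts_on_local: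
  assumes p: "covering_projection E X p" and x: "x \<in> topspace X"
  obtains U where "openin X U" "x \<in> U"
    "\<And>(H :: 'a::topological_space \<Rightarrow> _) S. continuous_map (top_of_set S) X H \<Longrightarrow> H ` S \<subseteq> U \<Longrightarrow> lifts_on E p H S"
proof -
  obtain U \<V> where U: "x \<in> U" "openin X U" and V: "\<Union>\<V> = {e \<in> topspace E. p e \<in> U}"
      and ope: "\<And>V. V \<in> \<V> \<Longrightarrow> openin E V" and disj: "pairwise disjnt \<V>"
      and hom: "\<And>V. V \<in> \<V> \<Longrightarrow> homeomorphic_map (subtopology E V) (subtopology X U) p"
      using evenly_covered[OF p x] by blast
  show thesis
  proof (rule that[OF U(2,1)])
    fix H :: "'a \<Rightarrow> _" and S assume H: "continuous_map (top_of_set S) X H" "H ` S \<subseteq> U"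
    show "lifts_on E p H S" unfolding lifts_on_def
    proof (intro ballI impI)
      fix y e assume y: "y \<in> S" "e \<in> topspace E" "p e = H y"
      show "\<exists>g. continuous_map (top_of_set S) E g \<and> g y = e \<and> (\<forall>z\<in>S. p (g z) = H z)"
        by (rule lifts_on_evenly_covered[OF V U(2) ope hom H y]) blast+
    qed
  qed
qed

text \<open>The lift over one piece is started at the value of the other at a common point. Since
  the overlap is connected, uniqueness of lifts makes the two agree on all of it.\<close>

lemma lifts_on_glue:
  fixes H :: "'a::topological_space \<Rightarrow> _"
  assumes p: "covering_projection E X p" and H: "continuous_map (top_of_set (A \<union> B)) X H"
    and AB: "closed A" "closed B" "connected (A \<inter> B)" "A \<inter> B \<noteq> {}"
    and A: "lifts_on E p H A" and B: "lifts_on E p H B"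
  shows "lifts_on E p H (A \<union> B)"
proof -
  have main: "\<exists>g. continuous_map (top_of_set (A \<union> B)) E g \<and> g y = e \<and> (\<forall>z\<in>A \<union> B. p (g z) = H z)"
    if AB: "closed A" "closed B" "connected (A \<inter> B)" "A \<inter> B \<noteq> {}"
      and A: "lifts_on E p H A" and B: "lifts_on E p H B"
      and y: "y \<in> A" "e \<in> topspace E" "p e = H y" for A B :: "'a set" and y e
  proof -
    obtain g where g: "continuous_map (top_of_set A) E g" "g y = e" "\<forall>z\<in>A. p (g z) = H z"
      by (rule lifts_onE[OF A y])
    obtain w where w: "w \<in> A" "w \<in> B" using AB by blast
    have gw: "g w \<in> topspace E" using g(1) w by (auto simp: continuous_map_def)
    obtain g' where g': "continuous_map (top_of_set B) E g'" "g' w = g w" "\<forall>z\<in>B. p (g' z) = H z"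
      by (rule lifts_onE[OF B w(2) gw g(3)[THEN bspec, OF w(1)]])
    have agree: "g z = g' z" if "z \<in> A \<inter> B" for z
    proof (rule covering_lift_unique[OF p, of "top_of_set (A \<inter> B)" g g' w])
      show "connected_space (top_of_set (A \<inter> B))"
        using AB(3) connectedin_iff_connected[of "A \<inter> B"] by (simp add: connectedin_def)
      show "continuous_map (top_of_set (A \<inter> B)) E g" "continuous_map (top_of_set (A \<inter> B)) E g'"
        by (rule continuous_map_from_subtopology_mono[OF g(1)] continuous_map_from_subtopology_mono[OF g'(1)]; blast)+
      show "p (g y) = p (g' y)" if "y \<in> topspace (top_of_set (A \<inter> B))" for y
        using g(3) g'(3) that by simp
    qed (use w g'(2) that in simp_all)
    define k where "k z = (if z \<in> A then g z else g' z)" for z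
    have "continuous_map (top_of_set (A \<union> B)) E k"
    proof (rule pasting_lemma_closed[of "{True, False}" _ "\<lambda>b. if b then A else B" _ "\<lambda>b. if b then g else g'"])
      have "subtopology (top_of_set (A \<union> B)) A = top_of_set A"
        "subtopology (top_of_set (A \<union> B)) B = top_of_set B"
        by (simp_all add: subtopology_subtopology Int_absorb1)
      then show "continuous_map (subtopology (top_of_set (A \<union> B)) (if i then A else B)) E (if i then g else g')" for i
        using g g' by simp
    qed (use AB agree in \<open>auto simp: k_def closedin_closed_eq closed_subset\<close>)
    then show ?thesis using g g' y agree by (intro exI[of _ k]) (auto simp: k_def)
  qed
  show ?thesis unfolding lifts_on_def
  proof (intro ballI impI)
    fix y e assume y: "y \<in> A \<union> B" "e \<in> topspace E" "p e = H y"
    show "\<exists>g. continuous_map (top_of_set (A \<union> B)) E g \<and> g y = e \<and> (\<forall>z\<in>A \<union> B. p (g z) = H z)"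
    proof (cases "y \<in> A")
      case True then show ?thesis by (rule main[OF AB A B _ y(2,3)])
    next
      case False
      then have "y \<in> B" using y by blast
      from main[OF AB(2,1) _ _ B A this y(2,3)] show ?thesis using AB by (simp add: Int_commute Un_commute)
    qed
  qed
qed

section \<open>Lifting maps of the unit square, and paths as a special case\<close>

lemma unit_interval_Bolzano:
  fixes P :: "real \<Rightarrow> real \<Rightarrow> bool"
  assumes trans: "\<And>a b c. 0 \<le> a \<Longrightarrow> a \<le> b \<Longrightarrow> b \<le> c \<Longrightarrow> c \<le> 1 \<Longrightarrow> P a b \<Longrightarrow> P b c \<Longrightarrow> P a c"
    and local: "\<And>x. 0 \<le> x \<Longrightarrow> x \<le> 1 \<Longrightarrow>
      \<exists>d>0. \<forall>a b. 0 \<le> a \<and> a \<le> x \<and> x \<le> b \<and> b \<le> 1 \<and> b - a < d \<longrightarrow> P a b"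
  shows "P 0 1"
proof -
  \<comment> \<open>The local condition of \<open>Bolzano\<close> allows endpoints outside [0,1].
    Clamping them with \<open>k\<close> neither moves points of [0,1] nor lengthens intervals, so
    the local assumption still applies.\<close>
  define k where "k x = max 0 (min 1 x)" for x :: real
  have "P (k 0) (k 1)"
  proof (rule Bolzano[where P = "\<lambda>a b. P (k a) (k b)"])
    fix a b c :: real assume "P (k a) (k b)" "P (k b) (k c)" "a \<le> b" "b \<le> c"
    then show "P (k a) (k c)" by (intro trans[of "k a" "k b" "k c"]) (auto simp: k_def)
  next
    fix x :: real assume x: "0 \<le> x" "x \<le> 1"
    then obtain d where d: "d > 0" "\<And>a b. 0 \<le> a \<and> a \<le> x \<and> x \<le> b \<and> b \<le> 1 \<and> b - a < d \<Longrightarrow> P a b"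
      using local by metis
    show "\<exists>d>0. \<forall>a b. a \<le> x \<and> x \<le> b \<and> b - a < d \<longrightarrow> P (k a) (k b)"
      using x by (intro exI[of _ d] conjI allI impI d) (auto simp: k_def)
  qed simp
  then show ?thesis by (simp add: k_def)
qed

text \<open>Two nested subdivisions: along the first coordinate for thin strips around a fixed
  height, then along the second coordinate. The strip height is existentially quantified in the
  inner one, so that the minimum of two heights serves for the union of two rectangles.\<close>

lemma lifts_on_square:
  fixes H :: "real \<times> real \<Rightarrow> 'x"
  assumes p: "covering_projection E X p" and H: "continuous_map (top_of_set ({0..1} \<times> {0..1})) X H"
  shows "lifts_on E p H ({0..1} \<times> {0..1})"
proof -
  let ?I = "{0..1::real}"
  define R where "R a b c d = lifts_on E p H ({a..b} \<times> {c..d})" for a b c d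
  have Hsub: "continuous_map (top_of_set S) X H" if "S \<subseteq> ?I \<times> ?I" for S
    using H that by (metis continuous_map_from_subtopology_mono)
  have strip: "\<exists>\<delta>>0. \<forall>c d. 0 \<le> c \<and> c \<le> s \<and> s \<le> d \<and> d \<le> 1 \<and> d - c < \<delta> \<longrightarrow> R 0 1 c d"
    if s: "0 \<le> s" "s \<le> 1" for s
  proof (rule unit_interval_Bolzano[where P = "\<lambda>a b. \<exists>\<delta>>0. \<forall>c d. 0 \<le> c \<and> c \<le> s \<and> s \<le> d \<and> d \<le> 1 \<and> d - c < \<delta> \<longrightarrow> R a b c d"])
    fix a b c :: real
    assume abc: "0 \<le> a" "a \<le> b" "b \<le> c" "c \<le> 1"
    assume "\<exists>\<delta>>0. \<forall>c d. 0 \<le> c \<and> c \<le> s \<and> s \<le> d \<and> d \<le> 1 \<and> d - c < \<delta> \<longrightarrow> R a b c d"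
    then obtain \<delta>1 where d1: "\<delta>1 > 0" "\<And>c d. 0 \<le> c \<and> c \<le> s \<and> s \<le> d \<and> d \<le> 1 \<and> d - c < \<delta>1 \<Longrightarrow> R a b c d"
      by blast
    assume "\<exists>\<delta>>0. \<forall>c' d. 0 \<le> c' \<and> c' \<le> s \<and> s \<le> d \<and> d \<le> 1 \<and> d - c' < \<delta> \<longrightarrow> R b c c' d"
    then obtain \<delta>2 where d2: "\<delta>2 > 0" "\<And>c' d. 0 \<le> c' \<and> c' \<le> s \<and> s \<le> d \<and> d \<le> 1 \<and> d - c' < \<delta>2 \<Longrightarrow> R b c c' d"
      by blast
    show "\<exists>\<delta>>0. \<forall>c' d. 0 \<le> c' \<and> c' \<le> s \<and> s \<le> d \<and> d \<le> 1 \<and> d - c' < \<delta> \<longrightarrow> R a c c' d"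
    proof (intro exI[of _ "min \<delta>1 \<delta>2"] conjI allI impI)
      fix c' d assume cd: "0 \<le> c' \<and> c' \<le> s \<and> s \<le> d \<and> d \<le> 1 \<and> d - c' < min \<delta>1 \<delta>2"
      have un: "{a..b} \<times> {c'..d} \<union> {b..c} \<times> {c'..d} = {a..c} \<times> {c'..d}" using abc by auto
      have int: "{a..b} \<times> {c'..d} \<inter> {b..c} \<times> {c'..d} = {b} \<times> {c'..d}" using abc by auto
      have "lifts_on E p H ({a..b} \<times> {c'..d} \<union> {b..c} \<times> {c'..d})"
      proof (rule lifts_on_glue[OF p])
        show "connected ({a..b} \<times> {c'..d} \<inter> {b..c} \<times> {c'..d})"
          unfolding int by (intro connected_Times) auto
        show "{a..b} \<times> {c'..d} \<inter> {b..c} \<times> {c'..d} \<noteq> {}" unfolding int using cd s by auto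
        show "lifts_on E p H ({a..b} \<times> {c'..d})" "lifts_on E p H ({b..c} \<times> {c'..d})"
          using d1(2)[of c' d] d2(2)[of c' d] cd by (simp_all add: R_def)
        show "continuous_map (top_of_set ({a..b} \<times> {c'..d} \<union> {b..c} \<times> {c'..d})) X H"
          unfolding un by (rule Hsub) (use abc cd in auto)
      qed (auto intro!: closed_Times)
      then show "R a c c' d" unfolding R_def un .
    qed (use d1 d2 in auto)
  next
    fix t :: real assume t: "0 \<le> t" "t \<le> 1"
    have "H (t, s) \<in> topspace X" using H t s by (auto simp: continuous_map_def)
    then obtain U where U: "openin X U" "H (t, s) \<in> U"
      "\<And>(H :: real \<times> real \<Rightarrow> _) S. continuous_map (top_of_set S) X H \<Longrightarrow> H ` S \<subseteq> U \<Longrightarrow> lifts_on E p H S"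
      using lifts_on_local[OF p] by metis
    have "openin (top_of_set (?I \<times> ?I)) {z \<in> ?I \<times> ?I. H z \<in> U}"
      using H U(1) by (auto simp: continuous_map_def)
    moreover have "(t, s) \<in> {z \<in> ?I \<times> ?I. H z \<in> U}" using t s U(2) by simp
    ultimately have "\<exists>\<epsilon>>0. \<forall>z\<in>?I \<times> ?I. dist z (t, s) < \<epsilon> \<longrightarrow> z \<in> {z \<in> ?I \<times> ?I. H z \<in> U}"
      unfolding openin_euclidean_subtopology_iff by (elim conjE) (rule bspec)
    then obtain \<epsilon> where e: "\<epsilon> > 0" "\<forall>z\<in>?I \<times> ?I. dist z (t, s) < \<epsilon> \<longrightarrow> z \<in> {z \<in> ?I \<times> ?I. H z \<in> U}"
      by (elim exE conjE) (rule that)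
    have "R a b c d" if ab: "0 \<le> a" "a \<le> t" "t \<le> b" "b \<le> 1" "b - a < \<epsilon>/2" 
      and cd: "0 \<le> c" "c \<le> s" "s \<le> d" "d \<le> 1" "d - c < \<epsilon>/2" for a b c d
      unfolding R_def
    proof (rule U(3))
      show "H ` ({a..b} \<times> {c..d}) \<subseteq> U"
      proof clarsimp
        fix u v assume *: "a \<le> u" "u \<le> b" "c \<le> v" "v \<le> d"
        have "dist (u, v) (t, s) \<le> \<bar>u - t\<bar> + \<bar>v - s\<bar>"
          unfolding dist_prod_def by (simp add: dist_real_def sqrt_sum_squares_le_sum_abs)
        also have "\<dots> < \<epsilon>" using ab cd * by linarith
        finally show "H (u, v) \<in> U" using e(2)[THEN bspec, of "(u, v)"] ab cd * by auto
      qed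
      show "continuous_map (top_of_set ({a..b} \<times> {c..d})) X H"
        by (rule Hsub) (use ab cd in auto)
    qed
    then show "\<exists>d>0. \<forall>a b. 0 \<le> a \<and> a \<le> t \<and> t \<le> b \<and> b \<le> 1 \<and> b - a < d \<longrightarrow>
       (\<exists>\<delta>>0. \<forall>c d. 0 \<le> c \<and> c \<le> s \<and> s \<le> d \<and> d \<le> 1 \<and> d - c < \<delta> \<longrightarrow> R a b c d)"
      using e(1) by (intro exI[of _ "\<epsilon>/2"] conjI allI impI) auto
  qed
  have "R 0 1 0 1"
  proof (rule unit_interval_Bolzano[where P = "\<lambda>c d. R 0 1 c d"])
    fix a b c :: real
    assume abc: "0 \<le> a" "a \<le> b" "b \<le> c" "c \<le> 1" and R: "R 0 1 a b" "R 0 1 b c"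
    have un: "{0..1} \<times> {a..b} \<union> {0..1} \<times> {b..c} = ?I \<times> {a..c}" using abc by auto
    have int: "{0..1} \<times> {a..b} \<inter> {0..1} \<times> {b..c} = ?I \<times> {b}" using abc by auto
    have "lifts_on E p H ({0..1} \<times> {a..b} \<union> {0..1} \<times> {b..c})"
    proof (rule lifts_on_glue[OF p])
      show "connected (?I \<times> {a..b} \<inter> ?I \<times> {b..c})"
        unfolding int by (intro connected_Times) auto
      show "?I \<times> {a..b} \<inter> ?I \<times> {b..c} \<noteq> {}" unfolding int by auto
      show "continuous_map (top_of_set (?I \<times> {a..b} \<union> ?I \<times> {b..c})) X H"
        unfolding un by (rule Hsub) (use abc in auto)
    qed (use R in \<open>auto intro!: closed_Times simp: R_def\<close>)
    then show "R 0 1 a c" unfolding R_def un .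
  qed (rule strip)
  then show ?thesis by (simp add: R_def)
qed

lemma connected_space_top_of_set: "connected S \<Longrightarrow> connected_space (top_of_set S)"
  using connectedin_iff_connected[of S] by (simp add: connectedin_def)

lemma path_lift_exists:
  assumes p: "covering_projection E X p" and g: "pathin X g" and e: "e \<in> topspace E" "p e = g 0"
  obtains g' where "is_lift E e p g g'"
proof -
  \<comment> \<open>The path is treated as a map of the square that is constant in the second
    coordinate; its lift is read off along the bottom edge.\<close>
  have "continuous_map (top_of_set ({0..1} \<times> {0..1})) X (g \<circ> (fst :: real \<times> real \<Rightarrow> real))"
  proof (rule continuous_map_compose[of _ "top_of_set {0..1::real}"])
    show "continuous_map (top_of_set ({0..1} \<times> {0..1})) (top_of_set {0..1::real}) fst"
      by (auto intro: continuous_intros)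
  qed (use g in \<open>simp add: pathin_def\<close>)
  then have "lifts_on E p (g \<circ> (fst :: real \<times> real \<Rightarrow> real)) ({0..1} \<times> {0..1})" by (rule lifts_on_square[OF p])
  moreover have "(0, 0) \<in> {0..1::real} \<times> {0..1::real}" "p e = (g \<circ> (fst :: real \<times> real \<Rightarrow> real)) (0, 0)" using e(2) by auto
  ultimately obtain L where L: "continuous_map (top_of_set ({0..1} \<times> {0..1})) E L"
    "L (0, 0) = e" "\<forall>z\<in>{0..1} \<times> {0..1}. p (L z) = (g \<circ> (fst :: real \<times> real \<Rightarrow> real)) z"
    using e(1) by (elim lifts_onE)
  have "pathin E (L \<circ> (\<lambda>t. (t, 0)))" unfolding pathin_def
    by (rule continuous_map_compose[OF _ L(1)]) (auto intro!: continuous_intros)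
  moreover have "p (L (t, 0)) = g t" if "t \<in> {0..1}" for t
    using L(3)[THEN bspec, of "(t, 0)"] that by simp
  ultimately show thesis using L(2) by (intro that[of "L \<circ> (\<lambda>t. (t, 0))"]) (simp add: is_lift_def)
qed

lemma path_lift_unique:
  assumes p: "covering_projection E X p" and g: "is_lift E e p a g" and g': "is_lift E e' p a g'"
    and t0: "t0 \<in> {0..1}" "g t0 = g' t0" and t: "t \<in> {0..1}"
  shows "g t = g' t"
proof (rule covering_lift_unique[OF p, of "top_of_set {0..1}" g g' t0])
  show "connected_space (top_of_set {0..1::real})" by (rule connected_space_top_of_set) simp
  show "p (g y) = p (g' y)" if "y \<in> topspace (top_of_set {0..1})" for y
    using g g' that by (simp add: is_lift_def)
qed (use assms in \<open>simp_all add: is_lift_def pathin_def\<close>)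


section \<open>Coverings from charts\<close>

text \<open>Gluing data for a covering with discrete fibre \<open>F\<close>: the map
  \<open>\<psi> i x\<close> labels the fibre over \<open>x\<close>, and \<open>compat\<close> says
  that the change of labels between two charts is locally constant, separately for each label. The
  set \<open>S\<close> lies in a type chosen in advance.\<close>

locale covering_charts =
  fixes X :: "'b topology" and F :: "'f set" and I :: "'i set" and U :: "'i \<Rightarrow> 'b set"
    and \<psi> :: "'i \<Rightarrow> 'b \<Rightarrow> 'f \<Rightarrow> 'e" and p :: "'e \<Rightarrow> 'b" and S :: "'e set"
  assumes open_U: "i \<in> I \<Longrightarrow> openin X (U i)"
    and cover: "topspace X \<subseteq> (\<Union>i\<in>I. U i)"
    and p_total: "e \<in> S \<Longrightarrow> p e \<in> topspace X"
    and fibre: "i \<in> I \<Longrightarrow> x \<in> U i \<Longrightarrow> bij_betw (\<psi> i x) F {e \<in> S. p e = x}"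
    and compat: "i \<in> I \<Longrightarrow> j \<in> I \<Longrightarrow> z \<in> F \<Longrightarrow> z' \<in> F \<Longrightarrow>
        openin X {x \<in> U i \<inter> U j. \<psi> i x z = \<psi> j x z'}"
    and F_nonempty: "F \<noteq> {}"
begin

text \<open>The finest topology on \<open>S\<close> for which all local sections with a fixed label
  are continuous.\<close>

definition total_top :: "'e topology" where
  "total_top = topology (\<lambda>W. W \<subseteq> S \<and> (\<forall>i\<in>I. \<forall>z\<in>F. openin X {x \<in> U i. \<psi> i x z \<in> W}))"

lemma openin_total_top:
  "openin total_top W \<longleftrightarrow> W \<subseteq> S \<and> (\<forall>i\<in>I. \<forall>z\<in>F. openin X {x \<in> U i. \<psi> i x z \<in> W})"
proof -
  have "istopology (\<lambda>W. W \<subseteq> S \<and> (\<forall>i\<in>I. \<forall>z\<in>F. openin X {x \<in> U i. \<psi> i x z \<in> W}))"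
    unfolding istopology_def
  proof (intro conjI allI impI)
    fix A B
    assume A: "A \<subseteq> S \<and> (\<forall>i\<in>I. \<forall>z\<in>F. openin X {x \<in> U i. \<psi> i x z \<in> A})"
      and B: "B \<subseteq> S \<and> (\<forall>i\<in>I. \<forall>z\<in>F. openin X {x \<in> U i. \<psi> i x z \<in> B})"
    show "A \<inter> B \<subseteq> S" using A by blast
    show "\<forall>i\<in>I. \<forall>z\<in>F. openin X {x \<in> U i. \<psi> i x z \<in> A \<inter> B}"
    proof (intro ballI)
      fix i z assume "i \<in> I" "z \<in> F"
      then have "openin X ({x \<in> U i. \<psi> i x z \<in> A} \<inter> {x \<in> U i. \<psi> i x z \<in> B})"
        using A B by (intro openin_Int) simp_all
      moreover have "{x \<in> U i. \<psi> i x z \<in> A} \<inter> {x \<in> U i. \<psi> i x z \<in> B} = {x \<in> U i. \<psi> i x z \<in> A \<inter> B}"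
        by auto
      ultimately show "openin X {x \<in> U i. \<psi> i x z \<in> A \<inter> B}" by simp
    qed
  next
    fix K assume K: "\<forall>W\<in>K. W \<subseteq> S \<and> (\<forall>i\<in>I. \<forall>z\<in>F. openin X {x \<in> U i. \<psi> i x z \<in> W})"
    show "\<Union>K \<subseteq> S" using K by blast
    show "\<forall>i\<in>I. \<forall>z\<in>F. openin X {x \<in> U i. \<psi> i x z \<in> \<Union>K}"
    proof (intro ballI)
      fix i z assume "i \<in> I" "z \<in> F"
      then have "openin X (\<Union>W\<in>K. {x \<in> U i. \<psi> i x z \<in> W})"
        using K by (intro openin_Union) auto
      moreover have "(\<Union>W\<in>K. {x \<in> U i. \<psi> i x z \<in> W}) = {x \<in> U i. \<psi> i x z \<in> \<Union>K}" by auto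
      ultimately show "openin X {x \<in> U i. \<psi> i x z \<in> \<Union>K}" by simp
    qed
  qed
  then show ?thesis by (simp add: total_top_def topology_inverse')
qed

lemma chart_in: "i \<in> I \<Longrightarrow> x \<in> U i \<Longrightarrow> z \<in> F \<Longrightarrow> \<psi> i x z \<in> S"
  and p_chart: "i \<in> I \<Longrightarrow> x \<in> U i \<Longrightarrow> z \<in> F \<Longrightarrow> p (\<psi> i x z) = x"
  using bij_betwE[OF fibre] by auto

lemma chart_inj:
  "i \<in> I \<Longrightarrow> x \<in> U i \<Longrightarrow> z \<in> F \<Longrightarrow> z' \<in> F \<Longrightarrow> \<psi> i x z = \<psi> i x z' \<Longrightarrow> z = z'"
  using bij_betw_imp_inj_on[OF fibre] by (auto dest: inj_onD)

lemma chart_surj: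
  assumes "i \<in> I" "e \<in> S" "p e \<in> U i"
  obtains z where "z \<in> F" "e = \<psi> i (p e) z"
proof -
  have "e \<in> \<psi> i (p e) ` F"
    using bij_betw_imp_surj_on[OF fibre[OF assms(1,3)]] assms(2) by simp
  then show thesis using that by blast
qed

lemma U_subset: "i \<in> I \<Longrightarrow> U i \<subseteq> topspace X"
  using open_U openin_subset by blast

lemma topspace_total_top [simp]: "topspace total_top = S"
proof
  show "topspace total_top \<subseteq> S"
    using openin_total_top openin_topspace by blast
  have "{x \<in> U i. \<psi> i x z \<in> S} = U i" if "i \<in> I" "z \<in> F" for i z
    using chart_in[OF that(1) _ that(2)] by auto
  then have "openin total_top S"
    unfolding openin_total_top using open_U by simp
  then show "S \<subseteq> topspace total_top" by (rule openin_subset)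
qed

lemma openin_sheet:
  assumes "i \<in> I" "z \<in> F"
  shows "openin total_top ((\<lambda>x. \<psi> i x z) ` U i)"
  unfolding openin_total_top
proof (intro conjI ballI)
  show "(\<lambda>x. \<psi> i x z) ` U i \<subseteq> S" using chart_in assms by auto
  fix j z' assume j: "j \<in> I" "z' \<in> F"
  have "{x \<in> U j. \<psi> j x z' \<in> (\<lambda>x. \<psi> i x z) ` U i} = {x \<in> U i \<inter> U j. \<psi> i x z = \<psi> j x z'}" (is "?L = ?R")
  proof
    show "?L \<subseteq> ?R"
    proof
      fix x assume "x \<in> ?L"
      then obtain y where y: "x \<in> U j" "y \<in> U i" "\<psi> j x z' = \<psi> i y z" by auto
      then have "x = y" using p_chart assms j by metis
      then show "x \<in> ?R" using y by simp
    qed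
  qed (use assms j in \<open>auto intro: rev_image_eqI\<close>)
  then show "openin X {x \<in> U j. \<psi> j x z' \<in> (\<lambda>x. \<psi> i x z) ` U i}"
    using compat[OF assms(1) j(1) assms(2) j(2)] by simp
qed

lemma continuous_map_section:
  assumes "i \<in> I" "z \<in> F"
  shows "continuous_map (subtopology X (U i)) total_top (\<lambda>x. \<psi> i x z)"
  unfolding continuous_map_def
proof (intro conjI allI impI)
  show "(\<lambda>x. \<psi> i x z) \<in> topspace (subtopology X (U i)) \<rightarrow> topspace total_top"
    using chart_in assms by auto
  fix W assume "openin total_top W"
  then have "openin X {x \<in> U i. \<psi> i x z \<in> W}" using assms by (simp add: openin_total_top)
  moreover have "{x \<in> topspace (subtopology X (U i)). \<psi> i x z \<in> W} = {x \<in> U i. \<psi> i x z \<in> W}"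
    using U_subset assms by auto
  ultimately show "openin (subtopology X (U i)) {x \<in> topspace (subtopology X (U i)). \<psi> i x z \<in> W}"
    using open_U[OF assms(1)] by (auto simp: openin_open_subtopology)
qed

lemma continuous_map_from_total_top:
  assumes im: "\<And>e. e \<in> S \<Longrightarrow> g e \<in> topspace Y"
    and op: "\<And>i z W. i \<in> I \<Longrightarrow> z \<in> F \<Longrightarrow> openin Y W \<Longrightarrow> openin X {x \<in> U i. g (\<psi> i x z) \<in> W}"
  shows "continuous_map total_top Y g"
  unfolding continuous_map_def
proof (intro conjI allI impI)
  fix W assume W: "openin Y W"
  have "{x \<in> U i. \<psi> i x z \<in> {e \<in> S. g e \<in> W}} = {x \<in> U i. g (\<psi> i x z) \<in> W}" if "i \<in> I" "z \<in> F" for i z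
    using chart_in[OF that(1) _ that(2)] by auto
  then show "openin total_top {e \<in> topspace total_top. g e \<in> W}"
    unfolding openin_total_top using op[OF _ _ W] by simp
qed (use im in simp)

lemma covering_projection_total_top: "covering_projection total_top X p"
  unfolding covering_projection_def
proof (intro conjI ballI)
  show cp: "continuous_map total_top X p"
  proof (rule continuous_map_from_total_top)
    fix i z W assume *: "i \<in> I" "z \<in> F" "openin X W"
    have "{x \<in> U i. p (\<psi> i x z) \<in> W} = U i \<inter> W" using p_chart[OF *(1) _ *(2)] by auto
    then show "openin X {x \<in> U i. p (\<psi> i x z) \<in> W}" using * open_U by auto
  qed (use p_total in simp)
  show "p ` topspace total_top = topspace X"
  proof
    show "topspace X \<subseteq> p ` topspace total_top"
    proof
      fix x assume "x \<in> topspace X"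
      then obtain i where i: "i \<in> I" "x \<in> U i" using cover by blast
      obtain z where z: "z \<in> F" using F_nonempty by blast
      show "x \<in> p ` topspace total_top"
        using p_chart[OF i z] chart_in[OF i z] by (metis image_eqI topspace_total_top)
    qed
  qed (use p_total in auto)
  fix x assume "x \<in> topspace X"
  then obtain i where i: "i \<in> I" "x \<in> U i" using cover by blast
  define sheet where "sheet z = (\<lambda>x. \<psi> i x z) ` U i" for z
  have hom: "homeomorphic_map (subtopology total_top (sheet z)) (subtopology X (U i)) p" if z: "z \<in> F" for z
  proof -
    have ops: "openin total_top (sheet z)" unfolding sheet_def using openin_sheet[OF i(1) z] .
    have tops: "topspace (subtopology total_top (sheet z)) = sheet z" "topspace (subtopology X (U i)) = U i"
      using openin_subset[OF ops] U_subset[OF i(1)] by auto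
    show ?thesis
    proof (rule bijective_open_imp_homeomorphic_map)
      show "continuous_map (subtopology total_top (sheet z)) (subtopology X (U i)) p"
        unfolding continuous_map_in_subtopology
        using continuous_map_from_subtopology[OF cp] p_chart[OF i(1) _ z]
        by (auto simp: tops simp del: topspace_subtopology) (auto simp: sheet_def)
      show "p ` topspace (subtopology total_top (sheet z)) = topspace (subtopology X (U i))"
        unfolding tops using p_chart[OF i(1) _ z] by (auto simp: sheet_def image_image)
      show "inj_on p (topspace (subtopology total_top (sheet z)))"
        unfolding tops using p_chart[OF i(1) _ z] by (auto simp: sheet_def inj_on_def)
      show "open_map (subtopology total_top (sheet z)) (subtopology X (U i)) p"
        unfolding open_map_def
      proof (intro allI impI)
        fix W assume "openin (subtopology total_top (sheet z)) W"
        then have W: "openin total_top W" "W \<subseteq> sheet z" using ops by (auto simp: openin_open_subtopology)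
        have "p ` W = {x \<in> U i. \<psi> i x z \<in> W}"
        proof
          show "{x \<in> U i. \<psi> i x z \<in> W} \<subseteq> p ` W"
            using p_chart[OF i(1) _ z] by (auto intro: rev_image_eqI)
        qed (use W(2) p_chart[OF i(1) _ z] in \<open>auto simp: sheet_def\<close>)
        then show "openin (subtopology X (U i)) (p ` W)"
          using W(1) i z open_U by (auto simp: openin_open_subtopology openin_total_top)
      qed
    qed
  qed
  show "\<exists>U. x \<in> U \<and> openin X U \<and> (\<exists>\<V>. \<Union> \<V> = {e \<in> topspace total_top. p e \<in> U} \<and>
      (\<forall>V\<in>\<V>. openin total_top V) \<and> disjoint \<V> \<and>
      (\<forall>V\<in>\<V>. homeomorphic_map (subtopology total_top V) (subtopology X U) p))"
  proof (intro exI[of _ "U i"] conjI exI[of _ "sheet ` F"])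
    show "\<Union> (sheet ` F) = {e \<in> topspace total_top. p e \<in> U i}"
    proof
      show "\<Union> (sheet ` F) \<subseteq> {e \<in> topspace total_top. p e \<in> U i}"
        using chart_in[OF i(1)] p_chart[OF i(1)] by (auto simp: sheet_def)
      show "{e \<in> topspace total_top. p e \<in> U i} \<subseteq> \<Union> (sheet ` F)"
        by (auto simp: sheet_def elim!: chart_surj[OF i(1)])
    qed
    show "\<forall>V\<in>sheet ` F. openin total_top V" using openin_sheet[OF i(1)] by (auto simp: sheet_def)
    show "disjoint (sheet ` F)"
    proof (rule pairwiseI)
      fix V V' assume "V \<in> sheet ` F" "V' \<in> sheet ` F" "V \<noteq> V'"
      then obtain z z' where z: "z \<in> F" "z' \<in> F" "V = sheet z" "V' = sheet z'" by blast
      show "disjnt V V'"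
      proof (rule ccontr)
        assume "\<not> disjnt V V'"
        then obtain x y where xy: "x \<in> U i" "y \<in> U i" "\<psi> i x z = \<psi> i y z'"
          using z by (auto simp: disjnt_iff sheet_def)
        then have "x = y" using p_chart[OF i(1)] z by metis
        then have "z = z'" using chart_inj[OF i(1)] xy z by blast
        then show False using z \<open>V \<noteq> V'\<close> by simp
      qed
    qed
    show "\<forall>V\<in>sheet ` F. homeomorphic_map (subtopology total_top V) (subtopology X (U i)) p"
      using hom by blast
  qed (use i open_U in auto)
qed

text \<open>The section with label \<open>z\<close>, evaluated along \<open>p \<circ> g\<close>, is
  another lift of \<open>p \<circ> g\<close>. It meets \<open>g\<close> at \<open>y0\<close>, so
  uniqueness of lifts identifies the two.\<close>

lemma connected_in_sheet:
  assumes Y: "connected_space Y" and g: "continuous_map Y total_top g" and i: "i \<in> I"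
    and U: "\<And>y. y \<in> topspace Y \<Longrightarrow> p (g y) \<in> U i" and y0: "y0 \<in> topspace Y" "z \<in> F" "g y0 = \<psi> i (p (g y0)) z"
    and y: "y \<in> topspace Y"
  shows "g y = \<psi> i (p (g y)) z"
proof (rule covering_lift_unique[OF covering_projection_total_top Y g,
      where g' = "\<lambda>y. \<psi> i (p (g y)) z" and ?y0.0 = y0])
  have "continuous_map Y (subtopology X (U i)) (p \<circ> g)"
    using continuous_map_compose[OF g covering_projection_continuous[OF covering_projection_total_top]] U
    by (auto simp: continuous_map_in_subtopology)
  from continuous_map_compose[OF this continuous_map_section[OF i y0(2)]]
  show "continuous_map Y total_top (\<lambda>y. \<psi> i (p (g y)) z)" by (simp add: o_def)
  show "p (g y) = p (\<psi> i (p (g y)) z)" if "y \<in> topspace Y" for y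
    using p_chart[OF i U[OF that] y0(2)] by simp
qed (use y0 y in auto)

end


section \<open>The mapping torus and its infinite cyclic covering\<close>

locale self_map =
  fixes X :: "'a topology" and f :: "'a \<Rightarrow> 'a"
  assumes continuous_f: "continuous_map X X f"
begin

abbreviation cyl :: "('a \<times> real) topology" where
  "cyl \<equiv> prod_topology X (top_of_set {0..1})"

abbreviation T :: "('a \<times> real) set topology" where "T \<equiv> mapping_torus X f"

abbreviation h :: "'a \<times> real \<Rightarrow> ('a \<times> real) set" where "h \<equiv> mapping_torus_proj X f"

text \<open>Each generating identification joins a point at height 1 to one at height 0, so every
  class has exactly one representative of height below 1. This normal form replaces reasoning about
  the generated equivalence relation.\<close>

definition can :: "'a \<times> real \<Rightarrow> 'a \<times> real" where
  "can z = (if snd z = 1 then (f (fst z), 0) else z)"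

definition pt :: "('a \<times> real) set \<Rightarrow> 'a \<times> real" where
  "pt c = can (SOME z. z \<in> topspace cyl \<and> h z = c)"

lemma f_in: "x \<in> topspace X \<Longrightarrow> f x \<in> topspace X"
  using continuous_f by (auto simp: continuous_map_def)

lemma can_in: "z \<in> topspace cyl \<Longrightarrow> can z \<in> topspace cyl"
  using f_in by (auto simp: can_def)

text \<open>The map \<open>can\<close> is constant along generating identifications, and each point
  is related to its image under \<open>can\<close>; so it is a complete invariant of the
  classes.\<close>

lemma h_eq_iff:
  assumes "z \<in> topspace cyl" "z' \<in> topspace cyl"
  shows "h z = h z' \<longleftrightarrow> can z = can z'"
proof -
  define R where "R = {((x, 1::real), (f x, 0::real)) | x. x \<in> topspace X}"
  define r where "r = (R \<union> R\<inverse>)\<^sup>*"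
  have h: "h z = r `` {z}" for z
    by (simp add: mapping_torus_proj_def mapping_torus_rel_def r_def R_def Let_def)
  have sym: "sym r" unfolding r_def by (intro sym_rtrancl sym_Un_converse)
  have tr: "trans r" unfolding r_def by (rule trans_rtrancl)
  have *: "r `` {a} = r `` {b}" if "(a, b) \<in> r" for a b
    using that symD[OF sym that] transD[OF tr] by blast
  have to_can: "(z, can z) \<in> r" if "z \<in> topspace cyl" for z
  proof (cases "snd z = 1")
    case True
    then have "(z, can z) \<in> R" using that by (cases z) (auto simp: R_def can_def)
    then show ?thesis by (auto simp: r_def)
  qed (simp add: can_def r_def)
  have inv: "can z = can z'" if "(z, z') \<in> r" for z z'
    using that unfolding r_def
    by (induction rule: rtrancl_induct) (auto simp: R_def can_def)
  show ?thesis
  proof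
    assume "h z = h z'"
    then have "z' \<in> r `` {z}" unfolding h by (simp add: r_def)
    then show "can z = can z'" using inv by blast
  next
    assume "can z = can z'"
    then show "h z = h z'" using *[OF to_can[OF assms(1)]] *[OF to_can[OF assms(2)]] by (simp add: h)
  qed
qed

lemma quotient_h: "quotient_map cyl T h"
  by (rule quotient_map_mapping_torus_proj)

lemma continuous_h: "continuous_map cyl T h"
  by (rule quotient_imp_continuous_map[OF quotient_h])

lemma topspace_T: "topspace T = h ` topspace cyl"
  using quotient_imp_surjective_map[OF quotient_h] by simp

lemma h_in: "z \<in> topspace cyl \<Longrightarrow> h z \<in> topspace T"
  by (simp add: topspace_T)

lemma pt_h:
  assumes "z \<in> topspace cyl" shows "pt (h z) = can z"
proof -
  have "\<exists>w. w \<in> topspace cyl \<and> h w = h z" using assms by blast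
  then have "(SOME w. w \<in> topspace cyl \<and> h w = h z) \<in> topspace cyl \<and> h (SOME w. w \<in> topspace cyl \<and> h w = h z) = h z"
    by (rule someI_ex)
  then show ?thesis unfolding pt_def using h_eq_iff assms by blast
qed

lemma h_can: "z \<in> topspace cyl \<Longrightarrow> h (can z) = h z"
  using h_eq_iff can_in by (simp add: can_def)

lemma h_one: "x \<in> topspace X \<Longrightarrow> h (x, 1) = h (f x, 0)"
  using h_can[of "(x, 1)"] by (simp add: can_def)

lemma T_cases:
  assumes "c \<in> topspace T"
  obtains x s where "x \<in> topspace X" "0 \<le> s" "s < 1" "c = h (x, s)" "pt c = (x, s)"
proof -
  obtain z where z: "z \<in> topspace cyl" "c = h z" using assms topspace_T by blast
  obtain x s where xs: "can z = (x, s)" by (cases "can z")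
  have "s \<noteq> 1" using xs by (auto simp: can_def split: if_splits)
  then show thesis
    using can_in[OF z(1)] h_can[OF z(1)] pt_h[OF z(1)] xs z by (intro that[of x s]) auto
qed

lemma snd_pt_bounds:
  assumes "c \<in> topspace T"
  shows "0 \<le> snd (pt c)" "snd (pt c) < 1"
  by (rule T_cases[OF assms]; simp)+

lemma openin_T_iff: "W \<subseteq> topspace T \<Longrightarrow> openin T W \<longleftrightarrow> openin cyl {z \<in> topspace cyl. h z \<in> W}"
  using quotient_h unfolding quotient_map_def by blast

section \<open>The level of a torus point and the infinite cyclic covering\<close>

lemma openin_cyl_snd: "open V \<Longrightarrow> openin cyl {z \<in> topspace cyl. snd z \<in> V}"
proof -
  assume "open V"
  have "continuous_map cyl euclideanreal snd"
    using continuous_map_snd[of X "top_of_set {0..1::real}"] by (simp add: continuous_map_in_subtopology)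
  then show ?thesis by (rule openin_continuous_map_preimage) (use \<open>open V\<close> in simp)
qed

text \<open>The preimage in the cylinder is described by \<open>V\<close>, and there the heights 0
  and 1 both stand for level 0; hence the condition that compares \<open>V'\<close> with
  \<open>V\<close>.\<close>

lemma openin_T_level:
  assumes V: "open V" and eq: "\<And>s. 0 \<le> s \<Longrightarrow> s \<le> 1 \<Longrightarrow> (if s = 1 then 0 else s) \<in> V' \<longleftrightarrow> s \<in> V"
  shows "openin T {c \<in> topspace T. snd (pt c) \<in> V'}"
proof -
  have "{z \<in> topspace cyl. h z \<in> {c \<in> topspace T. snd (pt c) \<in> V'}} = {z \<in> topspace cyl. snd z \<in> V}"
  proof (intro Collect_cong conj_cong refl)
    fix z assume z: "z \<in> topspace cyl"
    then have "snd (pt (h z)) = (if snd z = 1 then 0 else snd z)" by (simp add: pt_h can_def)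
    then show "h z \<in> {c \<in> topspace T. snd (pt c) \<in> V'} \<longleftrightarrow> snd z \<in> V"
      using eq[of "snd z"] z h_in[OF z] by (cases z) auto
  qed
  then show ?thesis using openin_cyl_snd[OF V] by (subst openin_T_iff) auto
qed

text \<open>Levels form the circle of reals modulo 1, covered by two arcs: \<open>U True\<close>
  omits level 0 and \<open>U False\<close> omits level 1/2. On these arcs \<open>lev\<close> is a
  real-valued level, in (0,1) and in (-1/2,1/2) respectively.\<close>

definition U :: "bool \<Rightarrow> ('a \<times> real) set set" where
  "U i = {c \<in> topspace T. snd (pt c) \<noteq> (if i then 0 else 1/2)}"

definition lev :: "bool \<Rightarrow> ('a \<times> real) set \<Rightarrow> real" where
  "lev i c = (if i \<or> snd (pt c) < 1/2 then snd (pt c) else snd (pt c) - 1)"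

text \<open>The pullback of the covering of the circle by the line along the level map, i.e. the
  infinite cyclic covering. It is the mapping telescope of \<open>f\<close>, extended in both
  directions.\<close>

definition tele :: "(('a \<times> real) set \<times> real) set" where
  "tele = {(c, \<tau>). c \<in> topspace T \<and> frac \<tau> = snd (pt c)}"

lemma openin_U: "openin T (U i)"
proof (cases i)
  case True
  have "openin T {c \<in> topspace T. snd (pt c) \<in> - {0}}"
    by (rule openin_T_level[where V = "{0<..<1}"]) auto
  then show ?thesis using True by (simp add: U_def)
next
  case False
  have "openin T {c \<in> topspace T. snd (pt c) \<in> - {1/2}}"
    by (rule openin_T_level[where V = "- {1/2}"]) auto
  then show ?thesis using False by (simp add: U_def)
qed

lemma tele_charts:
  "covering_charts T (UNIV :: int set) (UNIV :: bool set) U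
     (\<lambda>i c k. (c, lev i c + of_int k)) fst tele"
proof
  show "topspace T \<subseteq> (\<Union>i\<in>UNIV. U i)" 
  proof
    fix c assume "c \<in> topspace T"
    then have "c \<in> U True \<or> c \<in> U False" by (auto simp: U_def)
    then show "c \<in> (\<Union>i\<in>UNIV. U i)" by blast
  qed
  show "fst e \<in> topspace T" if "e \<in> tele" for e using that by (auto simp: tele_def)
  show "openin T (U i)" for i by (rule openin_U)
  show "bij_betw (\<lambda>k. (c, lev i c + real_of_int k)) UNIV {e \<in> tele. fst e = c}" if c: "c \<in> U i" for i c
    unfolding bij_betw_def
  proof
    show "inj (\<lambda>k. (c, lev i c + real_of_int k))" by (auto simp: inj_on_def)
    have cT: "c \<in> topspace T" using c by (simp add: U_def)
    have s: "0 \<le> snd (pt c)" "snd (pt c) < 1" using snd_pt_bounds[OF cT] by auto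
    then have fs: "frac (snd (pt c)) = snd (pt c)" by (simp add: frac_eq)
    have lf: "frac (lev i c + of_int k) = snd (pt c)" for k
    proof (cases "i \<or> snd (pt c) < 1/2")
      case True then show ?thesis by (simp add: lev_def fs frac_add_of_int_right)
    next
      case False
      then have "lev i c + of_int k = snd (pt c) + of_int (k - 1)" by (simp add: lev_def)
      then show ?thesis by (metis fs frac_add_of_int_right)
    qed
    show "(\<lambda>k. (c, lev i c + real_of_int k)) ` UNIV = {e \<in> tele. fst e = c}"
    proof
      show "(\<lambda>k. (c, lev i c + real_of_int k)) ` UNIV \<subseteq> {e \<in> tele. fst e = c}"
        using lf cT by (auto simp: tele_def)
      show "{e \<in> tele. fst e = c} \<subseteq> (\<lambda>k. (c, lev i c + real_of_int k)) ` UNIV"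
      proof clarsimp
        fix \<tau> assume "(c, \<tau>) \<in> tele"
        then have "\<tau> = snd (pt c) + of_int \<lfloor>\<tau>\<rfloor>" by (auto simp: tele_def frac_def)
        then have "\<tau> = lev i c + of_int \<lfloor>\<tau>\<rfloor> \<or> \<tau> = lev i c + of_int (\<lfloor>\<tau>\<rfloor> + 1)" by (auto simp: lev_def)
        then show "(c, \<tau>) \<in> range (\<lambda>k. (c, lev i c + real_of_int k))" by blast
      qed
    qed
  qed
  show "openin T {c \<in> U i \<inter> U j. (c, lev i c + real_of_int k) = (c, lev j c + real_of_int k')}" for i j k k'
  proof (cases "i = j")
    case True
    then have "{c \<in> U i \<inter> U j. (c, lev i c + real_of_int k) = (c, lev j c + real_of_int k')} = (if k = k' then U i else {})"
      by auto
    then show ?thesis using openin_U by simp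
  next
    case False
    have main: "openin T {c \<in> U True \<inter> U False. lev True c + real_of_int k = lev False c + real_of_int k'}" for k k'
    proof -
      \<comment> \<open>On the overlap the two real levels agree below level 1/2 and differ by 1
        above it; this gives the two conditions on \<open>k\<close> and \<open>k'\<close>.\<close>
      define V where "V = (if k = k' then {0<..<1/2} else if k + 1 = k' then {1/2<..<1} else {} :: real set)"
      have "openin T {c \<in> topspace T. snd (pt c) \<in> V}"
        by (rule openin_T_level[where V = V]) (auto simp: V_def)
      moreover have "{c \<in> U True \<inter> U False. lev True c + real_of_int k = lev False c + real_of_int k'}
          = {c \<in> topspace T. snd (pt c) \<in> V}" (is "?L = ?R")
      proof (intro set_eqI)
        fix c
        show "c \<in> ?L \<longleftrightarrow> c \<in> ?R"
        proof (cases "c \<in> topspace T")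
          case True
          have s: "0 \<le> snd (pt c)" "snd (pt c) < 1" using snd_pt_bounds[OF True] by auto
          have "real_of_int k = real_of_int k' \<longleftrightarrow> k = k'" "real_of_int k + 1 = real_of_int k' \<longleftrightarrow> k + 1 = k'" by linarith+
          then show ?thesis using s True by (auto simp: U_def lev_def V_def)
        qed (auto simp: U_def)
      qed
      ultimately show ?thesis by simp
    qed
    show ?thesis
    proof (cases i)
      case True
      then show ?thesis using False main[of k k'] by simp
    next
      case i: False
      have "{c \<in> U i \<inter> U j. (c, lev i c + real_of_int k) = (c, lev j c + real_of_int k')}
        = {c \<in> U True \<inter> U False. lev True c + real_of_int k' = lev False c + real_of_int k}"
        using i False by auto
      then show ?thesis using main[of k' k] by simp
    qed
  qed
qed auto

sublocale tele: covering_charts T "UNIV :: int set" "UNIV :: bool set" U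
  "\<lambda>i c k. (c, lev i c + of_int k)" fst tele
  by (rule tele_charts)

abbreviation Tele :: "(('a \<times> real) set \<times> real) topology" where
  "Tele \<equiv> tele.total_top"

lemma h_in_tele:
  assumes "x \<in> topspace X" "0 \<le> s" "s \<le> 1"
  shows "(h (x, s), s + of_int k) \<in> tele"
proof -
  have xs: "(x, s) \<in> topspace cyl" using assms by simp
  show ?thesis
  proof (cases "s = 1")
    case True
    then have "s + of_int k = of_int (k + 1)" by simp
    then have "frac (s + of_int k) = 0" by (metis frac_of_int)
    then show ?thesis using True xs h_in[OF xs] pt_h[OF xs] by (simp add: tele_def can_def)
  next
    case False
    then have "frac s = s" using assms by (simp add: frac_eq)
    then show ?thesis using False h_in[OF xs] pt_h[OF xs] by (simp add: tele_def can_def frac_add_of_int_right)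
  qed
qed

lemma tele_cases:
  assumes "e \<in> tele"
  obtains x s k where "x \<in> topspace X" "0 \<le> s" "s < 1" "e = (h (x, s), s + of_int k)" "pt (fst e) = (x, s)"
    "\<lfloor>snd e\<rfloor> = k"
proof -
  obtain c \<tau> where e: "e = (c, \<tau>)" "c \<in> topspace T" "frac \<tau> = snd (pt c)" using assms by (auto simp: tele_def)
  obtain x s where xs: "x \<in> topspace X" "0 \<le> s" "s < 1" "c = h (x, s)" "pt c = (x, s)"
    by (rule T_cases[OF e(2)])
  show thesis using xs e by (intro that[of x s "\<lfloor>\<tau>\<rfloor>"]) (auto simp: frac_def)
qed

text \<open>The covering is glued from the cylinders over the intervals [k, k+1], so continuity may
  be tested on each of them.\<close>

lemma continuous_map_from_Tele:
  assumes g: "\<And>k. continuous_map cyl Y (\<lambda>(x, s). g (h (x, s), s + of_int k))"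
  shows "continuous_map Tele Y g"
proof (rule tele.continuous_map_from_total_top)
  fix e assume "e \<in> tele"
  then obtain x s k where "x \<in> topspace X" "0 \<le> s" "s < 1" "e = (h (x, s), s + of_int k)"
    by (rule tele_cases)
  then show "g e \<in> topspace Y" using g[of k] by (auto simp: continuous_map_def Pi_iff)
next
  fix i k W assume W: "openin Y W"
  define G where "G k = {z \<in> topspace cyl. g (h z, snd z + of_int k) \<in> W}" for k
  have G: "openin cyl (G k)" for k
    using openin_continuous_map_preimage[OF g W, of k] by (simp add: G_def case_prod_unfold)
  \<comment> \<open>In the chart around level 0, sheet \<open>k\<close> consists of the lower half
    of cylinder \<open>k\<close> and the upper half of cylinder \<open>k - 1\<close>, whose top end
    is glued to it.\<close>
  define V where "V = (if i then G k \<inter> {z \<in> topspace cyl. snd z \<in> {0<..<1}}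
     else (G k \<inter> {z \<in> topspace cyl. snd z \<in> {..<1/2}}) \<union> (G (k - 1) \<inter> {z \<in> topspace cyl. snd z \<in> {1/2<..}}))"
  have V: "openin cyl V" unfolding V_def
    by (auto simp del: topspace_prod_topology greaterThanLessThan_iff lessThan_iff greaterThan_iff
        intro!: openin_Int openin_Un G openin_cyl_snd)
  have "{z \<in> topspace cyl. h z \<in> {c \<in> U i. g (c, lev i c + of_int k) \<in> W}} = V"
  proof (intro set_eqI)
    fix z
    show "z \<in> {z \<in> topspace cyl. h z \<in> {c \<in> U i. g (c, lev i c + of_int k) \<in> W}} \<longleftrightarrow> z \<in> V"
    proof (cases "z \<in> topspace cyl")
      case True
      obtain x s where z: "z = (x, s)" by (cases z)
      have s: "0 \<le> s" "s \<le> 1" using True z by auto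
      have p: "snd (pt (h z)) = (if s = 1 then 0 else s)" using pt_h[OF True] z by (simp add: can_def)
      show ?thesis
      proof (cases i)
        case i: True
        show ?thesis using i p s True h_in[OF True] by (auto simp: U_def V_def lev_def z G_def)
      next
        case i: False
        show ?thesis
        proof (cases "s = 1/2")
          case half: True
          then have "h z \<notin> U i" "z \<notin> V" using p i by (simp_all add: U_def V_def z)
          then show ?thesis by simp
        next
          case half: False
          consider "s = 1" | "s < 1/2" | "1/2 < s" "s < 1" using s half by linarith
          then show ?thesis
            using i p s True h_in[OF True]
            by cases (auto simp: U_def V_def lev_def z G_def algebra_simps)
        qed
      qed
    qed (auto simp: V_def G_def)
  qed
  then show "openin T {c \<in> U i. g (c, lev i c + of_int k) \<in> W}"
    using V by (subst openin_T_iff) (auto simp: U_def)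
qed

lemma continuous_map_level: "continuous_map Tele euclideanreal snd"
proof (rule continuous_map_from_Tele)
  fix k
  have "continuous_map cyl euclideanreal snd"
    using continuous_map_snd[of X "top_of_set {0..1::real}"] by (simp add: continuous_map_in_subtopology)
  then have "continuous_map cyl euclideanreal (\<lambda>z. snd z + of_int k)" by (intro continuous_intros) auto
  then show "continuous_map cyl euclideanreal (\<lambda>(x, s). snd (h (x, s), s + real_of_int k))"
    by (simp add: case_prod_unfold)
qed

end


section \<open>Null-homotopic loops and the flow on the mapping torus\<close>

lemma homotopic_loopI:
  fixes K :: "real \<times> real \<Rightarrow> 'a"
  assumes "continuous_map (top_of_set ({0..1} \<times> {0..1})) X K"
    and "\<And>t. t \<in> {0..1} \<Longrightarrow> K (0, t) = \<alpha> t" "\<And>t. t \<in> {0..1} \<Longrightarrow> K (1, t) = \<gamma> t"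
    and "\<And>s. s \<in> {0..1} \<Longrightarrow> K (s, 0) = b" "\<And>s. s \<in> {0..1} \<Longrightarrow> K (s, 1) = b"
  shows "homotopic_with (\<lambda>\<gamma>. \<gamma> 0 = b \<and> \<gamma> 1 = b) (top_of_set {0..1}) X \<alpha> \<gamma>"
proof (subst homotopic_with)
  show "(\<gamma> 0 = b \<and> \<gamma> 1 = b) = (\<gamma>' 0 = b \<and> \<gamma>' 1 = b)"
    if "\<And>x. x \<in> topspace (top_of_set {0..1}) \<Longrightarrow> \<gamma> x = \<gamma>' x" for \<gamma> \<gamma>' :: "real \<Rightarrow> 'a"
    using that by simp
  show "\<exists>K. continuous_map (prod_topology (top_of_set {0..1}) (top_of_set {0..1})) X K \<and>
      (\<forall>x\<in>topspace (top_of_set {0..1}). K (0::real, x) = \<alpha> x) \<and>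
      (\<forall>x\<in>topspace (top_of_set {0..1}). K (1, x) = \<gamma> x) \<and> (\<forall>t\<in>{0..1}. K (t, 0) = b \<and> K (t, 1) = b)"
    by (rule exI[where x = K]) (use assms in simp)
qed

lemma null_homotopic_loopI:
  fixes K :: "real \<times> real \<Rightarrow> 'a"
  assumes "continuous_map (top_of_set ({0..1} \<times> {0..1})) X K"
    and "\<And>t. t \<in> {0..1} \<Longrightarrow> K (0, t) = \<alpha> t" "\<And>t. t \<in> {0..1} \<Longrightarrow> K (1, t) = b"
    and "\<And>s. s \<in> {0..1} \<Longrightarrow> K (s, 0) = b" "\<And>s. s \<in> {0..1} \<Longrightarrow> K (s, 1) = b"
  shows "null_homotopic_loop X b \<alpha>"
  unfolding null_homotopic_loop_def by (rule homotopic_loopI[OF assms])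

lemma null_homotopic_loopE:
  assumes "null_homotopic_loop X b \<alpha>"
  obtains K :: "real \<times> real \<Rightarrow> _" where "continuous_map (top_of_set ({0..1} \<times> {0..1})) X K"
    "\<forall>t\<in>{0..1}. K (0, t) = \<alpha> t" "\<forall>t\<in>{0..1}. K (1, t) = b"
    "\<forall>s\<in>{0..1}. K (s, 0) = b" "\<forall>s\<in>{0..1}. K (s, 1) = b"
proof -
  obtain K :: "real \<times> real \<Rightarrow> _" where K: "continuous_map (prod_topology (top_of_set {0..1}) (top_of_set {0..1})) X K"
    "\<forall>t. K (0, t) = \<alpha> t" "\<forall>t. K (1, t) = b" "\<forall>s\<in>{0..1}. K (s, 0) = b \<and> K (s, 1) = b"
    using assms unfolding null_homotopic_loop_def homotopic_with_def by (elim exE conjE) (rule that; assumption)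
  then show thesis by (intro that[of K]) simp_all
qed

lemma continuous_map_square:
  assumes G: "continuous_map (top_of_set ({0..1} \<times> {0..1})) X G"
    and "continuous_on S a" "continuous_on S b"
    and "\<And>z. z \<in> S \<Longrightarrow> a z \<in> {0..1::real}" "\<And>z. z \<in> S \<Longrightarrow> b z \<in> {0..1::real}"
  shows "continuous_map (top_of_set S) X (\<lambda>z. G (a z, b z))"
proof -
  have "continuous_map (top_of_set S) X (G \<circ> (\<lambda>z. (a z, b z)))"
    by (rule continuous_map_compose[OF _ G])
       (use assms(2-) in \<open>auto intro!: continuous_on_Pair\<close>)
  then show ?thesis by (simp add: o_def)
qed

text \<open>The path up the left edge of the square, across at height \<open>s\<close>, and down the right edge is a
  homotopy from the bottom edge to a path traversed forth and back.\<close>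

lemma null_homotopic_bottom_edge:
  fixes G :: "real \<times> real \<Rightarrow> 'x"
  assumes G: "continuous_map (top_of_set ({0..1} \<times> {0..1})) X G"
    and sides: "\<And>s. s \<in> {0..1} \<Longrightarrow> G (1, s) = G (0, s)"
    and top: "\<And>t. t \<in> {0..1} \<Longrightarrow> G (t, 1) = G (0, 1)"
  shows "null_homotopic_loop X (G (0, 0)) (\<lambda>t. G (t, 0))"
proof -
  let ?I = "{0..1::real}"
  define m where "m t = min 1 (min (3 * t) (3 * (1 - t)))" for t :: real
  have m: "m t \<in> ?I" if "t \<in> ?I" for t using that by (auto simp: m_def)
  have mc: "continuous_on S (\<lambda>z. m (f z))" if "continuous_on S f" for S :: "(real \<times> real) set" and f
  proof (rule continuous_on_compose2[OF _ that])
    show "continuous_on UNIV m" unfolding m_def by (intro continuous_intros)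
  qed simp
  \<comment> \<open>At stage \<open>s\<close> the first and the last \<open>s / 3\<close> of the
    time are spent on the vertical edges, where \<open>m\<close> changes at speed 3;
    \<open>c\<close> is the horizontal position, which moves only in between.\<close>
  define c where "c s t = max 0 (min 1 ((t - s / 3) / (1 - 2 * s / 3)))" for s t :: real
  let ?P = "\<lambda>\<gamma>. \<gamma> 0 = G (0, 0) \<and> \<gamma> 1 = G (0, 0)"
  have "homotopic_with ?P (top_of_set ?I) X (\<lambda>t. G (t, 0)) (\<lambda>t. G (0, m t))"
  proof (subst homotopic_with, force, intro exI conjI ballI)
    let ?K = "\<lambda>z. G (c (fst z) (snd z), min (fst z) (m (snd z)))"
    have "continuous_on (?I \<times> ?I) (\<lambda>z. c (fst z) (snd z))"
      unfolding c_def by (intro continuous_intros) auto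
    then have "continuous_map (top_of_set (?I \<times> ?I)) X ?K"
      by (intro continuous_map_square[OF G] continuous_intros mc) (auto simp: c_def m_def)
    then show "continuous_map (prod_topology (top_of_set ?I) (top_of_set ?I)) X ?K" by simp
    fix t :: real assume t: "t \<in> topspace (top_of_set ?I)"
    have "c 0 t = t" using t by (auto simp: c_def)
    then show "?K (0, t) = G (t, 0)" using t m[of t] by (simp add: min_def)
    consider "t < 1/3" | "1/3 \<le> t" "t \<le> 2/3" | "2/3 < t" by linarith
    then show "?K (1, t) = G (0, m t)"
    proof cases
      case 2
      then have "m t = 1" by (simp add: m_def)
      moreover have "c 1 t \<in> ?I" by (simp add: c_def)
      ultimately show ?thesis using top[of "c 1 t"] by simp
    next
      case 1
      then have "c 1 t = 0" by (simp add: c_def)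
      then show ?thesis using m[of t] t by (simp add: min_absorb2)
    next
      case 3
      then have "c 1 t = 1" by (simp add: c_def)
      then show ?thesis using m[of t] t sides[of "m t"] by (simp add: min_absorb2)
    qed
  next
    fix s :: real assume s: "s \<in> ?I"
    have "(0 - s / 3) / (1 - 2 * s / 3) \<le> 0" using s by (intro divide_nonpos_pos) auto
    moreover have "max 0 (min 1 x) = 0" if "x \<le> 0" for x :: real using that by simp
    ultimately have "c s 0 = 0" unfolding c_def by blast
    then show "G (c (fst (s, 0::real)) (snd (s, 0::real)), min (fst (s, 0::real)) (m (snd (s, 0::real)))) = G (0, 0)"
      using s by (simp add: m_def)
    have "(1 - s / 3) / (1 - 2 * s / 3) \<ge> 1" using s by (simp add: le_divide_eq)
    then have "c s 1 = 1" by (simp add: c_def)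
    then show "G (c (fst (s, 1::real)) (snd (s, 1::real)), min (fst (s, 1::real)) (m (snd (s, 1::real)))) = G (0, 0)"
      using s sides[of 0] by (simp add: m_def)
  qed
  \<comment> \<open>A path up the left edge and back is contracted by scaling its height to
    0.\<close>
  moreover have "homotopic_with ?P (top_of_set ?I) X (\<lambda>t. G (0, m t)) (\<lambda>t. G (0, 0))"
  proof (subst homotopic_with, force, intro exI conjI ballI)
    let ?K = "\<lambda>z. G (0, (1 - fst z) * m (snd z))"
    have "continuous_map (top_of_set (?I \<times> ?I)) X ?K"
      by (intro continuous_map_square[OF G] continuous_intros mc) (use m in \<open>auto intro!: mult_le_one\<close>)
    then show "continuous_map (prod_topology (top_of_set ?I) (top_of_set ?I)) X ?K" by simp
  qed (auto simp: m_def)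
  ultimately show ?thesis unfolding null_homotopic_loop_def by (rule homotopic_with_trans)
qed

text \<open>The null homotopy of the top edge is attached above \<open>G\<close>. The attached part
  is constant on its sides, so the sides of the larger square still agree, and now the top edge is
  constant.\<close>

lemma null_homotopic_free:
  fixes G :: "real \<times> real \<Rightarrow> 'x"
  assumes G: "continuous_map (top_of_set ({0..1} \<times> {0..1})) X G"
    and sides: "\<And>s. s \<in> {0..1} \<Longrightarrow> G (1, s) = G (0, s)"
    and top: "null_homotopic_loop X (G (0, 1)) (\<lambda>t. G (t, 1))"
  shows "null_homotopic_loop X (G (0, 0)) (\<lambda>t. G (t, 0))"
proof -
  let ?I = "{0..1::real}"
  obtain N where N: "continuous_map (top_of_set (?I \<times> ?I)) X N"
    "\<forall>t\<in>?I. N (0, t) = G (t, 1)" "\<forall>t\<in>?I. N (1, t) = G (0, 1)"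
    "\<forall>s\<in>?I. N (s, 0) = G (0, 1)" "\<forall>s\<in>?I. N (s, 1) = G (0, 1)"
    using top by (rule null_homotopic_loopE)
  define G' where "G' z = (if snd z \<le> 1/2 then G (fst z, 2 * snd z) else N (2 * snd z - 1, fst z))" for z
  have "continuous_map (top_of_set (?I \<times> ?I)) X G'"
    unfolding G'_def
  proof (rule continuous_map_cases_le)
    have "{z \<in> topspace (top_of_set (?I \<times> ?I)). snd z \<le> 1/2} = ?I \<times> {0..1/2}" 
      "{z \<in> topspace (top_of_set (?I \<times> ?I)). 1/2 \<le> snd z} = ?I \<times> {1/2..1}" by auto
    moreover have "(?I \<times> ?I) \<inter> (?I \<times> {0..1/2}) = ?I \<times> {0..1/2}" "(?I \<times> ?I) \<inter> (?I \<times> {1/2..1}) = ?I \<times> {1/2..1}"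
      by auto
    ultimately have top: "subtopology (top_of_set (?I \<times> ?I)) {z \<in> topspace (top_of_set (?I \<times> ?I)). snd z \<le> 1/2} = top_of_set (?I \<times> {0..1/2})"
       "subtopology (top_of_set (?I \<times> ?I)) {z \<in> topspace (top_of_set (?I \<times> ?I)). 1/2 \<le> snd z} = top_of_set (?I \<times> {1/2..1})"
      by (simp_all only: subtopology_subtopology)
    show "continuous_map (subtopology (top_of_set (?I \<times> ?I)) {z \<in> topspace (top_of_set (?I \<times> ?I)). snd z \<le> 1/2}) X (\<lambda>z. G (fst z, 2 * snd z))"
      unfolding top by (intro continuous_map_square[OF G] continuous_intros) auto
    show "continuous_map (subtopology (top_of_set (?I \<times> ?I)) {z \<in> topspace (top_of_set (?I \<times> ?I)). 1/2 \<le> snd z}) X (\<lambda>z. N (2 * snd z - 1, fst z))"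
      unfolding top by (intro continuous_map_square[OF N(1)] continuous_intros) auto
    fix z assume z: "z \<in> topspace (top_of_set (?I \<times> ?I))" "snd z = 1/2"
    then have "2 * snd z = 1" "fst z \<in> ?I" by (simp, auto)
    then show "G (fst z, 2 * snd z) = N (2 * snd z - 1, fst z)" using N(2) by simp
  qed (auto intro!: continuous_intros)
  then have "null_homotopic_loop X (G' (0, 0)) (\<lambda>t. G' (t, 0))"
    by (rule null_homotopic_bottom_edge) (use sides N in \<open>auto simp: G'_def\<close>)
  then show ?thesis by (simp add: G'_def)
qed

section \<open>The forward flow on the mapping torus, and its effect on homotopies and lifts\<close>

context self_map
begin

text \<open>Extends \<open>h\<close> to all heights \<open>r\<close> at least 0: each passage
  through an integer height crosses the seam of the torus and costs one application of
  \<open>f\<close>.\<close>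

definition flow0 :: "'a \<times> real \<Rightarrow> ('a \<times> real) set" where
  "flow0 z = h ((f ^^ nat \<lfloor>snd z\<rfloor>) (fst z), frac (snd z))"

lemma continuous_funpow: "continuous_map X X (f ^^ n)"
  by (induction n) (auto intro: continuous_map_compose[OF _ continuous_f] simp del: o_apply simp: id_def[symmetric])

lemma funpow_in: "x \<in> topspace X \<Longrightarrow> (f ^^ n) x \<in> topspace X"
  by (induction n) (auto intro: f_in)

lemma flow0_eq:
  assumes "x \<in> topspace X" "real n \<le> r" "r \<le> real n + 1"
  shows "flow0 (x, r) = h ((f ^^ n) x, r - real n)"
proof (cases "r = real n + 1")
  case True
  then have "r = of_int (int n + 1)" by simp
  then have fr: "\<lfloor>r\<rfloor> = int n + 1" "frac r = 0" by (metis floor_of_int, metis frac_of_int)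
  then have "flow0 (x, r) = h ((f ^^ Suc n) x, 0)" 
    by (simp add: flow0_def nat_add_distrib del: frac_eq_0_iff)
  also have "\<dots> = h ((f ^^ n) x, 1)" using h_one[OF funpow_in[OF assms(1)]] by simp
  finally show ?thesis using True by simp
next
  case False
  then have "\<lfloor>r\<rfloor> = int n" using assms by (intro floor_unique) auto
  then show ?thesis by (simp add: flow0_def frac_def)
qed

lemma continuous_flow0: "continuous_map (prod_topology X (top_of_set {0..})) T flow0"
proof (rule pasting_lemma_locally_finite[where I = UNIV and T = "\<lambda>n. topspace X \<times> {real n..real n + 1}"
      and f = "\<lambda>n z. h ((f ^^ n) (fst z), snd z - real n)"])
  let ?P = "prod_topology X (top_of_set {0::real..})"
  have snd: "continuous_map ?P euclideanreal snd"
    using continuous_map_snd[of X "top_of_set {0::real..}"] by (simp add: continuous_map_in_subtopology)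
  fix z assume z: "z \<in> topspace ?P"
  let ?V = "{w \<in> topspace ?P. snd w \<in> {..<snd z + 1}}"
  have "finite {n \<in> UNIV. (topspace X \<times> {real n..real n + 1}) \<inter> ?V \<noteq> {}}"
  proof (rule finite_subset)
    show "{n \<in> UNIV. (topspace X \<times> {real n..real n + 1}) \<inter> ?V \<noteq> {}} \<subseteq> {..nat \<lceil>snd z + 1\<rceil>}"
    proof
      fix n assume "n \<in> {n \<in> UNIV. (topspace X \<times> {real n..real n + 1}) \<inter> ?V \<noteq> {}}"
      then obtain w where w: "w \<in> topspace X \<times> {real n..real n + 1}" "w \<in> ?V" by blast
      have "real n \<le> snd w" using w(1) by auto
      moreover have "snd w < snd z + 1" using w(2) by simp
      ultimately show "n \<in> {..nat \<lceil>snd z + 1\<rceil>}" by (simp, linarith)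
    qed
  qed simp
  moreover have "openin ?P ?V" by (rule openin_continuous_map_preimage[OF snd]) simp
  ultimately show "\<exists>V. openin ?P V \<and> z \<in> V \<and> finite {n \<in> UNIV. (topspace X \<times> {real n..real n + 1}) \<inter> V \<noteq> {}}"
    using z by (intro exI[of _ ?V]) auto
  show "\<exists>n. n \<in> UNIV \<and> z \<in> topspace X \<times> {real n..real n + 1} \<and> flow0 z = h ((f ^^ n) (fst z), snd z - real n)"
  proof (intro exI[of _ "nat \<lfloor>snd z\<rfloor>"] conjI)
    have "0 \<le> snd z" using z by auto
    then have b: "real (nat \<lfloor>snd z\<rfloor>) \<le> snd z" "snd z \<le> real (nat \<lfloor>snd z\<rfloor>) + 1"
      by linarith+
    then show "z \<in> topspace X \<times> {real (nat \<lfloor>snd z\<rfloor>)..real (nat \<lfloor>snd z\<rfloor>) + 1}" using z by auto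
    show "flow0 z = h ((f ^^ nat \<lfloor>snd z\<rfloor>) (fst z), snd z - real (nat \<lfloor>snd z\<rfloor>))"
      using flow0_eq[OF _ b, of "fst z"] z by auto
  qed simp
next
  let ?P = "prod_topology X (top_of_set {0::real..})"
  fix n
  have snd: "continuous_map ?P euclideanreal snd"
    using continuous_map_snd[of X "top_of_set {0::real..}"] by (simp add: continuous_map_in_subtopology)
  have "closedin ?P {w \<in> topspace ?P. snd w \<in> {real n..real n + 1}}"
    by (rule closedin_continuous_map_preimage[OF snd]) simp
  moreover have "{w \<in> topspace ?P. snd w \<in> {real n..real n + 1}} = topspace X \<times> {real n..real n + 1}" by auto
  ultimately show "closedin ?P (topspace X \<times> {real n..real n + 1})" by simp
  show "continuous_map (subtopology ?P (topspace X \<times> {real n..real n + 1})) T (\<lambda>z. h ((f ^^ n) (fst z), snd z - real n))"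
  proof -
    have c1: "continuous_map (subtopology ?P (topspace X \<times> {real n..real n + 1})) X (\<lambda>z. (f ^^ n) (fst z))"
    proof (rule continuous_map_from_subtopology)
      have "continuous_map ?P X ((f ^^ n) \<circ> fst)"
        by (rule continuous_map_compose[OF continuous_map_fst continuous_funpow])
      then show "continuous_map ?P X (\<lambda>z. (f ^^ n) (fst z))" by (simp add: o_def)
    qed
    have "continuous_map (subtopology ?P (topspace X \<times> {real n..real n + 1})) euclideanreal (\<lambda>z. snd z - real n)"
      by (intro continuous_map_diff continuous_map_from_subtopology[OF snd]) simp
    then have c2: "continuous_map (subtopology ?P (topspace X \<times> {real n..real n + 1})) (top_of_set {0..1}) (\<lambda>z. snd z - real n)"
      by (rule continuous_map_into_subtopology) auto
    have "continuous_map (subtopology ?P (topspace X \<times> {real n..real n + 1})) cyl (\<lambda>z. ((f ^^ n) (fst z), snd z - real n))"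
      using c1 c2 by (rule continuous_map_pairedI)
    from continuous_map_compose[OF this continuous_h] show ?thesis by (simp add: o_def)
  qed
  fix j z assume "z \<in> topspace ?P \<inter> (topspace X \<times> {real n..real n + 1}) \<inter> (topspace X \<times> {real j..real j + 1})"
  then show "h ((f ^^ n) (fst z), snd z - real n) = h ((f ^^ j) (fst z), snd z - real j)"
    using flow0_eq[of "fst z" n "snd z"] flow0_eq[of "fst z" j "snd z"] by auto
qed

text \<open>Times are cut off at 0 because \<open>f\<close> need not be invertible, so that there is
  only a forward flow.\<close>

definition flow :: "real \<times> ('a \<times> real) set \<Rightarrow> ('a \<times> real) set" where
  "flow z = flow0 (fst (pt (snd z)), snd (pt (snd z)) + max 0 (fst z))"

lemma flow_h:
  assumes x: "x \<in> topspace X" and s: "0 \<le> s" "s \<le> 1"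
  shows "flow (r, h (x, s)) = flow0 (x, s + max 0 r)"
proof (cases "s = 1")
  case True
  then have pt: "pt (h (x, s)) = (f x, 0)" using pt_h[of "(x, s)"] x by (simp add: can_def)
  define n where "n = nat \<lfloor>max 0 r\<rfloor>"
  have n: "real n \<le> max 0 r" "max 0 r \<le> real n + 1" unfolding n_def by linarith+
  have "flow0 (f x, max 0 r) = h ((f ^^ n) (f x), max 0 r - real n)"
    by (rule flow0_eq[OF f_in[OF x] n])
  also have "\<dots> = flow0 (x, 1 + max 0 r)"
    using flow0_eq[OF x, of "Suc n" "1 + max 0 r"] n by (simp add: funpow_swap1)
  finally show ?thesis using True pt by (simp add: flow_def)
next
  case False
  then have pt: "pt (h (x, s)) = (x, s)" using pt_h[of "(x, s)"] x s by (simp add: can_def)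
  then show ?thesis by (simp add: flow_def)
qed

text \<open>The product of the quotient map \<open>h\<close> with the locally compact line is again
  a quotient map, so continuity can be checked on the cylinder.\<close>

lemma continuous_flow: "continuous_map (prod_topology euclideanreal T) T flow"
proof (rule continuous_compose_quotient_map)
  show "quotient_map (prod_topology euclideanreal cyl) (prod_topology euclideanreal T) (\<lambda>(r, z). (r, h z))"
    by (rule quotient_map_prod_right[OF locally_compact_space_euclidean _ quotient_h]) simp
  have f: "continuous_map (prod_topology euclideanreal cyl) X (\<lambda>z. fst (snd z))"
    using continuous_map_compose[OF continuous_map_snd continuous_map_fst, of euclideanreal X "top_of_set {0..1::real}"] by (simp add: o_def)
  have "continuous_map (prod_topology euclideanreal cyl) euclideanreal (\<lambda>z. snd (snd z))"
    using continuous_map_compose[OF continuous_map_snd continuous_map_snd, of euclideanreal X "top_of_set {0..1::real}"]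
    by (simp add: o_def continuous_map_in_subtopology)
  then have "continuous_map (prod_topology euclideanreal cyl) euclideanreal (\<lambda>z. snd (snd z) + max 0 (fst z))"
    by (intro continuous_intros) auto
  then have "continuous_map (prod_topology euclideanreal cyl) (top_of_set {0..}) (\<lambda>z. snd (snd z) + max 0 (fst z))"
    by (rule continuous_map_into_subtopology) auto
  from continuous_map_compose[OF continuous_map_pairedI[OF f this] continuous_flow0]
  have "continuous_map (prod_topology euclideanreal cyl) T (\<lambda>z. flow0 (fst (snd z), snd (snd z) + max 0 (fst z)))"
    by (simp add: o_def)
  then show "continuous_map (prod_topology euclideanreal cyl) T (flow \<circ> (\<lambda>(r, z). (r, h z)))"
    by (rule continuous_map_eq) (auto simp: flow_h)
qed

text \<open>Each point of the loop flows for as long as its lift needs to climb to level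
  \<open>K\<close>. The two sides of the resulting square agree because \<open>\<alpha>'\<close> is
  closed, although the base point travels around the torus meanwhile; this is why
  \<open>null_homotopic_free\<close> is needed. Nothing is prescribed for \<open>g\<close> above
  level \<open>K\<close>.\<close>

lemma null_homotopic_pushed:
  assumes x0: "x0 \<in> topspace X" "f x0 = x0"
    and \<alpha>: "is_lift Tele (h (x0, 0), 0) fst \<alpha> \<alpha>'" "\<alpha>' 1 = (h (x0, 0), 0)"
    and K: "\<And>t. t \<in> {0..1} \<Longrightarrow> snd (\<alpha>' t) \<le> real K"
    and g: "\<And>x s k. x \<in> topspace X \<Longrightarrow> 0 \<le> s \<Longrightarrow> s < 1 \<Longrightarrow> s + of_int k \<le> real K \<Longrightarrow>
        g (h (x, s), s + of_int k) = (f ^^ nat (int K - k)) x"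
    and null: "null_homotopic_loop X x0 (g \<circ> \<alpha>')"
  shows "null_homotopic_loop T (h (x0, 0)) \<alpha>"
proof -
  let ?I = "{0..1::real}"
  have \<alpha>1: "continuous_map (top_of_set ?I) Tele \<alpha>'" "\<alpha>' 0 = (h (x0, 0), 0)"
    and \<alpha>2: "\<And>t. t \<in> ?I \<Longrightarrow> fst (\<alpha>' t) = \<alpha> t" using \<alpha>(1) by (auto simp: is_lift_def pathin_def)
  define G where "G z = flow (snd z * (real K - snd (\<alpha>' (fst z))), fst (\<alpha>' (fst z)))" for z
  have fst: "continuous_map (top_of_set (?I \<times> ?I)) (top_of_set ?I) fst"
    by (auto intro: continuous_intros)
  have lift: "continuous_map (top_of_set (?I \<times> ?I)) Tele (\<lambda>z. \<alpha>' (fst z))"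
    using continuous_map_compose[OF fst \<alpha>1(1)] by (simp add: o_def)
  have c1: "continuous_map (top_of_set (?I \<times> ?I)) euclideanreal (\<lambda>z. snd (\<alpha>' (fst z)))"
    using continuous_map_compose[OF lift continuous_map_level] by (simp add: o_def)
  have c2: "continuous_map (top_of_set (?I \<times> ?I)) T (\<lambda>z. fst (\<alpha>' (fst z)))"
    using continuous_map_compose[OF lift covering_projection_continuous[OF tele.covering_projection_total_top]]
    by (simp add: o_def)
  have "continuous_map (top_of_set (?I \<times> ?I)) euclideanreal (\<lambda>z. snd z * (real K - snd (\<alpha>' (fst z))))"
    using c1 by (intro continuous_intros) (auto intro: continuous_intros)
  from continuous_map_compose[OF continuous_map_pairedI[OF this c2] continuous_flow]
  have G: "continuous_map (top_of_set (?I \<times> ?I)) T G" by (simp add: o_def G_def[abs_def])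
  have val: "\<alpha>' t \<in> tele" if "t \<in> ?I" for t
    using \<alpha>1(1) that by (auto simp: continuous_map_def)
  have bottom: "G (t, 0) = \<alpha> t" if t: "t \<in> ?I" for t
  proof -
    obtain x s k where xs: "x \<in> topspace X" "0 \<le> s" "s < 1" "\<alpha>' t = (h (x, s), s + of_int k)"
      using val[OF t] by (rule tele_cases)
    then have "G (t, 0) = flow0 (x, s)" using flow_h[of x s 0] by (simp add: G_def)
    also have "\<dots> = \<alpha> t" using flow0_eq[of x 0 s] xs \<alpha>2[OF t] by simp
    finally show ?thesis .
  qed
  have top: "G (t, 1) = h ((g \<circ> \<alpha>') t, 0)" if t: "t \<in> ?I" for t
  proof -
    obtain x s k where xs: "x \<in> topspace X" "0 \<le> s" "s < 1" "\<alpha>' t = (h (x, s), s + of_int k)"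
      using val[OF t] by (rule tele_cases)
    have sK: "s + of_int k \<le> real K" using K[OF t] xs by simp
    then have k: "k \<le> int K" using xs by linarith
    have "G (t, 1) = flow0 (x, s + (real K - (s + of_int k)))"
      using flow_h[of x s "real K - (s + of_int k)"] xs sK by (simp add: G_def)
    also have "s + (real K - (s + of_int k)) = real (nat (int K - k))" using k by simp
    also have "flow0 (x, real (nat (int K - k))) = h ((f ^^ nat (int K - k)) x, 0)"
      using flow0_eq[OF xs(1), of "nat (int K - k)" "real (nat (int K - k))"] by simp
    also have "\<dots> = h ((g \<circ> \<alpha>') t, 0)" using g[OF xs(1-3) sK] xs by simp
    finally show ?thesis .
  qed
  have "null_homotopic_loop T (G (0, 0)) (\<lambda>t. G (t, 0))"
  proof (rule null_homotopic_free[OF G])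
    show "G (1, s) = G (0, s)" for s using \<alpha>1(2) \<alpha>(2) by (simp add: G_def)
    obtain N where N: "continuous_map (top_of_set (?I \<times> ?I)) X N"
      "\<forall>t\<in>?I. N (0, t) = (g \<circ> \<alpha>') t" "\<forall>t\<in>?I. N (1, t) = x0"
      "\<forall>s\<in>?I. N (s, 0) = x0" "\<forall>s\<in>?I. N (s, 1) = x0"
      using null by (rule null_homotopic_loopE)
    have G01: "G (0, 1) = h (x0, 0)" using top[of 0] N(2)[THEN bspec, of 0] N(4)[THEN bspec, of 0] by simp
    have "continuous_map (top_of_set (?I \<times> ?I)) cyl (\<lambda>z. (N z, 0))"
      using N(1) by (intro continuous_map_pairedI) auto
    from continuous_map_compose[OF this continuous_h]
    have "continuous_map (top_of_set (?I \<times> ?I)) T (\<lambda>z. h (N z, 0))" by (simp add: o_def)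
    then show "null_homotopic_loop T (G (0, 1)) (\<lambda>t. G (t, 1))"
      by (rule null_homotopic_loopI) (use N(2-) top G01 in simp_all)
  qed
  moreover have "G (0, 0) = h (x0, 0)" using bottom[of 0] \<alpha>2[of 0] \<alpha>1(2) by simp
  ultimately have *: "null_homotopic_loop T (h (x0, 0)) (\<lambda>t. G (t, 0))" by simp
  then obtain N where N: "continuous_map (top_of_set (?I \<times> ?I)) T N"
      "\<forall>t\<in>?I. N (0, t) = G (t, 0)" "\<forall>t\<in>?I. N (1, t) = h (x0, 0)"
      "\<forall>s\<in>?I. N (s, 0) = h (x0, 0)" "\<forall>s\<in>?I. N (s, 1) = h (x0, 0)"
    by (rule null_homotopic_loopE)
  show ?thesis by (rule null_homotopic_loopI[OF N(1)]) (use N bottom in simp_all)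
qed

text \<open>Lift the homotopy that moves the loop through the cylinder from height 0 to height 1,
  where it becomes the image loop. Its two side edges lift the same path of base points, so their
  coincidence at height 1 forces their coincidence at height 0.\<close>

lemma lift_closed_if_image_lift_closed:
  assumes p: "covering_projection E T p" and x0: "f x0 = x0" and \<alpha>: "loop_at X x0 \<alpha>"
    and closed: "\<And>e' \<beta>. is_lift E e' p (\<lambda>t. h (f (\<alpha> t), 0)) \<beta> \<Longrightarrow> \<beta> 1 = \<beta> 0"
    and lift: "is_lift E e p (\<lambda>t. h (\<alpha> t, 0)) \<beta>"
  shows "\<beta> 1 = \<beta> 0"
proof -
  let ?I = "{0..1::real}"
  have a: "continuous_map (top_of_set ?I) X \<alpha>" "\<alpha> 0 = x0" "\<alpha> 1 = x0" using \<alpha> by (auto simp: loop_at_def pathin_def)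
  have fst: "continuous_map (top_of_set (?I \<times> ?I)) (top_of_set ?I) fst"
    and snd: "continuous_map (top_of_set (?I \<times> ?I)) (top_of_set ?I) snd"
    by (auto intro: continuous_intros)
  have "continuous_map (top_of_set (?I \<times> ?I)) X (\<lambda>z. \<alpha> (fst z))"
    using continuous_map_compose[OF fst a(1)] by (simp add: o_def)
  from continuous_map_compose[OF continuous_map_pairedI[OF this snd] continuous_h]
  have "continuous_map (top_of_set (?I \<times> ?I)) T (\<lambda>z. h (\<alpha> (fst z), snd z))" by (simp add: o_def)
  then have lo: "lifts_on E p (\<lambda>z. h (\<alpha> (fst z), snd z)) (?I \<times> ?I)" by (rule lifts_on_square[OF p])
  have b: "continuous_map (top_of_set ?I) E \<beta>" "\<And>t. t \<in> ?I \<Longrightarrow> p (\<beta> t) = h (\<alpha> t, 0)"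
    using lift by (auto simp: is_lift_def pathin_def)
  have "(0, 0) \<in> ?I \<times> ?I" by simp
  moreover have "\<beta> 0 \<in> topspace E" using b(1) by (auto simp: continuous_map_def)
  moreover have "p (\<beta> 0) = h (\<alpha> (fst (0::real, 0::real)), snd (0::real, 0::real))" using b(2)[of 0] by simp
  ultimately obtain L where L: "continuous_map (top_of_set (?I \<times> ?I)) E L"
    "L (0, 0) = \<beta> 0" "\<forall>z\<in>?I \<times> ?I. p (L z) = h (\<alpha> (fst z), snd z)"
    by (rule lifts_onE[OF lo])
  have L3: "p (L (t, s)) = h (\<alpha> t, s)" if "t \<in> ?I" "s \<in> ?I" for t s
    using L(3)[THEN bspec, of "(t, s)"] that by simp
  have path: "is_lift E (L (a 0, b 0)) p (\<lambda>t. h (\<alpha> (a t), b t)) (\<lambda>t. L (a t, b t))"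
    if "continuous_on ?I a" "continuous_on ?I b" "\<And>t. t \<in> ?I \<Longrightarrow> a t \<in> ?I" "\<And>t. t \<in> ?I \<Longrightarrow> b t \<in> ?I" for a b
    using continuous_map_square[OF L(1) that] L3 that by (auto simp: is_lift_def pathin_def)
  have bot: "L (t, 0) = \<beta> t" if "t \<in> ?I" for t
    using path_lift_unique[OF p path[of "\<lambda>t. t" "\<lambda>_. 0"] lift, of 0 t] that L(2) by simp
  have "f (\<alpha> t) \<in> topspace X \<and> h (\<alpha> t, 1) = h (f (\<alpha> t), 0)" if "t \<in> ?I" for t
  proof -
    have "\<alpha> t \<in> topspace X" using a(1) that by (auto simp: continuous_map_def)
    then show ?thesis using h_one f_in by blast
  qed
  then have "is_lift E (L (0, 1)) p (\<lambda>t. h (f (\<alpha> t), 0)) (\<lambda>t. L (t, 1))"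
    using path[of "\<lambda>t. t" "\<lambda>_. 1"] by (auto simp: is_lift_def)
  from closed[OF this] have "L (1, 1) = L (0, 1)" .
  then have "L (1, 0) = L (0, 0)"
    using path_lift_unique[OF p path[of "\<lambda>_. 1" "\<lambda>t. t"], of "L (0, 0)" "\<lambda>t. L (0, t)" 1 0]
      path[of "\<lambda>_. 0" "\<lambda>t. t"] a by simp
  then show ?thesis using bot[of 0] bot[of 1] by simp
qed

end

text \<open>Inside an evenly covered set a lift is a local section of \<open>p\<close> applied to
  the path, so it takes equal values where the path does.\<close>

lemma lift_closed_in_evenly_covered:
  assumes p: "covering_projection E X p" and x: "x \<in> topspace X"
  obtains U where "openin X U" "x \<in> U"
    "\<forall>\<gamma> e \<beta>. pathin X \<gamma> \<longrightarrow> \<gamma> ` {0..1} \<subseteq> U \<longrightarrow> \<gamma> 1 = \<gamma> 0 \<longrightarrow> is_lift E e p \<gamma> \<beta> \<longrightarrow> \<beta> 1 = \<beta> 0"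
proof -
  obtain U \<V> where U: "x \<in> U" "openin X U" and V: "\<Union>\<V> = {e \<in> topspace E. p e \<in> U}"
      and ope: "\<And>V. V \<in> \<V> \<Longrightarrow> openin E V" and disj: "pairwise disjnt \<V>"
      and hom: "\<And>V. V \<in> \<V> \<Longrightarrow> homeomorphic_map (subtopology E V) (subtopology X U) p"
      using evenly_covered[OF p x] by blast
  show thesis
  proof (rule that[OF U(2,1)], intro allI impI)
    fix \<gamma> e \<beta>
    assume \<gamma>: "pathin X \<gamma>" "\<gamma> ` {0..1} \<subseteq> U" "\<gamma> 1 = \<gamma> 0" and \<beta>: "is_lift E e p \<gamma> \<beta>"
    have b: "(0::real) \<in> {0..1}" "\<beta> 0 \<in> topspace E" "p (\<beta> 0) = \<gamma> 0"
      using \<beta> by (auto simp: is_lift_def pathin_def continuous_map_def)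
    show "\<beta> 1 = \<beta> 0"
    proof (rule lifts_on_evenly_covered[OF V U(2) ope hom \<gamma>(1)[unfolded pathin_def] \<gamma>(2) b])
      fix g q assume g: "continuous_map (top_of_set {0..1}) E g" "g 0 = \<beta> 0"
        "\<And>z. z \<in> {0..1} \<Longrightarrow> p (g z) = \<gamma> z" "g = q \<circ> \<gamma>"
      have "is_lift E (\<beta> 0) p \<gamma> g" using g by (simp add: is_lift_def pathin_def)
      from path_lift_unique[OF p this \<beta>, of 0 1] have "g 1 = \<beta> 1" using g(2) by simp
      moreover have "g 1 = g 0" using g(4) \<gamma>(3) by simp
      ultimately show "\<beta> 1 = \<beta> 0" using g(2) by simp
    qed
  qed
qed


section \<open>Polar coordinates on the earring\<close>

text \<open>A point (x, y) of the \<open>m\<close>-th circle has squared norm 2x/m, so off the base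
  point the quotient is exactly \<open>m\<close>. In the next definition, the slope y/x at
  \<open>earring_loop m t\<close> is the cotangent of pi t, whence \<open>angle\<close> recovers
  \<open>t\<close> on every circle.\<close>

definition circle_index :: "real \<times> real \<Rightarrow> nat" where
  "circle_index z = nat \<lfloor>2 * fst z / (norm z)\<^sup>2\<rfloor>"

definition angle :: "real \<times> real \<Rightarrow> real" where
  "angle z = 1/2 - arctan (snd z / fst z) / pi"

lemma earring_loop_double_angle:
  "earring_loop m y = (2 / real m * (sin (pi * y))\<^sup>2, 2 / real m * (sin (pi * y) * cos (pi * y)))"
proof -
  have "cos (2 * pi * y) = 1 - 2 * (sin (pi * y))\<^sup>2" "sin (2 * pi * y) = 2 * sin (pi * y) * cos (pi * y)"
    using cos_double_sin[of "pi * y"] sin_double[of "pi * y"] by (simp_all add: mult.assoc)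
  then show ?thesis by (simp add: earring_loop_def)
qed

lemma norm_earring_loop: "norm (earring_loop m y) = 2 / real m * \<bar>sin (pi * y)\<bar>"
proof -
  have "(norm (earring_loop m y))\<^sup>2 = (2 / real m)\<^sup>2 * (sin (pi * y))\<^sup>2 * ((sin (pi * y))\<^sup>2 + (cos (pi * y))\<^sup>2)"
  proof -
    have "(k * s\<^sup>2)\<^sup>2 + (k * (s * c))\<^sup>2 = k\<^sup>2 * s\<^sup>2 * (s\<^sup>2 + c\<^sup>2)" for k s c :: real
      by (simp add: algebra_simps power2_eq_square)
    moreover have "(norm (earring_loop m y))\<^sup>2 = (2 / real m * (sin (pi * y))\<^sup>2)\<^sup>2 + (2 / real m * (sin (pi * y) * cos (pi * y)))\<^sup>2"
      unfolding earring_loop_double_angle norm_Pair by (simp del: abs_divide abs_mult times_divide_eq_left)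
    ultimately show ?thesis by (simp only:)
  qed
  then have "(norm (earring_loop m y))\<^sup>2 = (2 / real m * \<bar>sin (pi * y)\<bar>)\<^sup>2"
    by (simp add: power_mult_distrib power_divide)
  then show ?thesis by (rule power2_eq_imp_eq) simp_all
qed

lemma earring_loop_ends [simp]: "earring_loop m 0 = 0" "earring_loop m 1 = 0"
  by (simp_all add: earring_loop_def zero_prod_def)

lemma earring_loop_nonzero: "m \<ge> 1 \<Longrightarrow> 0 < y \<Longrightarrow> y < 1 \<Longrightarrow> earring_loop m y \<noteq> 0"
  using norm_earring_loop[of m y] sin_gt_zero[of "pi * y"] by auto

lemma circle_index_loop:
  assumes "m \<ge> 1" "0 < y" "y < 1"
  shows "2 * fst (earring_loop m y) / (norm (earring_loop m y))\<^sup>2 = real m"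
    and "circle_index (earring_loop m y) = m"
proof -
  have s: "sin (pi * y) > 0" using assms sin_gt_zero[of "pi * y"] by simp
  have "2 * fst (earring_loop m y) = 4 / real m * (sin (pi * y))\<^sup>2"
    by (simp add: earring_loop_double_angle)
  moreover have "(norm (earring_loop m y))\<^sup>2 = 4 / (real m)\<^sup>2 * (sin (pi * y))\<^sup>2"
    unfolding norm_earring_loop by (simp add: power_mult_distrib power_divide)
  ultimately show *: "2 * fst (earring_loop m y) / (norm (earring_loop m y))\<^sup>2 = real m"
    using s assms by (simp only:) (simp add: power2_eq_square)
  show "circle_index (earring_loop m y) = m" unfolding circle_index_def * by simp
qed

lemma angle_loop:
  assumes "m \<ge> 1" "0 < y" "y < 1"
  shows "angle (earring_loop m y) = y"
proof -
  have s: "sin (pi * y) > 0" using assms sin_gt_zero[of "pi * y"] by simp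
  have "snd (earring_loop m y) / fst (earring_loop m y) = cos (pi * y) / sin (pi * y)"
    using s assms by (simp add: earring_loop_double_angle power2_eq_square)
  also have "\<dots> = tan (pi/2 - pi * y)"
    by (simp add: tan_def sin_diff cos_diff)
  finally have "arctan (snd (earring_loop m y) / fst (earring_loop m y)) = pi/2 - pi * y"
    using assms by (simp only:) (rule arctan_tan; simp add: field_simps)
  then show ?thesis by (simp add: angle_def diff_divide_distrib)
qed

lemma earring_polar:
  assumes "z \<in> earring" "z \<noteq> 0"
  shows "circle_index z \<ge> 1" "0 < angle z" "angle z < 1" "earring_loop (circle_index z) (angle z) = z"
    "2 * fst z / (norm z)\<^sup>2 = real (circle_index z)" "fst z > 0"
proof -
  obtain m t where mt: "m \<ge> 1" "t \<in> {0..1}" "z = earring_loop m t"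
    using assms(1) by (rule earring_cases)
  have "t \<noteq> 0" "t \<noteq> 1" using assms(2) mt(3) by auto
  then have t: "0 < t" "t < 1" using mt(2) by auto
  note i = circle_index_loop[OF mt(1) t] angle_loop[OF mt(1) t]
  show "circle_index z \<ge> 1" "0 < angle z" "angle z < 1" "earring_loop (circle_index z) (angle z) = z"
    "2 * fst z / (norm z)\<^sup>2 = real (circle_index z)"
    using i mt t by auto
  have "sin (pi * t) > 0" using t sin_gt_zero[of "pi * t"] by simp
  then show "fst z > 0" using mt(1) by (simp add: mt(3) earring_loop_double_angle)
qed

lemma zero_in_earring [simp]: "0 \<in> earring"
  using earring_loop_in_earring[of 1 0] by simp

lemma continuous_on_angle: "continuous_on (earring - {0}) angle"
  unfolding angle_def using earring_polar(6) by (intro continuous_intros) (auto simp: order_less_le)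

lemma continuous_on_circle_index: "continuous_on (earring - {0}) (\<lambda>z. real (circle_index z))"
proof (rule continuous_on_eq)
  show "continuous_on (earring - {0}) (\<lambda>z. 2 * fst z / (norm z)\<^sup>2)"
    by (intro continuous_intros) auto
qed (use earring_polar(5) in auto)

text \<open>Off the base point the circle index is locally constant, so continuity of each single
  \<open>F m\<close> suffices. At the base point, where all circles meet, the bound with a constant
  \<open>C\<close> independent of \<open>m\<close> squeezes the values to 0. The extra argument
  \<open>s\<close> allows homotopies.\<close>

lemma continuous_on_earring_polar:
  fixes F :: "nat \<Rightarrow> real \<Rightarrow> 's::metric_space \<Rightarrow> real \<times> real"
  assumes cont: "\<And>m. m \<ge> 1 \<Longrightarrow> continuous_on ({0<..<1} \<times> S) (\<lambda>(y, s). F m y s)"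
    and bound: "\<And>m y s. m \<ge> 1 \<Longrightarrow> 0 < y \<Longrightarrow> y < 1 \<Longrightarrow> s \<in> S \<Longrightarrow> norm (F m y s) \<le> C * norm (earring_loop m y)"
  shows "continuous_on (earring \<times> S) (\<lambda>(z, s). if z = 0 then 0 else F (circle_index z) (angle z) s)"
    (is "continuous_on _ ?g")
  unfolding continuous_on_def
proof
  fix p assume p: "p \<in> earring \<times> S"
  obtain z s where zs: "p = (z, s)" by (cases p)
  show "(?g \<longlongrightarrow> ?g p) (at p within earring \<times> S)"
  proof (cases "z = 0")
    case True
    have "\<forall>\<^sub>F w in at p within earring \<times> S. norm (?g w) \<le> \<bar>C\<bar> * norm (fst w)"
      unfolding eventually_at_filter
    proof (intro always_eventually allI impI)
      fix w assume w: "w \<in> earring \<times> S"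
      show "norm (?g w) \<le> \<bar>C\<bar> * norm (fst w)"
      proof (cases "fst w = 0")
        case False
        have "fst w \<in> earring" using w by auto
        note q = earring_polar[OF this False]
        have "norm (F (circle_index (fst w)) (angle (fst w)) (snd w)) \<le> C * norm (fst w)"
          using bound[OF q(1-3), of "snd w"] w q(4) by auto
        also have "\<dots> \<le> \<bar>C\<bar> * norm (fst w)" by (intro mult_right_mono) auto
        finally show ?thesis using False by (simp add: case_prod_unfold)
      qed (simp add: case_prod_unfold)
    qed
    moreover have "((\<lambda>w. \<bar>C\<bar> * norm (fst w)) \<longlongrightarrow> 0) (at p within earring \<times> S)"
    proof -
      have "continuous_on (earring \<times> S) (\<lambda>w. \<bar>C\<bar> * norm (fst w))" by (intro continuous_intros)
      then have "((\<lambda>w. \<bar>C\<bar> * norm (fst w)) \<longlongrightarrow> \<bar>C\<bar> * norm (fst p)) (at p within earring \<times> S)"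
        using p unfolding continuous_on_def by (rule bspec)
      then show ?thesis by (simp add: zs True)
    qed
    ultimately have "(?g \<longlongrightarrow> 0) (at p within earring \<times> S)" by (rule Lim_null_comparison)
    then show ?thesis by (simp add: zs True)
  next
    case False
    have z: "z \<in> earring - {0}" using p zs False by auto
    let ?m = "circle_index z"
    have sub: "at p within earring \<times> S = at p within (earring - {0}) \<times> S"
    proof (rule at_within_nhd)
      show "p \<in> (- {0}) \<times> UNIV" "open ((- {0 :: real \<times> real}) \<times> (UNIV :: 's set))"
        using zs False by (auto intro!: open_Times)
    qed auto
    have m: "?m \<ge> 1" using earring_polar(1) z by blast
    have "continuous_on ((earring - {0}) \<times> S) (\<lambda>w. (angle (fst w), snd w))"
      using continuous_on_angle
      by (intro continuous_intros continuous_on_compose2[OF continuous_on_angle]) auto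
    then have "continuous_on ((earring - {0}) \<times> S) (\<lambda>w. F ?m (angle (fst w)) (snd w))"
      using continuous_on_compose2[OF cont[OF m], of "(earring - {0}) \<times> S" "\<lambda>w. (angle (fst w), snd w)"] earring_polar(2,3)
      by (fastforce simp: case_prod_unfold)
    then have lim: "((\<lambda>w. F ?m (angle (fst w)) (snd w)) \<longlongrightarrow> F ?m (angle (fst p)) (snd p)) (at p within (earring - {0}) \<times> S)"
      using z p zs by (simp add: continuous_on_def)
    have "continuous_on ((earring - {0}) \<times> S) (\<lambda>w. real (circle_index (fst w)))"
      by (intro continuous_on_compose2[OF continuous_on_circle_index] continuous_intros) auto
    then have "((\<lambda>w. real (circle_index (fst w))) \<longlongrightarrow> real ?m) (at p within (earring - {0}) \<times> S)"
      using z p zs by (auto simp: continuous_on_def)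
    then have "\<forall>\<^sub>F w in at p within (earring - {0}) \<times> S. dist (real (circle_index (fst w))) (real ?m) < 1"
      by (rule tendstoD) simp
    moreover have "\<forall>\<^sub>F w in at p within (earring - {0}) \<times> S. w \<in> (earring - {0}) \<times> S"
      by (simp add: eventually_at_filter)
    ultimately have "\<forall>\<^sub>F w in at p within (earring - {0}) \<times> S. F ?m (angle (fst w)) (snd w) = ?g w"
    proof eventually_elim
      case (elim w)
      have "circle_index (fst w) = ?m" using elim(1) by (simp add: dist_real_def)
      then show ?case using elim(2) by (simp add: case_prod_unfold mem_Times_iff)
    qed
    from Lim_transform_eventually[OF lim this] show ?thesis
      unfolding sub using False zs by simp
  qed
qed

lemma continuous_on_earring_polar_single:
  fixes F :: "nat \<Rightarrow> real \<Rightarrow> real \<times> real"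
  assumes "\<And>m. m \<ge> 1 \<Longrightarrow> continuous_on {0<..<1} (F m)"
    and "\<And>m y. m \<ge> 1 \<Longrightarrow> 0 < y \<Longrightarrow> y < 1 \<Longrightarrow> norm (F m y) \<le> C * norm (earring_loop m y)"
  shows "continuous_on earring (\<lambda>z. if z = 0 then 0 else F (circle_index z) (angle z))"
proof -
  have "continuous_on (earring \<times> {0::real}) (\<lambda>(z, s). if z = 0 then 0 else F (circle_index z) (angle z))"
    by (rule continuous_on_earring_polar[where C = C and F = "\<lambda>m y s. F m y"])
       (use assms in \<open>auto simp: case_prod_unfold intro!: continuous_on_compose2[OF assms(1)] continuous_intros\<close>)
  from continuous_on_compose2[OF this, of earring "\<lambda>z. (z, 0)"] show ?thesis
    by (fastforce intro: continuous_intros)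
qed

section \<open>A continuous left inverse of the shift\<close>

lemma continuous_on_earring_loop: "continuous_on S (earring_loop m)"
  unfolding earring_loop_def by (intro continuous_intros)

text \<open>The shift misses the first circle, so it has no inverse; this map squeezes that circle
  to the base point and enlarges every other circle to its predecessor.\<close>

definition collapse :: "real \<times> real \<Rightarrow> real \<times> real" where
  "collapse z = (if z = 0 then 0 else if circle_index z \<le> 1 then 0 else earring_loop (circle_index z - 1) (angle z))"

lemma collapse_loop:
  assumes "t \<in> {0..1}" "m \<ge> 1"
  shows "collapse (earring_loop (Suc m) t) = earring_loop m t"
proof (cases "t = 0 \<or> t = 1")
  case False
  then have t: "0 < t" "t < 1" using assms by auto
  show ?thesis
    using circle_index_loop(2)[OF _ t, of "Suc m"] angle_loop[OF _ t, of "Suc m"]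
      earring_loop_nonzero[OF _ t, of "Suc m"] assms(2) by (simp add: collapse_def)
qed (auto simp: collapse_def)

lemma continuous_on_collapse: "continuous_on earring collapse"
proof -
  define F where "F m y = (if m \<le> 1 then 0 else earring_loop (m - 1) y)" for m :: nat and y
  have "continuous_on earring (\<lambda>z. if z = 0 then 0 else F (circle_index z) (angle z))"
  \<comment> \<open>The \<open>m\<close>-th circle is enlarged by the factor m/(m - 1), which is at
    most 2 for \<open>m\<close> at least 2.\<close>
  proof (rule continuous_on_earring_polar_single[where C = 2])
    fix m :: nat assume "m \<ge> 1"
    show "continuous_on {0<..<1} (F m)"
      unfolding F_def by (cases "m \<le> 1") (auto intro: continuous_on_earring_loop)
    fix y :: real
    show "norm (F m y) \<le> 2 * norm (earring_loop m y)"
    proof (cases "m \<le> 1")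
      case False
      then have "2 / real (m - 1) \<le> 2 * (2 / real m)" by (simp add: field_simps of_nat_diff)
      then have "2 / real (m - 1) * \<bar>sin (pi * y)\<bar> \<le> 2 * (2 / real m) * \<bar>sin (pi * y)\<bar>"
        by (rule mult_right_mono) simp
      then show ?thesis using False by (simp add: F_def norm_earring_loop)
    qed (simp add: F_def)
  qed
  then show ?thesis by (rule continuous_on_eq) (simp add: F_def collapse_def)
qed

lemma collapse_in_earring: "collapse z \<in> earring"
  by (auto simp: collapse_def intro!: earring_loop_in_earring)

lemma continuous_map_collapse: "continuous_map earring_top earring_top collapse"
  using continuous_on_collapse collapse_in_earring by auto

lemma earring_shift_zero [simp]: "earring_shift 0 = 0"
  using earring_shift_loop[of 1 0] by simp

lemma collapse_shift: "z \<in> earring \<Longrightarrow> collapse (earring_shift z) = z"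
  by (elim earring_cases) (simp add: earring_shift_loop collapse_loop)

lemma collapse_zero [simp]: "collapse 0 = 0" by (simp add: collapse_def)

lemma earring_shift_funpow_loop:
  "m \<ge> 1 \<Longrightarrow> t \<in> {0..1} \<Longrightarrow> (earring_shift ^^ n) (earring_loop m t) = earring_loop (m + n) t"
  by (induction n) (simp_all add: earring_shift_loop)

lemma norm_earring_shift_funpow:
  assumes "z \<in> earring" "n \<ge> 1" shows "norm ((earring_shift ^^ n) z) \<le> 2 / real n"
proof -
  obtain m t where mt: "m \<ge> 1" "t \<in> {0..1}" "z = earring_loop m t"
    using assms(1) by (rule earring_cases)
  have "norm ((earring_shift ^^ n) z) = 2 / real (m + n) * \<bar>sin (pi * t)\<bar>"
    unfolding mt(3) earring_shift_funpow_loop[OF mt(1,2)] norm_earring_loop ..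
  also have "\<dots> \<le> 2 / real (m + n) * 1" by (intro mult_left_mono) auto
  also have "\<dots> \<le> 2 / real n" using assms(2) mt(1) by (simp add: field_simps)
  finally show ?thesis .
qed

section \<open>Loops in the earring have closed lifts\<close>

interpretation torus: self_map earring_top earring_shift
  by standard (rule continuous_map_earring_shift)

lemma loops_in_earring_lift_closed:
  assumes p: "covering_projection E earring_torus p" and \<alpha>: "loop_at earring_top (0, 0) \<alpha>"
    and lift: "is_lift E e p (earring_torus_incl \<circ> \<alpha>) \<alpha>'"
  shows "\<alpha>' 1 = \<alpha>' 0"
proof -
  have incl: "earring_torus_incl x = torus.h (x, 0)" for x by (simp add: earring_torus_incl_def)
  have T: "earring_torus = torus.T" by (simp add: earring_torus_def)
  have "torus.h ((0, 0), 0) \<in> topspace torus.T"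
    by (rule torus.h_in) (use zero_in_earring in \<open>simp add: zero_prod_def\<close>)
  then obtain U where U: "openin torus.T U" "torus.h ((0, 0), 0) \<in> U"
    "\<forall>\<gamma> e \<beta>. pathin torus.T \<gamma> \<longrightarrow> \<gamma> ` {0..1} \<subseteq> U \<longrightarrow> \<gamma> 1 = \<gamma> 0 \<longrightarrow> is_lift E e p \<gamma> \<beta> \<longrightarrow> \<beta> 1 = \<beta> 0"
    by (rule lift_closed_in_evenly_covered[OF p[unfolded T]])
  have ci: "continuous_map earring_top torus.T (\<lambda>x. torus.h (x, 0))"
  proof -
    have "continuous_map earring_top torus.cyl (\<lambda>x. (x, 0))"
      by (intro continuous_map_pairedI) auto
    from continuous_map_compose[OF this torus.continuous_h] show ?thesis by (simp add: o_def)
  qed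
  have "openin earring_top {x \<in> topspace earring_top. torus.h (x, 0) \<in> U}"
    using ci U(1) by (rule openin_continuous_map_preimage)
  then have "openin earring_top {x \<in> earring. torus.h (x, 0) \<in> U}" by simp
  moreover have "0 \<in> {x \<in> earring. torus.h (x, 0) \<in> U}" using U(2) zero_in_earring by (simp add: zero_prod_def)
  ultimately have "\<exists>\<epsilon>>0. \<forall>x\<in>earring. dist x 0 < \<epsilon> \<longrightarrow> x \<in> {x \<in> earring. torus.h (x, 0) \<in> U}"
    unfolding openin_euclidean_subtopology_iff by (elim conjE) (rule bspec)
  then obtain \<epsilon> where \<epsilon>: "\<epsilon> > 0" "\<forall>x\<in>earring. dist x 0 < \<epsilon> \<longrightarrow> x \<in> {x \<in> earring. torus.h (x, 0) \<in> U}"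
    by (elim exE conjE)
  obtain n :: nat where n: "n \<ge> 1" "2 / real n < \<epsilon>"
  proof -
    obtain n where "real n > 2 / \<epsilon>" using reals_Archimedean2 by blast
    then show thesis using \<epsilon>(1) by (intro that[of "Suc n"]) (auto simp: field_simps)
  qed
  \<comment> \<open>Downward induction on \<open>j\<close>. Loops in the \<open>n\<close>-th image
    of the shift stay within \<open>\<epsilon>\<close> of the base point, hence map into the evenly
    covered set \<open>U\<close>; closedness of lifts is then pulled back through one shift at a
    time until \<open>j\<close> is 0.\<close>
  have main: "\<beta> 1 = \<beta> 0" if "loop_at earring_top 0 \<gamma>" "\<gamma> ` {0..1} \<subseteq> (earring_shift ^^ j) ` earring" "j \<le> n"
    "is_lift E e p (\<lambda>t. torus.h (\<gamma> t, 0)) \<beta>" for j \<gamma> e \<beta>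
    using that
  proof (induction "n - j" arbitrary: j \<gamma> e \<beta>)
    case 0
    then have j: "j = n" by simp
    show ?case
    proof (rule U(3)[rule_format, OF _ _ _ 0(5)])
      show "pathin torus.T (\<lambda>t. torus.h (\<gamma> t, 0))"
        using continuous_map_compose[OF _ ci, of "top_of_set {0..1}" \<gamma>] 0(2) by (simp add: loop_at_def pathin_def o_def)
      show "(\<lambda>t. torus.h (\<gamma> t, 0)) ` {0..1} \<subseteq> U"
      proof clarify
        fix t :: real assume "t \<in> {0..1}"
        then obtain x where x: "x \<in> earring" "\<gamma> t = (earring_shift ^^ n) x" using 0(3) j by blast
        have "\<gamma> t \<in> earring" using x torus.funpow_in[of x n] by simp
        moreover have "norm (\<gamma> t) < \<epsilon>" using norm_earring_shift_funpow[OF x(1) n(1)] n(2) x(2) by simp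
        ultimately show "torus.h (\<gamma> t, 0) \<in> U" using \<epsilon>(2) by auto
      qed
      show "torus.h (\<gamma> 1, 0) = torus.h (\<gamma> 0, 0)" using 0(2) by (simp add: loop_at_def)
    qed
  next
    case (Suc k)
    show ?case
    proof (rule torus.lift_closed_if_image_lift_closed[OF p[unfolded T] earring_shift_zero Suc(3) _ Suc(6)])
      fix e' \<beta>' assume l: "is_lift E e' p (\<lambda>t. torus.h (earring_shift (\<gamma> t), 0)) \<beta>'"
      show "\<beta>' 1 = \<beta>' 0"
      proof (rule Suc(1)[of "Suc j" "\<lambda>t. earring_shift (\<gamma> t)" e'])
        show "loop_at earring_top 0 (\<lambda>t. earring_shift (\<gamma> t))"
          using Suc(3) pathin_compose[OF _ continuous_map_earring_shift] by (auto simp: loop_at_def o_def)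
        show "(\<lambda>t. earring_shift (\<gamma> t)) ` {0..1} \<subseteq> (earring_shift ^^ Suc j) ` earring"
        proof (rule image_subsetI)
          fix t :: real assume "t \<in> {0..1}"
          then obtain x where "x \<in> earring" "\<gamma> t = (earring_shift ^^ j) x" using Suc(4) by blast
          then have "earring_shift (\<gamma> t) = (earring_shift ^^ Suc j) x" "x \<in> earring" by simp_all
          then show "earring_shift (\<gamma> t) \<in> (earring_shift ^^ Suc j) ` earring" by (rule image_eqI)
        qed
        show "is_lift E e' p (\<lambda>t. torus.h (earring_shift (\<gamma> t), 0)) \<beta>'" by (rule l)
      qed (use Suc(2,5) in auto)
    qed
  qed
  have "\<alpha> ` {0..1} \<subseteq> (earring_shift ^^ 0) ` earring"
    using \<alpha> by (auto simp: loop_at_def pathin_def continuous_map_def)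
  moreover have "loop_at earring_top 0 \<alpha>" using \<alpha> by (simp add: zero_prod_def)
  moreover have "is_lift E e p (\<lambda>t. torus.h (\<alpha> t, 0)) \<alpha>'" using lift by (simp add: is_lift_def incl)
  ultimately show ?thesis using main[of \<alpha> 0 e \<alpha>'] by simp
qed


section \<open>Noncrossing matchings and word reduction\<close>

type_synonym signed_letter = "nat \<times> bool"

definition opposite :: "signed_letter \<Rightarrow> signed_letter" where
  "opposite x = (fst x, \<not> snd x)"

lemma opposite_opposite [simp]: "opposite (opposite x) = x"
  and fst_opposite [simp]: "fst (opposite x) = fst x"
  and snd_opposite [simp]: "snd (opposite x) = (\<not> snd x)"
  by (auto simp: opposite_def prod_eq_iff)

text \<open>A noncrossing perfect matching of inverse letters records a complete cancellation of the
  word that they spell in the order of \<open>pos\<close>. Unlike a sequence of cancellations, it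
  makes sense for infinitely many letters in any linear order.\<close>

definition nc_matching :: "('i \<Rightarrow> real) \<Rightarrow> ('i \<Rightarrow> signed_letter) \<Rightarrow> 'i set \<Rightarrow> ('i \<times> 'i) set \<Rightarrow> bool" where
  "nc_matching pos lt L P \<longleftrightarrow>
     P \<subseteq> L \<times> L \<and>
     (\<forall>(i, j)\<in>P. pos i < pos j \<and> lt j = opposite (lt i)) \<and>
     (\<forall>i\<in>L. \<exists>q\<in>P. i = fst q \<or> i = snd q) \<and>
     (\<forall>q\<in>P. \<forall>q'\<in>P. {fst q, snd q} \<inter> {fst q', snd q'} \<noteq> {} \<longrightarrow> q = q') \<and>
     (\<forall>(i, j)\<in>P. \<forall>(i', j')\<in>P. \<not> (pos i < pos i' \<and> pos i' < pos j \<and> pos j < pos j'))"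

lemma nc_matchingD:
  assumes "nc_matching pos lt L P"
  shows "P \<subseteq> L \<times> L"
    and "(i, j) \<in> P \<Longrightarrow> pos i < pos j"
    and "(i, j) \<in> P \<Longrightarrow> lt j = opposite (lt i)"
    and "i \<in> L \<Longrightarrow> \<exists>q\<in>P. i = fst q \<or> i = snd q"
    and "q \<in> P \<Longrightarrow> q' \<in> P \<Longrightarrow> {fst q, snd q} \<inter> {fst q', snd q'} \<noteq> {} \<Longrightarrow> q = q'"
    and "(i, j) \<in> P \<Longrightarrow> (i', j') \<in> P \<Longrightarrow> \<not> (pos i < pos i' \<and> pos i' < pos j \<and> pos j < pos j')"
  using assms unfolding nc_matching_def by (blast, fast, fast, blast, blast, fast)

lemma nc_matching_restrict:
  assumes P: "nc_matching pos lt L P" and L': "L' \<subseteq> L"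
    and closed: "\<And>i j. (i, j) \<in> P \<Longrightarrow> i \<in> L' \<longleftrightarrow> j \<in> L'"
  shows "nc_matching pos lt L' (P \<inter> L' \<times> L')"
proof -
  note D = nc_matchingD[OF P]
  have "\<exists>q\<in>P \<inter> L' \<times> L'. i = fst q \<or> i = snd q" if i: "i \<in> L'" for i
  proof -
    obtain q where q: "q \<in> P" "i = fst q \<or> i = snd q" using D(4) L' i by blast
    then have "q \<in> L' \<times> L'" using closed[of "fst q" "snd q"] i by (cases q) auto
    then show ?thesis using q by blast
  qed
  moreover have "\<forall>(i, j)\<in>P \<inter> L' \<times> L'. pos i < pos j \<and> lt j = opposite (lt i)"
    using D(2,3) by auto
  moreover have "\<forall>q\<in>P \<inter> L' \<times> L'. \<forall>q'\<in>P \<inter> L' \<times> L'. {fst q, snd q} \<inter> {fst q', snd q'} \<noteq> {} \<longrightarrow> q = q'"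
    using D(5) by (meson IntD1)
  moreover have "\<forall>(i, j)\<in>P \<inter> L' \<times> L'. \<forall>(i', j')\<in>P \<inter> L' \<times> L'. \<not> (pos i < pos i' \<and> pos i' < pos j \<and> pos j < pos j')"
    using D(6) by (auto 0 3)
  ultimately show ?thesis unfolding nc_matching_def by simp
qed

text \<open>Koenig's lemma. Matched letters have equal index, so a matching of \<open>L k\<close>
  restricts to one of every smaller \<open>L n\<close>, and each level has only finitely many. The
  union of a coherent sequence covers every letter, since each letter occurs at some level.\<close>

lemma compactness_of_matchings:
  fixes L :: "nat \<Rightarrow> 'i set"
  assumes L: "\<And>n. L n = {i \<in> A. fst (lt i) \<le> n}" and fin: "\<And>n. finite (L n)"
    and ex: "\<And>n. \<exists>P. nc_matching pos lt (L n) P"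
  obtains P where "nc_matching pos lt A P"
proof -
  let ?M = "\<lambda>n P. nc_matching pos lt (L n) P"
  let ?r = "\<lambda>n P. P \<inter> L n \<times> L n"
  have restr: "?M n (?r n P)" if "?M k P" "n \<le> k" for n k P
  proof (rule nc_matching_restrict[OF that(1)])
    show "L n \<subseteq> L k" using that(2) by (auto simp: L)
    fix i j assume ij: "(i, j) \<in> P"
    have "i \<in> A" "j \<in> A" using nc_matchingD(1)[OF that(1)] ij by (auto simp: L)
    moreover have "lt j = opposite (lt i)" by (rule nc_matchingD(3)[OF that(1) ij])
    ultimately show "i \<in> L n \<longleftrightarrow> j \<in> L n" by (simp add: L)
  qed
  have rr: "?r n (?r k P) = ?r n P" if "n \<le> k" for n k P
  proof -
    have "L n \<subseteq> L k" using that by (auto simp: L)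
    then show ?thesis by blast
  qed
  define ext where "ext n P \<longleftrightarrow> ?M n P \<and> (\<forall>k\<ge>n. \<exists>Q. ?M k Q \<and> ?r n Q = P)" for n P
  have finM: "finite {P. ?M n P}" for n
  proof (rule finite_subset)
    show "{P. ?M n P} \<subseteq> Pow (L n \<times> L n)" using nc_matchingD(1)[of pos lt "L n"] by auto
  qed (use fin in simp)
  \<comment> \<open>Otherwise each of the finitely many candidates \<open>P\<close> stops extending
    at some level \<open>k P\<close>, and a matching at the maximum \<open>K\<close> of these levels
    gives a contradiction. The predicate \<open>Q\<close> later prescribes the restriction to the
    previous level.\<close>
  have step: "\<exists>P. ext m P \<and> Q P" if inf: "\<And>k. k \<ge> m \<Longrightarrow> \<exists>P. ?M k P \<and> Q (?r m P)" for m Q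
  proof (rule ccontr)
    assume no: "\<nexists>P. ext m P \<and> Q P"
    have "\<forall>P. \<exists>k. ?M m P \<longrightarrow> Q P \<longrightarrow> k \<ge> m \<and> (\<forall>R. ?M k R \<longrightarrow> ?r m R \<noteq> P)"
    proof
      fix P
      show "\<exists>k. ?M m P \<longrightarrow> Q P \<longrightarrow> k \<ge> m \<and> (\<forall>R. ?M k R \<longrightarrow> ?r m R \<noteq> P)"
      proof (cases "?M m P \<and> Q P")
        case True
        then have "\<not> ext m P" using no by blast
        then show ?thesis using True unfolding ext_def by blast
      qed blast
    qed
    from choice[OF this] obtain k where
      k: "\<forall>P. ?M m P \<longrightarrow> Q P \<longrightarrow> k P \<ge> m \<and> (\<forall>R. ?M (k P) R \<longrightarrow> ?r m R \<noteq> P)" ..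
    define K where "K = Max (insert m (k ` {P. ?M m P}))"
    have K: "m \<le> K" "\<And>P. ?M m P \<Longrightarrow> k P \<le> K"
      unfolding K_def using finM by (auto intro: Max_ge)
    obtain P where P: "?M K P" "Q (?r m P)" using inf[OF K(1)] by (elim exE conjE)
    have m: "?M m (?r m P)" by (rule restr[OF P(1) K(1)])
    note kP = k[rule_format, OF m P(2)]
    have "?M (k (?r m P)) (?r (k (?r m P)) P)" using restr[OF P(1) K(2)[OF m]] .
    moreover have "?r m (?r (k (?r m P)) P) = ?r m P" by (rule rr) (use kP in blast)
    ultimately show False using kP by blast
  qed
  have "\<exists>f. \<forall>n. ext n (f n) \<and> ?r n (f (Suc n)) = f n"
  proof (rule dependent_nat_choice)
    show "\<exists>P. ext 0 P" 
    proof -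
      have "\<exists>P. ?M k P \<and> True" for k using ex by simp
      from step[of 0 "\<lambda>_. True", OF this] show ?thesis by simp
    qed
    fix P n assume e: "ext n P"
    have "\<exists>Q. ?M k Q \<and> ?r n (?r (Suc n) Q) = P" if "k \<ge> Suc n" for k
    proof -
      have "n \<le> k" using that by simp
      then obtain Q where "?M k Q" "?r n Q = P" using e unfolding ext_def by blast
      then show ?thesis using rr[of n "Suc n" Q] by (intro exI[of _ Q]) simp
    qed
    from step[of "Suc n" "\<lambda>R. ?r n R = P", OF this]
    show "\<exists>R. ext (Suc n) R \<and> ?r n R = P" .
  qed
  then obtain f where f0: "\<forall>n. ext n (f n) \<and> ?r n (f (Suc n)) = f n" ..
  then have f: "\<And>n. ext n (f n)" "\<And>n. ?r n (f (Suc n)) = f n" by simp_all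
  have M: "?M n (f n)" for n using f(1) by (simp add: ext_def)
  have mono: "f n \<subseteq> f k" if "n \<le> k" for n k
  proof (rule lift_Suc_mono_le[OF _ that])
    show "f n \<subseteq> f (Suc n)" for n using f(2)[of n] by blast
  qed
  define P where "P = (\<Union>n. f n)"
  have pair: "\<exists>n. q \<in> f n \<and> q' \<in> f n" if qq: "q \<in> P" "q' \<in> P" for q q'
  proof -
    obtain n k where "q \<in> f n" "q' \<in> f k" using qq by (auto simp: P_def)
    then have "q \<in> f (max n k)" "q' \<in> f (max n k)"
      using mono[of n "max n k"] mono[of k "max n k"] by auto
    then show ?thesis by blast
  qed
  have "nc_matching pos lt A P"
    unfolding nc_matching_def
  proof (intro conjI ballI impI)
    show "P \<subseteq> A \<times> A"
    proof
      fix q assume "q \<in> P"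
      then obtain n where "q \<in> f n" by (auto simp: P_def)
      then have "q \<in> L n \<times> L n" using nc_matchingD(1)[OF M] by blast
      then show "q \<in> A \<times> A" by (auto simp: L)
    qed
    show "case q of (i, j) \<Rightarrow> pos i < pos j \<and> lt j = opposite (lt i)" if q: "q \<in> P" for q
    proof -
      obtain n where "(fst q, snd q) \<in> f n" using q by (auto simp: P_def)
      from nc_matchingD(2,3)[OF M this] show ?thesis by (simp add: case_prod_unfold)
    qed
    show "\<exists>q\<in>P. i = fst q \<or> i = snd q" if "i \<in> A" for i
    proof -
      have "i \<in> L (fst (lt i))" using that by (simp add: L)
      from nc_matchingD(4)[OF M this] show ?thesis unfolding P_def by blast
    qed
    fix q q' assume q: "q \<in> P" "q' \<in> P"
    then obtain n where n: "q \<in> f n" "q' \<in> f n" using pair by blast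
    show "q = q'" if "{fst q, snd q} \<inter> {fst q', snd q'} \<noteq> {}"
      using nc_matchingD(5)[OF M n that] .
    show "case q of (i, j) \<Rightarrow> \<forall>(i', j')\<in>P. \<not> (pos i < pos i' \<and> pos i' < pos j \<and> pos j < pos j')"
    proof clarify
      fix i j i' j' assume *: "q = (i, j)" "(i', j') \<in> P" "pos i < pos i'" "pos i' < pos j" "pos j < pos j'"
      then obtain n where n: "(i, j) \<in> f n" "(i', j') \<in> f n" using pair q by blast
      then show False using nc_matchingD(6)[OF M n] *(3-5) by blast
    qed
  qed
  then show thesis by (rule that)
qed

section \<open>Reduced words, and matchings obtained from a stack\<close>

definition reduced_word :: "signed_letter list \<Rightarrow> bool" where
  "reduced_word w \<longleftrightarrow> (\<forall>k. Suc k < length w \<longrightarrow> w ! Suc k \<noteq> opposite (w ! k))"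

text \<open>Left multiplication by a generator or its inverse in the free group, acting on normal
  forms.\<close>

definition push :: "signed_letter \<Rightarrow> signed_letter list \<Rightarrow> signed_letter list" where
  "push x w = (if w \<noteq> [] \<and> hd w = opposite x then tl w else x # w)"

lemma reduced_Nil [simp]: "reduced_word []" by (simp add: reduced_word_def)

lemma reduced_Cons: "reduced_word (x # w) \<longleftrightarrow> reduced_word w \<and> (w \<noteq> [] \<longrightarrow> hd w \<noteq> opposite x)"
proof
  assume r: "reduced_word (x # w)"
  have "w ! Suc k \<noteq> opposite (w ! k)" if "Suc k < length w" for k
    using r[unfolded reduced_word_def, rule_format, of "Suc k"] that by simp
  moreover have "hd w \<noteq> opposite x" if "w \<noteq> []"
    using r[unfolded reduced_word_def, rule_format, of 0] that by (simp add: hd_conv_nth)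
  ultimately show "reduced_word w \<and> (w \<noteq> [] \<longrightarrow> hd w \<noteq> opposite x)" by (simp add: reduced_word_def)
next
  assume r: "reduced_word w \<and> (w \<noteq> [] \<longrightarrow> hd w \<noteq> opposite x)"
  show "reduced_word (x # w)" unfolding reduced_word_def
  proof (intro allI impI)
    fix k assume "Suc k < length (x # w)"
    then show "(x # w) ! Suc k \<noteq> opposite ((x # w) ! k)"
      using r by (cases k) (auto simp: reduced_word_def hd_conv_nth)
  qed
qed

lemma reduced_push: "reduced_word w \<Longrightarrow> reduced_word (push x w)"
  by (cases w) (auto simp: push_def reduced_Cons)

lemma push_opposite: 
  assumes "reduced_word w" shows "push (opposite x) (push x w) = w"
proof (cases w)
  case (Cons y v)
  show ?thesis
  proof (cases "y = opposite x")
    case True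
    then have "v \<noteq> [] \<longrightarrow> hd v \<noteq> x" using assms Cons by (simp add: reduced_Cons)
    then show ?thesis using Cons True by (auto simp: push_def)
  qed (simp add: Cons push_def)
qed (simp add: push_def)

lemma bij_push: "bij_betw (push x) {w. reduced_word w} {w. reduced_word w}"
  by (rule bij_betw_byWitness[where f' = "push (opposite x)"])
     (use push_opposite[of _ x] push_opposite[of _ "opposite x"] in \<open>auto intro: reduced_push\<close>)

text \<open>The word \<open>w\<close> is what is left of the letters in \<open>L\<close> after cancelling those matched by \<open>P\<close>; \<open>S\<close>
  remembers where the remaining ones come from.\<close>

definition stack_state :: "('i \<Rightarrow> real) \<Rightarrow> ('i \<Rightarrow> signed_letter) \<Rightarrow> 'i set \<Rightarrow> signed_letter list \<Rightarrow> bool" where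
  "stack_state pos lt L w \<longleftrightarrow> (\<exists>S P. map lt S = w \<and> distinct S \<and> set S \<subseteq> L \<and>
     nc_matching pos lt (L - set S) P \<and> sorted_wrt (\<lambda>i j. pos j < pos i) S \<and>
     (\<forall>s\<in>set S. \<forall>(i, j)\<in>P. \<not> (pos i < pos s \<and> pos s < pos j)))"

lemma stack_state_empty: "stack_state pos lt {} []"
  unfolding stack_state_def by (intro exI[of _ "[]"] exI[of _ "{}"]) (simp add: nc_matching_def)

lemma stack_state_Nil: "stack_state pos lt L [] \<Longrightarrow> \<exists>P. nc_matching pos lt L P"
  unfolding stack_state_def by auto

text \<open>The only interesting case is that \<open>x\<close> cancels the top \<open>s\<close> of
  the stack. A pair crossing the new pair of \<open>s\<close> and \<open>x\<close> would have to
  enclose \<open>s\<close>, as nothing lies beyond \<open>x\<close>; but no stack element is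
  enclosed by a pair. The remaining stack lies before \<open>s\<close>, so the new pair encloses
  none of it.\<close>

lemma stack_state_push:
  assumes st: "stack_state pos lt L w" and x: "\<And>i. i \<in> L \<Longrightarrow> pos i < pos x"
  shows "stack_state pos lt (insert x L) (push (lt x) w)"
proof -
  obtain S P where S: "map lt S = w" "distinct S" "set S \<subseteq> L" "nc_matching pos lt (L - set S) P"
     "sorted_wrt (\<lambda>i j. pos j < pos i) S" "\<forall>s\<in>set S. \<forall>(i, j)\<in>P. \<not> (pos i < pos s \<and> pos s < pos j)"
    using st unfolding stack_state_def by blast
  have xL: "x \<notin> L" using x by blast
  note D = nc_matchingD[OF S(4)]
  show ?thesis
  proof (cases "w \<noteq> [] \<and> hd w = opposite (lt x)")
    case False
    have "\<not> (pos i < pos x \<and> pos x < pos j)" if "(i, j) \<in> P" for i j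
    proof -
      have "j \<in> L" using D(1) that by blast
      then show ?thesis using x by force
    qed
    note out = this
    have nc: "nc_matching pos lt (insert x L - set (x # S)) P" using S(4) xL by (simp add: Diff_insert_absorb insert_Diff_if)
    show ?thesis unfolding stack_state_def
    proof (intro exI conjI)
      show "map lt (x # S) = push (lt x) w" using False S(1) by (auto simp: push_def)
      show "distinct (x # S)" using S(2,3) xL by auto
      show "sorted_wrt (\<lambda>i j. pos j < pos i) (x # S)" using S(3,5) x by auto
      show "set (x # S) \<subseteq> insert x L" using S(3) by auto
      show "\<forall>t\<in>set (x # S). \<forall>(i, j)\<in>P. \<not> (pos i < pos t \<and> pos t < pos j)" using S(6) out by auto
    qed (rule nc)
  next
    case True
    then obtain s S' where S': "S = s # S'" "lt s = opposite (lt x)" using S(1) by (cases S) auto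
    have s: "s \<in> L" "s \<notin> set S'" "pos s < pos x" "s \<noteq> x" "x \<notin> set S" using S S' x xL by auto
    let ?P = "insert (s, x) P"
    have Lx: "insert x L - set S' = insert x (insert s (L - set S))" using s S' by auto
    have inP: "i \<in> L" "j \<in> L" "i \<noteq> s" "j \<noteq> s" "i \<noteq> x" "j \<noteq> x" if "(i, j) \<in> P" for i j
    proof -
      have "i \<in> L - set S" "j \<in> L - set S" using D(1) that by blast+
      then show "i \<in> L" "j \<in> L" "i \<noteq> s" "j \<noteq> s" "i \<noteq> x" "j \<noteq> x" using S' xL by auto
    qed
    have nc: "nc_matching pos lt (insert x L - set S') ?P"
      unfolding Lx nc_matching_def
    proof (intro conjI)
      show "?P \<subseteq> insert x (insert s (L - set S)) \<times> insert x (insert s (L - set S))" using D(1) by blast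
      show "\<forall>(i, j)\<in>?P. pos i < pos j \<and> lt j = opposite (lt i)"
      proof clarify
        fix i j assume "(i, j) \<in> ?P"
        then consider "i = s" "j = x" | "(i, j) \<in> P" by blast
        then show "pos i < pos j \<and> lt j = opposite (lt i)"
        proof cases
          case 1 then show ?thesis using s S' by simp
        next
          case 2 from D(2,3)[OF 2] show ?thesis by blast
        qed
      qed
      show "\<forall>i\<in>insert x (insert s (L - set S)). \<exists>q\<in>?P. i = fst q \<or> i = snd q"
      proof
        fix i assume "i \<in> insert x (insert s (L - set S))"
        then consider "i = x \<or> i = s" | "i \<in> L - set S" by blast
        then show "\<exists>q\<in>?P. i = fst q \<or> i = snd q"
        proof cases
          case 2 then show ?thesis using D(4)[OF 2] by blast
        qed auto
      qed
      show "\<forall>q\<in>?P. \<forall>q'\<in>?P. {fst q, snd q} \<inter> {fst q', snd q'} \<noteq> {} \<longrightarrow> q = q'"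
      proof (intro ballI impI)
        fix q q' assume q: "q \<in> ?P" "q' \<in> ?P" "{fst q, snd q} \<inter> {fst q', snd q'} \<noteq> {}"
        consider "q \<in> P" "q' \<in> P" | "q = (s, x)" "q' = (s, x)" | "q = (s, x)" "q' \<in> P" | "q \<in> P" "q' = (s, x)"
          using q(1,2) by blast
        then show "q = q'"
        proof cases
          case 1 show ?thesis by (rule D(5)[OF 1 q(3)])
        next
          case 3
          have "(fst q', snd q') \<in> P" using 3(2) by simp
          from inP(3-6)[OF this] show ?thesis using q(3) 3(1) by auto
        next
          case 4
          have "(fst q, snd q) \<in> P" using 4(1) by simp
          from inP(3-6)[OF this] show ?thesis using q(3) 4(2) by auto
        qed simp
      qed
      show "\<forall>(i, j)\<in>?P. \<forall>(i', j')\<in>?P. \<not> (pos i < pos i' \<and> pos i' < pos j \<and> pos j < pos j')"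
      proof clarify
        fix i j i' j' assume *: "(i, j) \<in> ?P" "(i', j') \<in> ?P" "pos i < pos i'" "pos i' < pos j" "pos j < pos j'"
        have ge: "pos j' \<le> pos x"
        proof (cases "(i', j') \<in> P")
          case True then show ?thesis using x[OF inP(2)] by force
        next
          case False then show ?thesis using *(2) by simp
        qed
        consider "(i, j) \<in> P" "(i', j') \<in> P" | "(i, j) \<in> P" "i' = s" | "j = x"
          using *(1,2) by blast
        then show False
        proof cases
          case 1 then show ?thesis using D(6)[OF 1] *(3-5) by blast
        next
          case 2
          have "s \<in> set S" using S'(1) by simp
          then have "\<not> (pos i < pos s \<and> pos s < pos j)" using S(6) 2(1) by blast
          then show ?thesis using 2(2) *(3,4) by blast
        next
          case 3 then show ?thesis using ge *(5) by simp
        qed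
      qed
    qed
    have out: "\<not> (pos i < pos t \<and> pos t < pos j)" if t: "t \<in> set S'" "(i, j) \<in> ?P" for t i j
    proof -
      have ts: "pos t < pos s" using S(5) S'(1) t(1) by simp
      from t(2) consider "i = s" | "(i, j) \<in> P" by blast
      then show ?thesis
      proof cases
        case 1 then show ?thesis using ts by simp
      next
        case 2
        have "t \<in> set S" using t(1) S'(1) by simp
        then show ?thesis using S(6) 2 by blast
      qed
    qed
    show ?thesis unfolding stack_state_def
    proof (intro exI conjI)
      show "map lt S' = push (lt x) w" using True S(1) S'(1) by (auto simp: push_def)
      show "distinct S'" "sorted_wrt (\<lambda>i j. pos j < pos i) S'" using S(2,5) S'(1) by simp_all
      show "set S' \<subseteq> insert x L" using S(3) S'(1) by auto
      show "\<forall>t\<in>set S'. \<forall>(i, j)\<in>?P. \<not> (pos i < pos t \<and> pos t < pos j)" using out by blast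
    qed (rule nc)
  qed
qed


section \<open>Excursions of a loop in the earring\<close>

text \<open>In the locale \<open>assembly\<close> below, at most one summand is nonzero at each
  point; the sum then selects the value of the active index, or 0 if there is none.\<close>

definition assemble :: "'i set \<Rightarrow> ('i \<Rightarrow> nat) \<Rightarrow> ('i \<Rightarrow> 'x \<Rightarrow> real) \<Rightarrow> 'x \<Rightarrow> real \<times> real" where
  "assemble A lab G x =
     (\<Sum>i | i \<in> A \<and> earring_loop (lab i) (G i x) \<noteq> 0. earring_loop (lab i) (G i x))"

lemma assemble_zero:
  assumes "\<And>i. i \<in> A \<Longrightarrow> earring_loop (lab i) (G i x) = 0"
  shows "assemble A lab G x = 0"
proof -
  have "{i. i \<in> A \<and> earring_loop (lab i) (G i x) \<noteq> 0} = {}" using assms by blast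
  then show ?thesis unfolding assemble_def by (simp only: sum.empty)
qed

lemma assemble_single:
  assumes "i \<in> A" "\<And>j. j \<in> A \<Longrightarrow> j \<noteq> i \<Longrightarrow> earring_loop (lab j) (G j x) = 0"
  shows "assemble A lab G x = earring_loop (lab i) (G i x)"
proof (cases "earring_loop (lab i) (G i x) = 0")
  case True
  have "assemble A lab G x = 0"
    by (rule assemble_zero) (use True assms in blast)
  then show ?thesis using True by simp
next
  case False
  then have "{i. i \<in> A \<and> earring_loop (lab i) (G i x) \<noteq> 0} = {i}" using assms by blast
  then show ?thesis by (simp add: assemble_def)
qed

locale assembly =
  fixes A :: "'i set" and lab :: "'i \<Rightarrow> nat" and G :: "'i \<Rightarrow> 'x::metric_space \<Rightarrow> real" and S :: "'x set"
  assumes lab_pos: "i \<in> A \<Longrightarrow> lab i \<ge> 1"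
    and fin: "finite {i \<in> A. lab i \<le> n}"
    and cont: "i \<in> A \<Longrightarrow> continuous_on S (G i)"
    and disj: "x \<in> S \<Longrightarrow> i \<in> A \<Longrightarrow> j \<in> A \<Longrightarrow> earring_loop (lab i) (G i x) \<noteq> 0 \<Longrightarrow>
       earring_loop (lab j) (G j x) \<noteq> 0 \<Longrightarrow> i = j"
begin

lemma assemble_cases:
  assumes "x \<in> S"
  obtains "assemble A lab G x = 0" "\<forall>i\<in>A. earring_loop (lab i) (G i x) = 0"
  | i where "i \<in> A" "assemble A lab G x = earring_loop (lab i) (G i x)"
     "\<forall>j\<in>A. j \<noteq> i \<longrightarrow> earring_loop (lab j) (G j x) = 0"
proof (cases "\<exists>i\<in>A. earring_loop (lab i) (G i x) \<noteq> 0")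
  case True
  then obtain i where i: "i \<in> A" "earring_loop (lab i) (G i x) \<noteq> 0" by blast
  then have *: "\<forall>j\<in>A. j \<noteq> i \<longrightarrow> earring_loop (lab j) (G j x) = 0" using disj[OF assms] by blast
  have "assemble A lab G x = earring_loop (lab i) (G i x)"
    by (rule assemble_single[OF i(1)]) (use * in blast)
  then show ?thesis using that(2) i(1) * by blast
next
  case False
  then show ?thesis using that(1) assemble_zero[of A lab G x] by blast
qed

lemma assemble_in_earring: "x \<in> S \<Longrightarrow> assemble A lab G x \<in> earring"
proof -
  assume "x \<in> S"
  then show ?thesis
  proof (cases rule: assemble_cases)
    case (2 i)
    then show ?thesis using earring_loop_in_earring[OF lab_pos[OF 2(1)]] by simp
  qed simp
qed

text \<open>The finite partial sums over labels up to \<open>n\<close> converge uniformly, because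
  an omitted term lies on a circle of diameter less than 2/n.\<close>

lemma continuous_on_assemble: "continuous_on S (assemble A lab G)"
proof (rule uniform_limit_theorem)
  let ?s = "\<lambda>n x. \<Sum>i | i \<in> A \<and> lab i \<le> n. earring_loop (lab i) (G i x)"
  show "\<forall>\<^sub>F n in sequentially. continuous_on S (?s n)"
    by (intro always_eventually allI continuous_on_sum continuous_on_compose2[OF continuous_on_earring_loop] cont) auto
  show "uniform_limit S ?s (assemble A lab G) sequentially"
  proof (rule uniform_limitI)
    fix e :: real assume e: "e > 0"
    obtain n0 where n0: "real n0 > 2 / e" using reals_Archimedean2 by blast
    have "dist (?s n x) (assemble A lab G x) < e" if n: "n \<ge> n0" and x: "x \<in> S" for n x
      using x
    proof (cases rule: assemble_cases)
      case 1
      then have "?s n x = 0" by (intro sum.neutral) auto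
      then show ?thesis using 1 e by simp
    next
      case (2 i)
      show ?thesis
      proof (cases "lab i \<le> n")
        case True
        have "?s n x = (\<Sum>j\<in>{i}. earring_loop (lab j) (G j x))"
          by (rule sum.mono_neutral_right[OF fin]) (use 2 True in auto)
        then show ?thesis using 2 e by simp
      next
        case False
        have z: "?s n x = 0"
        proof (rule sum.neutral, intro ballI)
          fix j assume j: "j \<in> {j. j \<in> A \<and> lab j \<le> n}"
          then have "j \<noteq> i" using False by auto
          then show "earring_loop (lab j) (G j x) = 0" using 2(3) j by blast
        qed
        have "norm (assemble A lab G x) \<le> 2 / real (lab i) * 1"
          unfolding 2(2) norm_earring_loop by (intro mult_left_mono) auto
        also have "\<dots> < e"
        proof -
          have "real n0 < real (lab i)" using False n by simp
          then have "2 / e < real (lab i)" using n0 by linarith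
          then show ?thesis using e lab_pos[OF 2(1)] by (simp add: divide_less_eq mult.commute)
        qed
        finally show ?thesis by (simp add: z dist_norm)
      qed
    qed
    then show "\<forall>\<^sub>F n in sequentially. \<forall>x\<in>S. dist (?s n x) (assemble A lab G x) < e"
      unfolding eventually_sequentially by blast
  qed
qed simp

end

definition stretch :: "real \<Rightarrow> real" where
  "stretch y = max 0 (min 1 (2 * y - 1/2))"

lemma continuous_on_stretch: "continuous_on S stretch"
  unfolding stretch_def by (intro continuous_intros)

lemma stretch_bounds: "0 \<le> stretch y" "stretch y \<le> 1"
  by (auto simp: stretch_def)

lemma stretch_low: "y \<le> 1/4 \<Longrightarrow> stretch y = 0"
  and stretch_high: "3/4 \<le> y \<Longrightarrow> stretch y = 1"
  by (auto simp: stretch_def)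

text \<open>Together with \<open>norm_earring_loop\<close> this keeps the middle half of the
  \<open>m\<close>-th circle at distance at least 1/m from the base point. The bound 1/2 is
  convenient, not sharp.\<close>

lemma sin_pi_ge_half:
  assumes "1/4 \<le> y" "y \<le> 3/4" shows "sin (pi * y) \<ge> 1/2"
proof -
  have low: "sin (pi * y) \<ge> 1/2" if "1/4 \<le> y" "y \<le> 1/2" for y
  proof -
    have "pi / 6 \<le> pi * y" using mult_left_mono[OF that(1), of pi] by simp
    then have "sin (pi / 6) \<le> sin (pi * y)"
      using mult_left_mono[OF that(2), of pi] by (intro sin_monotone_2pi_le) auto
    then show ?thesis by (simp add: sin_30)
  qed
  show ?thesis
  proof (cases "y \<le> 1/2")
    case False
    have "sin (pi * y) = sin (pi * (1 - y))" by (simp add: right_diff_distrib sin_diff)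
    then show ?thesis using low[of "1 - y"] False assms by simp
  qed (use low assms in simp)
qed

lemma sin_pi_mono:
  assumes "0 \<le> x" "x \<le> y" "y \<le> 1/2" shows "sin (pi * x) \<le> sin (pi * y)"
proof -
  have "0 \<le> pi * x" "pi * x \<le> pi * y" "pi * y \<le> pi * (1/2)" using assms by (auto intro!: mult_left_mono)
  then show ?thesis by (intro sin_monotone_2pi_le) (use pi_ge_zero in linarith)+
qed

lemma sin_pi_reflect: "sin (pi * (1 - y)) = sin (pi * y)"
  by (simp add: right_diff_distrib sin_diff)

text \<open>Stretching moves a parameter towards its nearer endpoint, and the sine of pi y decreases
  in that direction on either side of 1/2. This is the bound, uniform in \<open>m\<close>, for
  continuity at the base point.\<close>

lemma norm_loop_stretch:
  assumes "0 < y" "y < 1" "0 \<le> s" "s \<le> 1"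
  shows "norm (earring_loop m ((1 - s) * y + s * stretch y)) \<le> norm (earring_loop m y)"
proof -
  let ?y = "(1 - s) * y + s * stretch y"
  have in01: "0 \<le> ?y" "?y \<le> 1"
  proof -
    show "0 \<le> ?y" using assms stretch_bounds[of y] by simp
    have "?y \<le> (1 - s) * 1 + s * 1" using assms stretch_bounds[of y] by (intro add_mono mult_left_mono) auto
    then show "?y \<le> 1" by simp
  qed
  have eq: "?y - y = s * (stretch y - y)" by (simp add: algebra_simps)
  have "sin (pi * ?y) \<le> sin (pi * y)"
  proof (cases "y \<le> 1/2")
    case True
    have "stretch y - y \<le> 0" using True assms(1) by (simp add: stretch_def)
    then have "?y \<le> y" using eq assms(3) mult_nonneg_nonpos[of s "stretch y - y"] by linarith
    then show ?thesis using sin_pi_mono[OF in01(1) _ True] by blast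
  next
    case False
    have "0 \<le> stretch y - y" using False assms(2) by (simp add: stretch_def)
    then have "y \<le> ?y" using eq assms(3) mult_nonneg_nonneg[of s "stretch y - y"] by linarith
    then have "sin (pi * (1 - ?y)) \<le> sin (pi * (1 - y))" using in01 False by (intro sin_pi_mono) auto
    then show ?thesis by (simp only: sin_pi_reflect)
  qed
  moreover have "0 \<le> sin (pi * ?y)"
    using in01 mult_left_mono[OF in01(2), of pi] by (intro sin_ge_zero) auto
  moreover have "0 \<le> sin (pi * y)"
    using assms mult_left_mono[of y 1 pi] by (intro sin_ge_zero) auto
  ultimately show ?thesis unfolding norm_earring_loop by (intro mult_left_mono) auto
qed

section \<open>The excursions of a fixed loop and their phases\<close>

locale earring_path =
  fixes \<beta> :: "real \<Rightarrow> real \<times> real"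
  assumes cont_\<beta>: "continuous_on {0..1} \<beta>" and \<beta>_in: "t \<in> {0..1} \<Longrightarrow> \<beta> t \<in> earring"
    and \<beta>_0: "\<beta> 0 = 0" and \<beta>_1: "\<beta> 1 = 0"
begin

text \<open>The connected components of the set of times at which the loop is off the base point,
  encoded by their endpoints.\<close>

definition excursions :: "(real \<times> real) set" where
  "excursions = {I. 0 \<le> fst I \<and> fst I < snd I \<and> snd I \<le> 1 \<and> \<beta> (fst I) = 0 \<and> \<beta> (snd I) = 0 \<and>
     (\<forall>t\<in>{fst I<..<snd I}. \<beta> t \<noteq> 0)}"

text \<open>The midpoint is an arbitrary sample time: the circle index is constant on an excursion
  by \<open>circle_index_excursion\<close>.\<close>

definition lab :: "real \<times> real \<Rightarrow> nat" where
  "lab I = circle_index (\<beta> ((fst I + snd I) / 2))"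

lemma excursion_exists:
  assumes t: "t \<in> {0..1}" and nz: "\<beta> t \<noteq> 0"
  obtains I where "I \<in> excursions" "t \<in> {fst I<..<snd I}"
proof -
  \<comment> \<open>The excursion around \<open>t\<close> runs from the last zero before
    \<open>t\<close> to the first zero after it; both exist by compactness.\<close>
  define Z where "Z = {u \<in> {0..1}. \<beta> u = 0}"
  have "Z = {0..1} \<inter> \<beta> -` {0}" by (auto simp: Z_def)
  then have clZ: "closed Z" using continuous_closed_preimage[OF cont_\<beta>, of "{0}"] by simp
  have comp: "compact (Z \<inter> {0..t})" "compact (Z \<inter> {t..1})"
    using clZ by (simp_all add: compact_Int_closed closed_Int_compact)
  have "0 \<in> Z \<inter> {0..t}" "1 \<in> Z \<inter> {t..1}" using t \<beta>_0 \<beta>_1 by (auto simp: Z_def)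
  then obtain a b where a: "a \<in> Z \<inter> {0..t}" "\<forall>u\<in>Z \<inter> {0..t}. u \<le> a" and b: "b \<in> Z \<inter> {t..1}" "\<forall>u\<in>Z \<inter> {t..1}. b \<le> u"
    using compact_attains_sup[OF comp(1)] compact_attains_inf[OF comp(2)] by blast
  have "a \<noteq> t" "b \<noteq> t" using a b nz by (auto simp: Z_def)
  then have ab: "a < t" "t < b" using a b by auto
  show thesis
  proof (rule that[of "(a, b)"])
    have "\<beta> u \<noteq> 0" if u: "u \<in> {a<..<b}" for u
    proof
      assume "\<beta> u = 0"
      moreover have "u \<in> {0..1}" using u a(1) b(1) by (auto simp: Z_def)
      ultimately have "u \<in> Z" by (simp add: Z_def)
      then have "u \<in> Z \<inter> {0..t} \<or> u \<in> Z \<inter> {t..1}" using u a(1) b(1) by (auto simp: Z_def)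
      then show False
      proof
        assume "u \<in> Z \<inter> {0..t}"
        then have "u \<le> a" using a(2) by blast
        then show False using u by simp
      next
        assume "u \<in> Z \<inter> {t..1}"
        then have "b \<le> u" using b(2) by blast
        then show False using u by simp
      qed
    qed
    then show "(a, b) \<in> excursions" using a(1) b(1) ab by (auto simp: excursions_def Z_def)
  qed (use ab in simp)
qed

lemma excursionD:
  assumes "I \<in> excursions"
  shows "0 \<le> fst I" "fst I < snd I" "snd I \<le> 1" "\<beta> (fst I) = 0" "\<beta> (snd I) = 0"
    "t \<in> {fst I<..<snd I} \<Longrightarrow> \<beta> t \<noteq> 0" "t \<in> {fst I<..<snd I} \<Longrightarrow> t \<in> {0..1}"
    "t \<in> {fst I<..<snd I} \<Longrightarrow> \<beta> t \<in> earring - {0}"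
proof -
  show *: "0 \<le> fst I" "fst I < snd I" "snd I \<le> 1" "\<beta> (fst I) = 0" "\<beta> (snd I) = 0"
    "t \<in> {fst I<..<snd I} \<Longrightarrow> \<beta> t \<noteq> 0"
    using assms by (auto simp: excursions_def)
  then show "t \<in> {fst I<..<snd I} \<Longrightarrow> t \<in> {0..1}" by auto
  then show "t \<in> {fst I<..<snd I} \<Longrightarrow> \<beta> t \<in> earring - {0}" using * \<beta>_in by blast
qed

lemma excursions_disjoint:
  assumes "I \<in> excursions" "J \<in> excursions" "I \<noteq> J"
  shows "snd I \<le> fst J \<or> snd J \<le> fst I"
proof (rule ccontr)
  assume "\<not> (snd I \<le> fst J \<or> snd J \<le> fst I)"
  then have ov: "fst J < snd I" "fst I < snd J" by auto
  have "fst I = fst J"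
  proof (rule ccontr)
    assume "fst I \<noteq> fst J"
    then have "fst J \<in> {fst I<..<snd I} \<or> fst I \<in> {fst J<..<snd J}" using ov by auto
    then show False using excursionD(4,6)[OF assms(1)] excursionD(4,6)[OF assms(2)] by blast
  qed
  moreover have "snd I = snd J"
  proof (rule ccontr)
    assume "snd I \<noteq> snd J"
    then have "snd J \<in> {fst I<..<snd I} \<or> snd I \<in> {fst J<..<snd J}" using ov by auto
    then show False using excursionD(5,6)[OF assms(1)] excursionD(5,6)[OF assms(2)] by blast
  qed
  ultimately show False using assms(3) by (simp add: prod_eq_iff)
qed

lemma excursion_unique:
  assumes "I \<in> excursions" "J \<in> excursions" "t \<in> {fst I<..<snd I}" "t \<in> {fst J<..<snd J}"
  shows "I = J"
  using excursions_disjoint[OF assms(1,2)] assms(3,4) by auto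

lemma continuous_on_excursion:
  assumes "I \<in> excursions"
  shows "continuous_on {fst I<..<snd I} (\<lambda>t. angle (\<beta> t))"
    and "continuous_on {fst I<..<snd I} (\<lambda>t. real (circle_index (\<beta> t)))"
proof -
  have b: "continuous_on {fst I<..<snd I} \<beta>"
    by (rule continuous_on_subset[OF cont_\<beta>]) (use excursionD(7)[OF assms] in blast)
  have im: "\<beta> ` {fst I<..<snd I} \<subseteq> earring - {0}"
    by (rule image_subsetI) (rule excursionD(8)[OF assms])
  show "continuous_on {fst I<..<snd I} (\<lambda>t. angle (\<beta> t))"
    by (rule continuous_on_compose2[OF continuous_on_angle b im])
  show "continuous_on {fst I<..<snd I} (\<lambda>t. real (circle_index (\<beta> t)))"
    by (rule continuous_on_compose2[OF continuous_on_circle_index b im])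
qed

text \<open>A continuous function on an interval with integer values is constant, since distinct
  values differ by at least 1.\<close>

lemma circle_index_excursion:
  assumes I: "I \<in> excursions" and t: "t \<in> {fst I<..<snd I}"
  shows "circle_index (\<beta> t) = lab I"
proof -
  have "(\<lambda>t. real (circle_index (\<beta> t))) constant_on {fst I<..<snd I}"
  proof (rule continuous_discrete_range_constant[OF _ continuous_on_excursion(2)[OF I]])
    fix x assume "x \<in> {fst I<..<snd I}"
    have "1 \<le> norm (real (circle_index (\<beta> y)) - real (circle_index (\<beta> x)))"
      if "real (circle_index (\<beta> y)) \<noteq> real (circle_index (\<beta> x))" for y
      using that by (auto simp: real_norm_def)
    then show "\<exists>e>0. \<forall>y. y \<in> {fst I<..<snd I} \<and> real (circle_index (\<beta> y)) \<noteq> real (circle_index (\<beta> x)) \<longrightarrow>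
        e \<le> norm (real (circle_index (\<beta> y)) - real (circle_index (\<beta> x)))"
      by (intro exI[of _ 1]) auto
  qed simp
  moreover have "(fst I + snd I) / 2 \<in> {fst I<..<snd I}" using excursionD(2)[OF I] by simp
  ultimately show ?thesis using t unfolding constant_on_def lab_def by (metis of_nat_eq_iff)
qed

lemma lab_pos: "I \<in> excursions \<Longrightarrow> lab I \<ge> 1"
  and \<beta>_excursion: "I \<in> excursions \<Longrightarrow> t \<in> {fst I<..<snd I} \<Longrightarrow>
      \<beta> t = earring_loop (lab I) (angle (\<beta> t)) \<and> 0 < angle (\<beta> t) \<and> angle (\<beta> t) < 1"
proof -
  assume I: "I \<in> excursions"
  have "(fst I + snd I) / 2 \<in> {fst I<..<snd I}" using excursionD(2)[OF I] by simp
  from excursionD(8)[OF I this] show "lab I \<ge> 1" unfolding lab_def using earring_polar(1) by blast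
  assume t: "t \<in> {fst I<..<snd I}"
  have e: "\<beta> t \<in> earring" "\<beta> t \<noteq> 0" using excursionD(8)[OF I t] by auto
  show "\<beta> t = earring_loop (lab I) (angle (\<beta> t)) \<and> 0 < angle (\<beta> t) \<and> angle (\<beta> t) < 1"
    using earring_polar(2-4)[OF e] circle_index_excursion[OF I t] by simp
qed

text \<open>Points of the middle half of the circle are too far from the base point, so the angle
  avoids [1/4, 3/4]; by connectedness it cannot pass from one outer quarter to the other.\<close>

lemma small_excursion_part:
  assumes I: "I \<in> excursions" and J: "{u<..<v} \<subseteq> {fst I<..<snd I}"
    and small: "\<And>t. t \<in> {u<..<v} \<Longrightarrow> norm (\<beta> t) < 1 / real (lab I)"
  shows "(\<forall>t\<in>{u<..<v}. angle (\<beta> t) < 1/4) \<or> (\<forall>t\<in>{u<..<v}. angle (\<beta> t) > 3/4)"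
proof (rule ccontr)
  have out: "angle (\<beta> t) < 1/4 \<or> angle (\<beta> t) > 3/4" if t: "t \<in> {u<..<v}" for t
  proof (rule ccontr)
    assume "\<not> ?thesis"
    then have "sin (pi * angle (\<beta> t)) \<ge> 1/2" by (intro sin_pi_ge_half) auto
    then have "2 / real (lab I) * (1/2) \<le> 2 / real (lab I) * \<bar>sin (pi * angle (\<beta> t))\<bar>"
      by (intro mult_left_mono) auto
    also have "\<dots> = norm (\<beta> t)"
      using \<beta>_excursion[OF I, of t] J t norm_earring_loop[of "lab I" "angle (\<beta> t)"] by auto
    finally show False using small[OF t] by simp
  qed
  assume "\<not> ?thesis"
  then obtain t t' where t: "t \<in> {u<..<v}" "t' \<in> {u<..<v}" "\<not> angle (\<beta> t) < 1/4" "\<not> angle (\<beta> t') > 3/4" by blast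
  have conn: "connected ((\<lambda>t. angle (\<beta> t)) ` {u<..<v})"
    by (rule connected_continuous_image[OF continuous_on_subset[OF continuous_on_excursion(1)[OF I] J]]) simp
  have "angle (\<beta> t') \<le> 1/2" "1/2 \<le> angle (\<beta> t)" using out[OF t(1)] out[OF t(2)] t(3,4) by auto
  then have "1/2 \<in> (\<lambda>t. angle (\<beta> t)) ` {u<..<v}"
    by (rule connectedD_interval[OF conn imageI[OF t(2)] imageI[OF t(1)]])
  then obtain w where "w \<in> {u<..<v}" "angle (\<beta> w) = 1/2" by auto
  then show False using out[of w] by simp
qed

lemma \<beta>_near_zero:
  assumes "c \<in> {0..1}" "\<beta> c = 0" "e > 0"
  obtains d where "d > 0" "\<forall>t\<in>{0..1}. \<bar>t - c\<bar> < d \<longrightarrow> norm (\<beta> t) < e"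
proof -
  have "\<exists>d>0. \<forall>t\<in>{0..1}. dist t c < d \<longrightarrow> dist (\<beta> t) (\<beta> c) < e"
    using cont_\<beta>[unfolded continuous_on_iff, rule_format, OF assms(1,3)] .
  then show thesis using that assms(2) by (auto simp: dist_real_def)
qed

text \<open>Towards an endpoint of an excursion the angle tends to 0 or to 1, and
  \<open>low_at\<close> singles out the first case. A bound by 1/4 is enough, because
  \<open>stretch\<close> turns it into the exact value 0.\<close>

definition low_at :: "real \<Rightarrow> real \<times> real \<Rightarrow> bool" where
  "low_at c I \<longleftrightarrow> (\<exists>d>0. \<forall>t\<in>{fst I<..<snd I}. \<bar>t - c\<bar> < d \<longrightarrow> angle (\<beta> t) < 1/4)"

lemma endpoint_type:
  assumes I: "I \<in> excursions" and c: "c \<in> {fst I, snd I}"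
  obtains d where "d > 0" "\<forall>t\<in>{fst I<..<snd I}. \<bar>t - c\<bar> < d \<longrightarrow>
    (if low_at c I then angle (\<beta> t) < 1/4 else angle (\<beta> t) > 3/4)"
proof (cases "low_at c I")
  case True
  then show ?thesis using that unfolding low_at_def by auto
next
  case False
  have "c \<in> {0..1}" "\<beta> c = 0" "1 / real (lab I) > 0"
    using excursionD(1-5)[OF I] lab_pos[OF I] c by auto
  then obtain d where d: "d > 0" "\<forall>t\<in>{0..1}. \<bar>t - c\<bar> < d \<longrightarrow> norm (\<beta> t) < 1 / real (lab I)"
    by (rule \<beta>_near_zero)
  define J where "J = {max (fst I) (c - d)<..<min (snd I) (c + d)}"
  have J: "t \<in> J \<longleftrightarrow> t \<in> {fst I<..<snd I} \<and> \<bar>t - c\<bar> < d" for t by (auto simp: J_def)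
  have "(\<forall>t\<in>J. angle (\<beta> t) < 1/4) \<or> (\<forall>t\<in>J. angle (\<beta> t) > 3/4)"
    unfolding J_def
  proof (rule small_excursion_part[OF I], fold J_def)
    show "J \<subseteq> {fst I<..<snd I}" using J by blast
    show "norm (\<beta> t) < 1 / real (lab I)" if "t \<in> J" for t
      using that J d(2) excursionD(7)[OF I, of t] by blast
  qed
  moreover have "\<not> (\<forall>t\<in>J. angle (\<beta> t) < 1/4)" using False d(1) J unfolding low_at_def by blast
  ultimately show ?thesis using that[OF d(1)] False J by auto
qed

definition phase_at :: "real \<Rightarrow> real \<times> real \<Rightarrow> real" where
  "phase_at c I = (if low_at c I then 0 else 1)"

abbreviation start_phase :: "real \<times> real \<Rightarrow> real" where "start_phase I \<equiv> phase_at (fst I) I"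
abbreviation end_phase :: "real \<times> real \<Rightarrow> real" where "end_phase I \<equiv> phase_at (snd I) I"

lemma loop_phase_at [simp]: "earring_loop m (phase_at c I) = 0"
  by (simp add: phase_at_def)

lemma stretch_phase_at:
  "if low_at c I then y < 1/4 else y > 3/4 \<Longrightarrow> stretch y = phase_at c I"
  by (auto simp: phase_at_def stretch_low stretch_high split: if_splits)

text \<open>The excursions that survive stretching; all others are sent to the base point.\<close>

definition big :: "(real \<times> real) set" where
  "big = {I \<in> excursions. \<exists>t\<in>{fst I<..<snd I}. 1/4 \<le> angle (\<beta> t) \<and> angle (\<beta> t) \<le> 3/4}"

lemma big_excursion: "I \<in> big \<Longrightarrow> I \<in> excursions"
  by (simp add: big_def)

text \<open>A big excursion on one of the first \<open>n\<close> circles moves a definite distance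
  away from the base point, so by uniform continuity it lasts at least \<open>d\<close>. Only
  finitely many disjoint intervals of that length fit into [0,1].\<close>

lemma finite_big: "finite {I \<in> big. lab I \<le> n}"
proof -
  have "uniformly_continuous_on {0..1} \<beta>"
    by (rule compact_uniformly_continuous[OF cont_\<beta>]) simp
  moreover have "1 / real (Suc n) > 0" by simp
  ultimately obtain d where d: "d > 0"
    "\<forall>t\<in>{0..1}. \<forall>t'\<in>{0..1}. dist t' t < d \<longrightarrow> dist (\<beta> t') (\<beta> t) < 1 / real (Suc n)"
    unfolding uniformly_continuous_on_def by blast
  have long: "snd I - fst I \<ge> d" if I: "I \<in> big" "lab I \<le> n" for I
  proof (rule ccontr)
    assume short: "\<not> snd I - fst I \<ge> d"
    have ex: "I \<in> excursions" using I(1) by (rule big_excursion)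
    obtain t where t: "t \<in> {fst I<..<snd I}" "1/4 \<le> angle (\<beta> t)" "angle (\<beta> t) \<le> 3/4"
      using I(1) by (auto simp: big_def)
    have "t \<in> {0..1}" "fst I \<in> {0..1}" using excursionD(1-3)[OF ex] t(1) by auto
    moreover have "dist t (fst I) < d" using t(1) short by (auto simp: dist_real_def)
    ultimately have "dist (\<beta> t) (\<beta> (fst I)) < 1 / real (Suc n)" using d(2) by blast
    then have "norm (\<beta> t) < 1 / real (Suc n)" using excursionD(4)[OF ex] by simp
    also have "\<dots> \<le> 1 / real (lab I)" using I(2) lab_pos[OF ex] by (simp add: field_simps)
    also have "\<dots> = 2 / real (lab I) * (1/2)" by simp
    also have "\<dots> \<le> 2 / real (lab I) * \<bar>sin (pi * angle (\<beta> t))\<bar>"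
      using sin_pi_ge_half[OF t(2,3)] by (intro mult_left_mono) auto
    also have "\<dots> = norm (\<beta> t)"
      using \<beta>_excursion[OF ex t(1)] norm_earring_loop[of "lab I" "angle (\<beta> t)"] by simp
    finally show False by simp
  qed
  \<comment> \<open>Starting points at least \<open>d\<close> apart fall into different cells of
    length \<open>d\<close>.\<close>
  have "inj_on (\<lambda>I. \<lfloor>fst I / d\<rfloor>) {I \<in> big. lab I \<le> n}"
  proof (rule inj_onI, rule ccontr)
    fix I J assume I: "I \<in> {I \<in> big. lab I \<le> n}" and J: "J \<in> {I \<in> big. lab I \<le> n}"
      and eq: "\<lfloor>fst I / d\<rfloor> = \<lfloor>fst J / d\<rfloor>" and ne: "I \<noteq> J"
    have "snd I \<le> fst J \<or> snd J \<le> fst I"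
      by (rule excursions_disjoint[OF _ _ ne]) (use I J big_excursion in auto)
    then have "fst J - fst I \<ge> d \<or> fst I - fst J \<ge> d" using long[of I] long[of J] I J by auto
    then have "fst J / d - fst I / d \<ge> 1 \<or> fst I / d - fst J / d \<ge> 1"
      using d(1) by (simp add: le_divide_eq flip: diff_divide_distrib)
    moreover have "\<lfloor>x\<rfloor> < \<lfloor>y\<rfloor>" if "y - x \<ge> 1" for x y :: real using that by linarith
    ultimately show False using eq by (metis less_irrefl)
  qed
  moreover have "(\<lambda>I. \<lfloor>fst I / d\<rfloor>) ` {I \<in> big. lab I \<le> n} \<subseteq> {0..\<lfloor>1 / d\<rfloor>}"
  proof (rule image_subsetI)
    fix I assume "I \<in> {I \<in> big. lab I \<le> n}"
    then have ex: "I \<in> excursions" by (auto intro: big_excursion)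
    have "0 \<le> fst I / d" "fst I / d \<le> 1 / d"
      using excursionD(1-3)[OF ex] d(1) by (auto intro: divide_right_mono)
    then show "\<lfloor>fst I / d\<rfloor> \<in> {0..\<lfloor>1 / d\<rfloor>}" by (auto intro: floor_mono)
  qed
  ultimately show ?thesis by (meson finite_atLeastAtMost_int finite_imageD finite_subset)
qed

definition phase :: "real \<times> real \<Rightarrow> real \<Rightarrow> real" where
  "phase I t = (if t \<le> fst I then start_phase I else if snd I \<le> t then end_phase I else stretch (angle (\<beta> t)))"

definition clamp01 :: "real \<Rightarrow> real" where "clamp01 x = max 0 (min 1 x)"

text \<open>Has the same end values as \<open>phase\<close>. Passing to it removes all turning back
  within an excursion, which becomes either constant or one uniform passage around its
  circle.\<close>

definition linear_phase :: "real \<times> real \<Rightarrow> real \<Rightarrow> real" where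
  "linear_phase I t = start_phase I + (end_phase I - start_phase I) * clamp01 ((t - fst I) / (snd I - fst I))"

lemma continuous_on_clamp01: "continuous_on S f \<Longrightarrow> continuous_on S (\<lambda>x. clamp01 (f x))"
  unfolding clamp01_def by (intro continuous_intros)

lemma clamp01_low: "x \<le> 0 \<Longrightarrow> clamp01 x = 0" and clamp01_high: "1 \<le> x \<Longrightarrow> clamp01 x = 1"
  by (auto simp: clamp01_def)

lemma continuous_phase:
  assumes I: "I \<in> excursions" shows "continuous_on UNIV (phase I)"
proof -
  obtain d where d: "d > 0" "\<forall>t\<in>{fst I<..<snd I}. \<bar>t - fst I\<bar> < d \<longrightarrow>
      (if low_at (fst I) I then angle (\<beta> t) < 1/4 else angle (\<beta> t) > 3/4)"
    by (rule endpoint_type[OF I, of "fst I"]) simp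
  obtain d' where d': "d' > 0" "\<forall>t\<in>{fst I<..<snd I}. \<bar>t - snd I\<bar> < d' \<longrightarrow>
      (if low_at (snd I) I then angle (\<beta> t) < 1/4 else angle (\<beta> t) > 3/4)"
    by (rule endpoint_type[OF I, of "snd I"]) simp
  define A where "A = {..<min (snd I) (fst I + d)}"
  define B where "B = {max (fst I) (snd I - d')<..}"
  have "phase I t = start_phase I" if t: "t \<in> A" for t
  proof (cases "t \<le> fst I")
    case False
    then have "t \<in> {fst I<..<snd I}" "\<bar>t - fst I\<bar> < d" using t by (auto simp: A_def)
    then have "stretch (angle (\<beta> t)) = start_phase I" using d(2) by (intro stretch_phase_at) blast
    then show ?thesis using False t by (simp add: phase_def A_def)
  qed (simp add: phase_def)
  then have 1: "continuous_on A (phase I)" by (intro continuous_on_eq[OF continuous_on_const[of _ "start_phase I"]]) simp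
  have "phase I t = end_phase I" if t: "t \<in> B" for t
  proof (cases "snd I \<le> t")
    case False
    then have "t \<in> {fst I<..<snd I}" "\<bar>t - snd I\<bar> < d'" using t by (auto simp: B_def)
    then have "stretch (angle (\<beta> t)) = end_phase I" using d'(2) by (intro stretch_phase_at) blast
    then show ?thesis using False t by (simp add: phase_def B_def)
  qed (use excursionD(2)[OF I] in \<open>simp add: phase_def\<close>)
  then have 2: "continuous_on B (phase I)" by (intro continuous_on_eq[OF continuous_on_const[of _ "end_phase I"]]) simp
  have "continuous_on {fst I<..<snd I} (\<lambda>t. stretch (angle (\<beta> t)))"
    by (rule continuous_on_compose2[OF continuous_on_stretch[of UNIV] continuous_on_excursion(1)[OF I]]) simp
  then have 3: "continuous_on {fst I<..<snd I} (phase I)"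
    by (rule continuous_on_eq) (simp add: phase_def)
  have "continuous_on (A \<union> {fst I<..<snd I} \<union> B) (phase I)"
    using 1 2 3 by (intro continuous_on_open_Un) (auto simp: A_def B_def)
  moreover have "A \<union> {fst I<..<snd I} \<union> B = UNIV"
    using d(1) d'(1) excursionD(2)[OF I] by (auto simp: A_def B_def)
  ultimately show ?thesis by simp
qed

lemma phase_outside: "I \<in> excursions \<Longrightarrow> t \<notin> {fst I<..<snd I} \<Longrightarrow> phase I t = start_phase I \<and> linear_phase I t = start_phase I \<or> phase I t = end_phase I \<and> linear_phase I t = end_phase I"
proof -
  assume I: "I \<in> excursions" and t: "t \<notin> {fst I<..<snd I}"
  have I2: "fst I < snd I" by (rule excursionD(2)[OF I])
  from t consider "t \<le> fst I" | "snd I \<le> t" by force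
  then show ?thesis
  proof cases
    case 1
    then have "(t - fst I) / (snd I - fst I) \<le> 0" using I2 by (intro divide_nonpos_pos) auto
    then show ?thesis using 1 by (simp add: phase_def linear_phase_def clamp01_low)
  next
    case 2
    then have "1 \<le> (t - fst I) / (snd I - fst I)" using I2 by (simp add: le_divide_eq)
    then show ?thesis using 2 I2 by (simp add: phase_def linear_phase_def clamp01_high)
  qed
qed

lemma continuous_linear_phase:
  assumes "I \<in> excursions" shows "continuous_on UNIV (linear_phase I)"
proof -
  have "snd I - fst I \<noteq> 0" using excursionD(2)[OF assms] by simp
  then show ?thesis unfolding linear_phase_def by (intro continuous_intros continuous_on_clamp01) simp_all
qed

text \<open>The first coordinate is the parameter of the homotopy and the second one is
  time.\<close>

abbreviation mix :: "real \<times> real \<Rightarrow> real \<times> real \<Rightarrow> real" where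
  "mix I z \<equiv> (1 - fst z) * phase I (snd z) + fst z * linear_phase I (snd z)"

lemma mix_outside:
  assumes "I \<in> excursions" "snd z \<notin> {fst I<..<snd I}"
  shows "earring_loop m (mix I z) = 0"
proof -
  have "mix I z = start_phase I \<or> mix I z = end_phase I"
    using phase_outside[OF assms] by (auto simp flip: distrib_right)
  then show ?thesis by auto
qed

lemma assembly_mix: "assembly big lab mix UNIV"
proof
  show "continuous_on UNIV (mix I)" if "I \<in> big" for I
    by (intro continuous_intros continuous_on_compose2[OF continuous_phase[OF big_excursion[OF that]]]
        continuous_on_compose2[OF continuous_linear_phase[OF big_excursion[OF that]]]) auto
  show "I = J" if "I \<in> big" "J \<in> big" "earring_loop (lab I) (mix I z) \<noteq> 0" "earring_loop (lab J) (mix J z) \<noteq> 0" for I J z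
    using excursion_unique[OF big_excursion[OF that(1)] big_excursion[OF that(2)], of "snd z"]
      mix_outside[OF big_excursion[OF that(1)], of z "lab I"] mix_outside[OF big_excursion[OF that(2)], of z "lab J"] that(3,4) by blast
qed (use lab_pos big_excursion finite_big in auto)

end


section \<open>Null homotopies from matchings\<close>

definition stretch_map :: "(real \<times> real) \<times> real \<Rightarrow> real \<times> real" where
  "stretch_map = (\<lambda>(z, s). if z = 0 then 0
     else earring_loop (circle_index z) ((1 - s) * angle z + s * stretch (angle z)))"

lemma continuous_on_stretch_map: "continuous_on (earring \<times> {0..1}) stretch_map"
  unfolding stretch_map_def
proof (rule continuous_on_earring_polar[where C = 1 and F = "\<lambda>m y s. earring_loop m ((1 - s) * y + s * stretch y)"])
  fix m :: nat
  have "continuous_on ({0<..<1} \<times> {0..1}) (\<lambda>z. (1 - snd z) * fst z + snd z * stretch (fst z))"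
    by (intro continuous_intros continuous_on_compose2[OF continuous_on_stretch[of UNIV]]) auto
  then show "continuous_on ({0<..<1} \<times> {0..1}) (\<lambda>(y, s). earring_loop m ((1 - s) * y + s * stretch y))"
    unfolding case_prod_unfold by (rule continuous_on_compose2[OF continuous_on_earring_loop[of UNIV]]) simp
  fix y s :: real
  assume "0 < y" "y < 1" "s \<in> {0..1}"
  then show "norm (earring_loop m ((1 - s) * y + s * stretch y)) \<le> 1 * norm (earring_loop m y)"
    using norm_loop_stretch by simp
qed

lemma stretch_map_in: "z \<in> earring \<Longrightarrow> stretch_map (z, s) \<in> earring"
  using earring_polar(1)[of z] by (auto simp: stretch_map_def intro!: earring_loop_in_earring)

context earring_path
begin

lemma assemble_on_excursion:
  assumes A: "A \<subseteq> excursions" and I: "I \<in> A" "t \<in> {fst I<..<snd I}"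
    and out: "\<And>J. J \<in> A \<Longrightarrow> t \<notin> {fst J<..<snd J} \<Longrightarrow> earring_loop (lab J) (G J x) = 0"
  shows "assemble A lab G x = earring_loop (lab I) (G I x)"
proof (rule assemble_single[OF I(1)])
  fix J assume J: "J \<in> A" "J \<noteq> I"
  then have "t \<notin> {fst J<..<snd J}" using excursion_unique[of I J t] A I by blast
  then show "earring_loop (lab J) (G J x) = 0" using out J(1) by blast
qed

lemma big_subset: "big \<subseteq> excursions"
  using big_excursion by blast

lemma stretched_eq:
  assumes t: "t \<in> {0..1}"
  shows "stretch_map (\<beta> t, 1) = assemble big lab mix (0, t)"
proof (cases "\<exists>I\<in>excursions. t \<in> {fst I<..<snd I}")
  case False
  then have "\<beta> t = 0" using excursion_exists[OF t] by blast
  moreover have "assemble big lab mix (0, t) = 0"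
    by (rule assemble_zero, rule mix_outside) (use False big_excursion in auto)
  ultimately show ?thesis by (simp add: stretch_map_def)
next
  case True
  then obtain I where I: "I \<in> excursions" "t \<in> {fst I<..<snd I}" by blast
  have nz: "\<beta> t \<noteq> 0" by (rule excursionD(6)[OF I])
  have L: "stretch_map (\<beta> t, 1) = earring_loop (lab I) (stretch (angle (\<beta> t)))"
    using nz circle_index_excursion[OF I] by (simp add: stretch_map_def)
  show ?thesis
  proof (cases "I \<in> big")
    case True
    have "assemble big lab mix (0, t) = earring_loop (lab I) (mix I (0, t))"
      by (rule assemble_on_excursion[OF big_subset True I(2)], rule mix_outside) (use big_excursion in auto)
    also have "mix I (0, t) = stretch (angle (\<beta> t))" using I(2) by (simp add: phase_def)
    finally show ?thesis using L by simp
  next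
    case False
    then have "\<not> (1/4 \<le> angle (\<beta> t) \<and> angle (\<beta> t) \<le> 3/4)" using I by (auto simp: big_def)
    then have "stretch (angle (\<beta> t)) = 0 \<or> stretch (angle (\<beta> t)) = 1"
      using stretch_low[of "angle (\<beta> t)"] stretch_high[of "angle (\<beta> t)"] by linarith
    then have "stretch_map (\<beta> t, 1) = 0" using L by auto
    moreover have "assemble big lab mix (0, t) = 0"
    proof (rule assemble_zero, rule mix_outside)
      fix J assume J: "J \<in> big"
      then show J': "J \<in> excursions" by (rule big_excursion)
      have "t \<notin> {fst J<..<snd J}" using excursion_unique[OF I(1) J' I(2)] J False by blast
      then show "snd (0::real, t) \<notin> {fst J<..<snd J}" by simp
    qed
    ultimately show ?thesis by simp
  qed
qed

abbreviation loop_homotopic :: "(real \<Rightarrow> real \<times> real) \<Rightarrow> (real \<Rightarrow> real \<times> real) \<Rightarrow> bool" where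
  "loop_homotopic \<equiv> homotopic_with (\<lambda>\<gamma>. \<gamma> 0 = 0 \<and> \<gamma> 1 = 0) (top_of_set {0..1}) earring_top"

lemma homotopic_stretched: "loop_homotopic \<beta> (\<lambda>t. assemble big lab mix (0, t))"
proof (rule homotopic_loopI[where K = "\<lambda>z. stretch_map (\<beta> (snd z), fst z)"])
  have "continuous_on ({0..1} \<times> {0..1}) (\<lambda>z::real\<times>real. (\<beta> (snd z), fst z))"
    by (intro continuous_intros continuous_on_compose2[OF cont_\<beta>]) auto
  then have "continuous_on ({0..1} \<times> {0..1}) (\<lambda>z::real\<times>real. stretch_map (\<beta> (snd z), fst z))"
    by (rule continuous_on_compose2[OF continuous_on_stretch_map]) (use \<beta>_in in auto)
  then show "continuous_map (top_of_set ({0..1} \<times> {0..1})) earring_top (\<lambda>z::real\<times>real. stretch_map (\<beta> (snd z), fst z))"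
    by (simp, intro funcsetI stretch_map_in \<beta>_in) auto
  fix t :: real assume t: "t \<in> {0..1}"
  show "stretch_map (\<beta> (snd (0::real, t)), fst (0::real, t)) = \<beta> t"
    using earring_polar(4)[OF \<beta>_in[OF t]] by (simp add: stretch_map_def)
  show "stretch_map (\<beta> (snd (1::real, t)), fst (1::real, t)) = assemble big lab mix (0, t)"
    using stretched_eq[OF t] by simp
qed (simp_all add: \<beta>_0 \<beta>_1 stretch_map_def)

lemma homotopic_linear: "loop_homotopic (\<lambda>t. assemble big lab mix (0, t)) (\<lambda>t. assemble big lab mix (1, t))"
proof -
  interpret a: assembly big lab mix UNIV by (rule assembly_mix)
  show ?thesis
  proof (rule homotopic_loopI[where K = "assemble big lab mix"])
    show "continuous_map (top_of_set ({0..1} \<times> {0..1})) earring_top (assemble big lab mix)"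
      using continuous_on_subset[OF a.continuous_on_assemble] a.assemble_in_earring by auto
    have "assemble big lab mix (s, t) = 0" if "t = 0 \<or> t = 1" for s t
    proof (rule assemble_zero, rule mix_outside)
      fix I assume "I \<in> big"
      then show I: "I \<in> excursions" by (rule big_excursion)
      show "snd (s, t) \<notin> {fst I<..<snd I}" using excursionD(1,3)[OF I] that by auto
    qed
    then show "assemble big lab mix (s, 0) = 0" "assemble big lab mix (s, 1) = 0" for s by auto
  qed simp_all
qed

text \<open>A big excursion with equal end phases has constant linear phase and drops out; the
  others go around their circle once.\<close>

definition letters :: "(real \<times> real) set" where
  "letters = {I \<in> big. start_phase I \<noteq> end_phase I}"

text \<open>For an element of \<open>letters\<close> the sign is \<open>True\<close> exactly when
  the circle is passed with increasing angle.\<close>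

definition letter :: "real \<times> real \<Rightarrow> signed_letter" where
  "letter I = (lab I, low_at (fst I) I)"

text \<open>Extends the linear phases of a matched pair from the diagonal to the half plane
  \<open>fst z \<le> snd z\<close>. One ramp rises in the first coordinate over the first interval,
  the other falls in the second coordinate over the second interval; their minimum makes the strip
  turn the corner between the two.\<close>

definition strip :: "(real \<times> real) \<times> (real \<times> real) \<Rightarrow> real \<times> real \<Rightarrow> real" where
  "strip q z = start_phase (fst q) + (end_phase (fst q) - start_phase (fst q)) *
     clamp01 (min ((fst z - fst (fst q)) / (snd (fst q) - fst (fst q)))
                  ((snd (snd q) - snd z) / (snd (snd q) - fst (snd q))))"

lemma letter_excursion: "I \<in> letters \<Longrightarrow> I \<in> excursions"
  by (simp add: letters_def big_excursion)

text \<open>The pair of intervals \<open>(a, b), (c, d)\<close> is joined by the strip of all \<open>(u, v)\<close> with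
  \<open>u\<close> in \<open>(a, b)\<close> and \<open>v < d\<close>, or \<open>v\<close> in \<open>(c, d)\<close> and \<open>u > a\<close>. Strips of noncrossing pairs are disjoint.\<close>

lemma strip_active:
  assumes q: "fst q \<in> letters" "snd q \<in> letters" and nz: "earring_loop m (strip q z) \<noteq> 0"
  shows "fst (fst q) < fst z" "snd z < snd (snd q)" "fst z < snd (fst q) \<or> fst (snd q) < snd z"
proof -
  have I: "fst (fst q) < snd (fst q)" "fst (snd q) < snd (snd q)"
    using excursionD(2) letter_excursion q by blast+
  show "fst (fst q) < fst z"
  proof (rule ccontr)
    assume "\<not> ?thesis"
    then have "(fst z - fst (fst q)) / (snd (fst q) - fst (fst q)) \<le> 0" using I by (intro divide_nonpos_pos) auto
    then have "strip q z = start_phase (fst q)" by (simp add: strip_def clamp01_low min_le_iff_disj)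
    then show False using nz by simp
  qed
  show "snd z < snd (snd q)"
  proof (rule ccontr)
    assume "\<not> ?thesis"
    then have "(snd (snd q) - snd z) / (snd (snd q) - fst (snd q)) \<le> 0" using I by (intro divide_nonpos_pos) auto
    then have "strip q z = start_phase (fst q)" by (simp add: strip_def clamp01_low min_le_iff_disj)
    then show False using nz by simp
  qed
  show "fst z < snd (fst q) \<or> fst (snd q) < snd z"
  proof (rule ccontr)
    assume "\<not> ?thesis"
    then have "1 \<le> (snd (snd q) - snd z) / (snd (snd q) - fst (snd q))"
      "1 \<le> (fst z - fst (fst q)) / (snd (fst q) - fst (fst q))" using I by (auto simp: le_divide_eq)
    then have "strip q z = end_phase (fst q)" by (simp add: strip_def clamp01_high)
    then show False using nz by simp
  qed
qed

context
  fixes P assumes P: "nc_matching fst letter letters P"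
begin

lemma pair_letters:
  assumes "q \<in> P"
  shows "fst q \<in> letters" "snd q \<in> letters" "snd (fst q) \<le> fst (snd q)" "lab (snd q) = lab (fst q)"
    "start_phase (snd q) = end_phase (fst q)" "end_phase (snd q) = start_phase (fst q)"
proof -
  have q: "(fst q, snd q) \<in> P" using assms by simp
  show L: "fst q \<in> letters" "snd q \<in> letters" using nc_matchingD(1)[OF P] q by blast+
  have lt: "fst (fst q) < fst (snd q)" by (rule nc_matchingD(2)[OF P q])
  have op: "letter (snd q) = opposite (letter (fst q))" by (rule nc_matchingD(3)[OF P q])
  show "lab (snd q) = lab (fst q)" using op by (simp add: letter_def opposite_def)
  have "low_at (fst (snd q)) (snd q) \<longleftrightarrow> \<not> low_at (fst (fst q)) (fst q)" using op by (simp add: letter_def opposite_def)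
  then show "start_phase (snd q) = end_phase (fst q)" "end_phase (snd q) = start_phase (fst q)"
    using L by (auto simp: letters_def phase_at_def split: if_splits)
  have "fst (snd q) < snd (snd q)" using excursionD(2) letter_excursion L(2) by blast
  moreover have "fst q \<noteq> snd q" using lt by auto
  ultimately show "snd (fst q) \<le> fst (snd q)"
    using excursions_disjoint[OF letter_excursion[OF L(1)] letter_excursion[OF L(2)]] lt by fastforce
qed

lemma strips_disjoint_ordered:
  assumes q: "q \<in> P" and q': "q' \<in> P" and lt: "fst (fst q) < fst (fst q')" and z: "fst z \<le> snd z"
    and nz: "earring_loop m (strip q z) \<noteq> 0" and nz': "earring_loop m' (strip q' z) \<noteq> 0"
  shows False
proof -
  note A = strip_active[OF pair_letters(1,2)[OF q] nz] and A' = strip_active[OF pair_letters(1,2)[OF q'] nz']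
  have "q \<noteq> q'" using lt by auto
  then have dis: "{fst q, snd q} \<inter> {fst q', snd q'} = {}" using nc_matchingD(5)[OF P q q'] by blast
  have ex: "fst q \<in> excursions" "snd q \<in> excursions" "fst q' \<in> excursions" "snd q' \<in> excursions"
    using pair_letters(1,2)[OF q] pair_letters(1,2)[OF q'] letter_excursion by auto
  note len = excursionD(2)[OF ex(1)] excursionD(2)[OF ex(2)] excursionD(2)[OF ex(3)] excursionD(2)[OF ex(4)]
  have d1: "snd (fst q) \<le> fst (fst q')"
    using excursions_disjoint[OF ex(1,3)] dis lt len by auto
  have d2: "snd (snd q) \<le> fst (fst q') \<or> snd (fst q') \<le> fst (snd q)"
    using excursions_disjoint[OF ex(2,3)] dis by auto
  have d3: "snd (snd q) \<le> fst (snd q') \<or> snd (snd q') \<le> fst (snd q)"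
    using excursions_disjoint[OF ex(2,4)] dis by auto
  have nc: "\<not> (fst (fst q) < fst (fst q') \<and> fst (fst q') < fst (snd q) \<and> fst (snd q) < fst (snd q'))"
    using nc_matchingD(6)[OF P, of "fst q" "snd q" "fst q'" "snd q'"] q q' by simp
  \<comment> \<open>Either \<open>q\<close> ends before \<open>q'\<close> starts, which no point on
    or above the diagonal can reconcile with both strips; or noncrossing nests \<open>q'\<close>
    inside \<open>q\<close>, and both parts of the strip of \<open>q\<close> then miss the strip of
    \<open>q'\<close>.\<close>
  from d2 show False
  proof
    assume "snd (snd q) \<le> fst (fst q')"
    then show False using A(2) A'(1) z by linarith
  next
    assume "snd (fst q') \<le> fst (snd q)"
    then have "\<not> fst (snd q) < fst (snd q')" using nc lt len by linarith
    then have "snd (snd q') \<le> fst (snd q)" using d3 len by linarith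
    then show False using A(3) A'(1,2) d1 by linarith
  qed
qed

lemma assembly_strip: "assembly P (\<lambda>q. lab (fst q)) strip {z. fst z \<le> snd z}"
proof
  show "1 \<le> lab (fst q)" if "q \<in> P" for q
    by (rule lab_pos[OF letter_excursion[OF pair_letters(1)[OF that]]])
  show "finite {q \<in> P. lab (fst q) \<le> n}" for n
  proof (rule finite_subset)
    show "{q \<in> P. lab (fst q) \<le> n} \<subseteq> {I \<in> big. lab I \<le> n} \<times> {I \<in> big. lab I \<le> n}"
    proof
      fix q assume "q \<in> {q \<in> P. lab (fst q) \<le> n}"
      then show "q \<in> {I \<in> big. lab I \<le> n} \<times> {I \<in> big. lab I \<le> n}"
        using pair_letters(1,2,4)[of q] by (auto simp: letters_def mem_Times_iff)
    qed
  qed (simp add: finite_big)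
  show "continuous_on {z. fst z \<le> snd z} (strip q)" if "q \<in> P" for q
  proof -
    have "snd (fst q) - fst (fst q) \<noteq> 0" "snd (snd q) - fst (snd q) \<noteq> 0"
      using excursionD(2)[OF letter_excursion[OF pair_letters(1)[OF that]]]
        excursionD(2)[OF letter_excursion[OF pair_letters(2)[OF that]]] by simp_all
    then show ?thesis unfolding strip_def by (intro continuous_intros continuous_on_clamp01) simp_all
  qed
  fix z q q'
  assume z: "z \<in> {z. fst z \<le> snd z}" and q: "q \<in> P" "q' \<in> P"
    and nz: "earring_loop (lab (fst q)) (strip q z) \<noteq> 0" "earring_loop (lab (fst q')) (strip q' z) \<noteq> 0"
  have "fst (fst q) = fst (fst q')"
    using strips_disjoint_ordered[OF q _ _ nz] strips_disjoint_ordered[OF q(2,1) _ _ nz(2,1)] z by force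
  moreover have ex: "fst q \<in> excursions" "fst q' \<in> excursions"
    using pair_letters(1) q letter_excursion by auto
  ultimately have "fst q = fst q'"
    using excursions_disjoint[OF ex] excursionD(2)[OF ex(1)] excursionD(2)[OF ex(2)] by force
  then show "q = q'" using nc_matchingD(5)[OF P q] by blast
qed

text \<open>Over the first interval the falling ramp is saturated, over the second the rising one.
  There the phase runs backwards, which is the linear phase of the second letter because a matched
  pair has its end phases swapped.\<close>

lemma strip_diagonal:
  assumes q: "q \<in> P" and I: "I = fst q \<or> I = snd q" and t: "t \<in> {fst I<..<snd I}"
  shows "strip q (t, t) = linear_phase I t"
  using I
proof
  have len: "fst (fst q) < snd (fst q)" "fst (snd q) < snd (snd q)"
    using excursionD(2)[OF letter_excursion[OF pair_letters(1)[OF q]]]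
      excursionD(2)[OF letter_excursion[OF pair_letters(2)[OF q]]] by simp_all
  {
    assume i: "I = fst q"
    then have "1 \<le> (snd (snd q) - t) / (snd (snd q) - fst (snd q))"
      using len t pair_letters(3)[OF q] by (simp add: le_divide_eq)
    moreover have "(t - fst (fst q)) / (snd (fst q) - fst (fst q)) \<le> 1"
      using len t i by (simp add: divide_le_eq)
    ultimately show ?thesis unfolding strip_def linear_phase_def i by simp
  next
    assume i: "I = snd q"
    let ?y = "(t - fst (snd q)) / (snd (snd q) - fst (snd q))"
    have y': "(snd (snd q) - t) / (snd (snd q) - fst (snd q)) = 1 - ?y"
      using len by (simp add: field_simps)
    have "1 \<le> (t - fst (fst q)) / (snd (fst q) - fst (fst q))"
      using len t i pair_letters(3)[OF q] by (simp add: le_divide_eq)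
    moreover have y: "0 \<le> ?y" "?y \<le> 1" using len t i by (auto simp: divide_le_eq)
    ultimately have "strip q (t, t) = start_phase (fst q) + (end_phase (fst q) - start_phase (fst q)) * (1 - ?y)"
      unfolding strip_def fst_conv snd_conv y' by (simp add: min_absorb2 clamp01_def)
    also have "\<dots> = start_phase (snd q) + (end_phase (snd q) - start_phase (snd q)) * ?y"
    proof -
      have "a + (b - a) * (1 - y) = b + (a - b) * y" for a b y :: real by (simp add: algebra_simps)
      then show ?thesis unfolding pair_letters(5,6)[OF q] by blast
    qed
    also have "\<dots> = linear_phase I t" using y by (simp add: linear_phase_def i clamp01_def)
    finally show ?thesis .
  }
qed

lemma strip_diagonal_outside:
  assumes q: "q \<in> P" and t: "t \<notin> {fst (fst q)<..<snd (fst q)}" "t \<notin> {fst (snd q)<..<snd (snd q)}"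
  shows "earring_loop m (strip q (t, t)) = 0"
proof (rule ccontr)
  assume "\<not> ?thesis"
  from strip_active[OF pair_letters(1,2)[OF q] this] show False using t by auto
qed

lemma assemble_strip_diagonal:
  "assemble P (\<lambda>q. lab (fst q)) strip (t, t) = assemble big lab mix (1, t)"
proof (cases "\<exists>I\<in>letters. t \<in> {fst I<..<snd I}")
  case True
  then obtain I where I: "I \<in> letters" "t \<in> {fst I<..<snd I}" by blast
  obtain q where q: "q \<in> P" "I = fst q \<or> I = snd q" using nc_matchingD(4)[OF P I(1)] by blast
  have "assemble P (\<lambda>q. lab (fst q)) strip (t, t) = earring_loop (lab (fst q)) (strip q (t, t))"
  proof (rule assemble_single[OF q(1)])
    fix q' assume q': "q' \<in> P" "q' \<noteq> q"
    then have dis: "{fst q, snd q} \<inter> {fst q', snd q'} = {}" using nc_matchingD(5)[OF P q(1) q'(1)] by blast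
    have ex: "fst q' \<in> excursions" "snd q' \<in> excursions"
      using pair_letters(1,2)[OF q'(1)] letter_excursion by auto
    show "earring_loop (lab (fst q')) (strip q' (t, t)) = 0"
    proof (rule strip_diagonal_outside[OF q'(1)])
      show "t \<notin> {fst (fst q')<..<snd (fst q')}"
        using excursion_unique[OF letter_excursion[OF I(1)] ex(1) I(2)] dis q(2) by blast
      show "t \<notin> {fst (snd q')<..<snd (snd q')}"
        using excursion_unique[OF letter_excursion[OF I(1)] ex(2) I(2)] dis q(2) by blast
    qed
  qed
  also have "\<dots> = earring_loop (lab I) (linear_phase I t)"
    using strip_diagonal[OF q I(2)] pair_letters(4)[OF q(1)] q(2) by auto
  also have "\<dots> = earring_loop (lab I) (mix I (1, t))" by simp
  also have "\<dots> = assemble big lab mix (1, t)"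
  proof (rule assemble_on_excursion[OF big_subset _ I(2), symmetric])
    show "I \<in> big" using I(1) by (simp add: letters_def)
    show "earring_loop (lab J) (mix J (1, t)) = 0" if "J \<in> big" "t \<notin> {fst J<..<snd J}" for J
      using mix_outside[OF big_excursion[OF that(1)], of "(1, t)"] that(2) by simp
  qed
  finally show ?thesis .
next
  case False
  have "assemble P (\<lambda>q. lab (fst q)) strip (t, t) = 0"
    by (rule assemble_zero, rule strip_diagonal_outside) (use False pair_letters(1,2) in blast)+
  moreover have "assemble big lab mix (1, t) = 0"
  proof (rule assemble_zero)
    fix I assume I: "I \<in> big"
    show "earring_loop (lab I) (mix I (1, t)) = 0"
    proof (cases "t \<in> {fst I<..<snd I}")
      case True
      then have "I \<notin> letters" using False by blast
      then have "start_phase I = end_phase I" using I by (simp add: letters_def)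
      then have "mix I (1, t) = start_phase I" by (simp add: linear_phase_def)
      then show ?thesis by simp
    qed (use mix_outside[OF big_excursion[OF I], of "(1, t)"] in simp)
  qed
  ultimately show ?thesis by simp
qed

text \<open>The assembled strips give a map on the triangle with vertices (0,0), (1,1) and (0,1)
  that restricts to the straightened loop on the diagonal. The other two edges avoid all strips and
  go to the base point, so sliding the diagonal into the corner (0,1) contracts the loop.\<close>

lemma null_homotopic_if_matching: "null_homotopic_loop earring_top 0 \<beta>"
proof -
  interpret a: assembly P "\<lambda>q. lab (fst q)" strip "{z. fst z \<le> snd z}" by (rule assembly_strip)
  let ?F = "assemble P (\<lambda>q. lab (fst q)) strip"
  have edge: "?F (u, v) = 0" if uv: "u \<le> 0 \<or> 1 \<le> v" for u v
  proof (rule assemble_zero, rule ccontr)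
    fix q assume q: "q \<in> P" and nz: "earring_loop (lab (fst q)) (strip q (u, v)) \<noteq> 0"
    from strip_active[OF pair_letters(1,2)[OF q] nz] show False
      using excursionD(1)[OF letter_excursion[OF pair_letters(1)[OF q]]]
        excursionD(3)[OF letter_excursion[OF pair_letters(2)[OF q]]] uv by auto
  qed
  have "loop_homotopic (\<lambda>t. assemble big lab mix (1, t)) (\<lambda>t. 0)"
  proof (rule homotopic_loopI[where K = "\<lambda>z. ?F ((1 - fst z) * snd z, (1 - fst z) * snd z + fst z)"])
    have "continuous_on ({0..1} \<times> {0..1}) (\<lambda>z::real\<times>real. ((1 - fst z) * snd z, (1 - fst z) * snd z + fst z))"
      by (intro continuous_intros)
    then have "continuous_on ({0..1} \<times> {0..1}) (\<lambda>z::real\<times>real. ?F ((1 - fst z) * snd z, (1 - fst z) * snd z + fst z))"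
      by (rule continuous_on_compose2[OF a.continuous_on_assemble]) auto
    then show "continuous_map (top_of_set ({0..1} \<times> {0..1})) earring_top
        (\<lambda>z::real\<times>real. ?F ((1 - fst z) * snd z, (1 - fst z) * snd z + fst z))"
      using a.assemble_in_earring by auto
    show "?F ((1 - fst (0::real, t)) * snd (0::real, t), (1 - fst (0::real, t)) * snd (0::real, t) + fst (0::real, t))
        = assemble big lab mix (1, t)" for t
      using assemble_strip_diagonal by simp
  qed (use edge in \<open>simp_all\<close>)
  from homotopic_with_trans[OF homotopic_with_trans[OF homotopic_stretched homotopic_linear] this]
  show ?thesis by (simp add: null_homotopic_loop_def)
qed

end

lemma finite_letters: "finite {I \<in> letters. fst (letter I) \<le> n}"
  by (rule finite_subset[OF _ finite_big[of n]]) (auto simp: letters_def letter_def)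

lemma null_homotopic_if_finite_matchings:
  assumes "\<And>n. \<exists>P. nc_matching fst letter {I \<in> letters. fst (letter I) \<le> n} P"
  shows "null_homotopic_loop earring_top 0 \<beta>"
proof (rule compactness_of_matchings[of "\<lambda>n. {I \<in> letters. fst (letter I) \<le> n}" letters letter fst])
  fix P assume "nc_matching fst letter letters P"
  then show ?thesis by (rule null_homotopic_if_matching)
qed (use assms finite_letters in auto)

end


section \<open>The coverings of the earring by reduced words\<close>

text \<open>As a set the total space is the product of \<open>topspace X\<close> and
  \<open>F\<close>; the twisting is all in the topology, through the relabellings
  \<open>\<phi> i\<close>. The coding \<open>enc\<close> moves the product into a prescribed type of
  points.\<close>

lemma covering_charts_pullback:
  assumes g: "continuous_map X Y g"
    and V: "\<And>i. i \<in> I \<Longrightarrow> openin Y (V i)" "topspace Y \<subseteq> (\<Union>i\<in>I. V i)"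
    and bij: "\<And>i y. i \<in> I \<Longrightarrow> y \<in> V i \<Longrightarrow> bij_betw (\<phi> i y) F F"
    and compat: "\<And>i j w w'. i \<in> I \<Longrightarrow> j \<in> I \<Longrightarrow> w \<in> F \<Longrightarrow> w' \<in> F \<Longrightarrow>
       openin Y {y \<in> V i \<inter> V j. \<phi> i y w = \<phi> j y w'}"
    and F: "F \<noteq> {}" and dec: "\<And>x w. dec (enc x w) = (x, w)"
  shows "covering_charts X F I (\<lambda>i. {x \<in> topspace X. g x \<in> V i}) (\<lambda>i x w. enc x (\<phi> i (g x) w))
     (\<lambda>e. fst (dec e)) {e. \<exists>x\<in>topspace X. \<exists>w\<in>F. e = enc x w}"
proof
  show "openin X {x \<in> topspace X. g x \<in> V i}" if "i \<in> I" for i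
    using g V(1)[OF that] by (rule openin_continuous_map_preimage)
  show "topspace X \<subseteq> (\<Union>i\<in>I. {x \<in> topspace X. g x \<in> V i})"
  proof
    fix x assume x: "x \<in> topspace X"
    then have "g x \<in> topspace Y" using g by (auto simp: continuous_map_def)
    then show "x \<in> (\<Union>i\<in>I. {x \<in> topspace X. g x \<in> V i})" using V(2) x by blast
  qed
  show "fst (dec e) \<in> topspace X" if "e \<in> {e. \<exists>x\<in>topspace X. \<exists>w\<in>F. e = enc x w}" for e
    using that by (auto simp: dec)
  show "bij_betw (\<lambda>w. enc x (\<phi> i (g x) w)) F {e \<in> {e. \<exists>x\<in>topspace X. \<exists>w\<in>F. e = enc x w}. fst (dec e) = x}"
    if "i \<in> I" "x \<in> {x \<in> topspace X. g x \<in> V i}" for i x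
  proof -
    have "bij_betw (enc x) F {e \<in> {e. \<exists>x\<in>topspace X. \<exists>w\<in>F. e = enc x w}. fst (dec e) = x}"
      unfolding bij_betw_def
    proof
      show "inj_on (enc x) F" by (rule inj_on_inverseI[where g = "\<lambda>e. snd (dec e)"]) (simp add: dec)
      show "enc x ` F = {e \<in> {e. \<exists>x\<in>topspace X. \<exists>w\<in>F. e = enc x w}. fst (dec e) = x}"
        using that(2) by (auto simp: dec)
    qed
    moreover have "bij_betw (\<phi> i (g x)) F F" using bij that by blast
    ultimately show ?thesis using bij_betw_trans by (fastforce simp: o_def)
  qed
  show "openin X {x \<in> {x \<in> topspace X. g x \<in> V i} \<inter> {x \<in> topspace X. g x \<in> V j}.
      enc x (\<phi> i (g x) w) = enc x (\<phi> j (g x) w')}"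
    if "i \<in> I" "j \<in> I" "w \<in> F" "w' \<in> F" for i j w w'
  proof -
    have inj: "enc x a = enc x b \<longleftrightarrow> a = b" for x a b by (metis dec snd_conv)
    have "{x \<in> {x \<in> topspace X. g x \<in> V i} \<inter> {x \<in> topspace X. g x \<in> V j}.
      enc x (\<phi> i (g x) w) = enc x (\<phi> j (g x) w')} = {x \<in> topspace X. g x \<in> {y \<in> V i \<inter> V j. \<phi> i y w = \<phi> j y w'}}"
      by (auto simp: inj)
    then show ?thesis using openin_continuous_map_preimage[OF g compat[OF that]] by simp
  qed
qed (rule F)

text \<open>The cuts of the covering, at which labels jump: the points opposite to the base point on
  the first \<open>n\<close> circles.\<close>

definition far_points :: "nat \<Rightarrow> (real \<times> real) set" where
  "far_points n = (\<lambda>m. earring_loop m (1/2)) ` {1..n}"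

text \<open>Domain 0 is a neighbourhood of the base point and contains every later circle entirely.
  Only finitely many circles may be cut, because a covering has to be even around the base
  point.\<close>

definition word_dom :: "nat \<Rightarrow> nat \<Rightarrow> (real \<times> real) set" where
  "word_dom n i = (if i = 0 then earring - far_points n else {z \<in> earring - {0}. circle_index z = i})"

text \<open>Passing the cut of circle \<open>i\<close> with increasing angle multiplies the word by
  \<open>(i, True)\<close>; away from the cuts the word is locally constant along a sheet.\<close>

definition word_chart :: "nat \<Rightarrow> real \<times> real \<Rightarrow> signed_letter list \<Rightarrow> signed_letter list" where
  "word_chart i z w = (if i = 0 \<or> angle z < 1/2 then w else push (i, True) w)"

lemma far_point_iff:
  assumes "z \<in> earring"
  shows "z \<in> far_points n \<longleftrightarrow> z \<noteq> 0 \<and> circle_index z \<le> n \<and> angle z = 1/2"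
proof
  assume "z \<in> far_points n"
  then obtain m where "1 \<le> m" "m \<le> n" "z = earring_loop m (1/2)" by (auto simp: far_points_def)
  then show "z \<noteq> 0 \<and> circle_index z \<le> n \<and> angle z = 1/2"
    using circle_index_loop(2)[of m "1/2"] angle_loop[of m "1/2"] earring_loop_nonzero[of m "1/2"] by simp
next
  assume z: "z \<noteq> 0 \<and> circle_index z \<le> n \<and> angle z = 1/2"
  have "circle_index z \<in> {1..n}" using z earring_polar(1)[OF assms] by simp
  moreover have "z = earring_loop (circle_index z) (1/2)" using earring_polar(4)[OF assms] z by simp
  ultimately show "z \<in> far_points n" unfolding far_points_def by (rule rev_image_eqI)
qed

lemma openin_circle_part:
  assumes "open A" shows "openin earring_top {z \<in> earring - {0}. circle_index z = i \<and> angle z \<in> A}"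
proof -
  have "openin (top_of_set (earring - {0})) {z \<in> earring - {0}. angle z \<in> A}"
    using continuous_openin_preimage_gen[OF continuous_on_angle assms] by (simp add: vimage_def Int_def)
  moreover have "openin (top_of_set (earring - {0})) {z \<in> earring - {0}. real (circle_index z) \<in> {real i - 1<..<real i + 1}}"
    using continuous_openin_preimage_gen[OF continuous_on_circle_index, of "{real i - 1<..<real i + 1}"]
    by (simp add: vimage_def Int_def)
  ultimately have "openin (top_of_set (earring - {0})) ({z \<in> earring - {0}. angle z \<in> A} \<inter>
      {z \<in> earring - {0}. real (circle_index z) \<in> {real i - 1<..<real i + 1}})"
    by (rule openin_Int)
  moreover have "{z \<in> earring - {0}. angle z \<in> A} \<inter>
      {z \<in> earring - {0}. real (circle_index z) \<in> {real i - 1<..<real i + 1}}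
      = {z \<in> earring - {0}. circle_index z = i \<and> angle z \<in> A}"
  proof -
    have "real k \<in> {real i - 1<..<real i + 1} \<longleftrightarrow> k = i" for k by auto
    then show ?thesis by blast
  qed
  moreover have "openin earring_top (earring - {0})"
    using openin_diff[of earring_top earring "{0}"] by (simp add: closedin_closed_eq)
  ultimately show ?thesis by (simp only:) (rule openin_trans)
qed

lemma openin_word_dom: "openin earring_top (word_dom n i)"
proof (cases "i = 0")
  case True
  have "openin earring_top (earring \<inter> - far_points n)"
    by (rule openin_open_Int) (simp add: far_points_def open_Compl finite_imp_closed)
  then show ?thesis using True by (simp add: word_dom_def Diff_eq)
next
  case False
  then show ?thesis using openin_circle_part[of UNIV i] by (simp add: word_dom_def)
qed

lemma word_dom_cover: "earring \<subseteq> (\<Union>i\<in>{..n}. word_dom n i)"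
proof
  fix z assume z: "z \<in> earring"
  show "z \<in> (\<Union>i\<in>{..n}. word_dom n i)"
  proof (cases "z \<in> far_points n")
    case True
    then have nz: "z \<noteq> 0" "circle_index z \<le> n" using far_point_iff[OF z] by auto
    then have "z \<in> word_dom n (circle_index z)" using z earring_polar(1)[OF z] by (simp add: word_dom_def)
    then show ?thesis using nz by blast
  next
    case False
    then have "z \<in> word_dom n 0" using z by (simp add: word_dom_def)
    then show ?thesis by blast
  qed
qed

lemma bij_word_chart: "bij_betw (word_chart i z) {w. reduced_word w} {w. reduced_word w}"
proof (cases "i = 0 \<or> angle z < 1/2")
  case True
  then have "word_chart i z = id" by (auto simp: word_chart_def)
  then show ?thesis by simp
next
  case False
  then have "word_chart i z = push (i, True)" by (auto simp: word_chart_def)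
  then show ?thesis using bij_push by simp
qed

lemma word_chart_compat:
  assumes ij: "i \<le> n" "j \<le> n" and w: "reduced_word w" "reduced_word w'"
  shows "openin earring_top {z \<in> word_dom n i \<inter> word_dom n j. word_chart i z w = word_chart j z w'}"
proof -
  \<comment> \<open>Domains 0 and \<open>j\<close> overlap in circle \<open>j\<close> without its
    base point and its cut, that is in two arcs. The change of labels is the identity on one of them
    and a push on the other.\<close>
  have mixed: "openin earring_top {z \<in> word_dom n 0 \<inter> word_dom n j. w = word_chart j z w'}"
    if j: "j \<noteq> 0" "j \<le> n" for j w w'
  proof -
    let ?C = "\<lambda>A. {z \<in> earring - {0}. circle_index z = j \<and> angle z \<in> A}"
    have "{z \<in> word_dom n 0 \<inter> word_dom n j. w = word_chart j z w'} =
       (if w = w' then ?C {..<1/2} else {}) \<union> (if w = push (j, True) w' then ?C {1/2<..} else {})"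
    proof (intro set_eqI)
      fix z
      show "z \<in> {z \<in> word_dom n 0 \<inter> word_dom n j. w = word_chart j z w'} \<longleftrightarrow>
        z \<in> (if w = w' then ?C {..<1/2} else {}) \<union> (if w = push (j, True) w' then ?C {1/2<..} else {})"
        using far_point_iff[of z n] j by (cases "z \<in> earring") (auto simp: word_dom_def word_chart_def)
    qed
    moreover have "openin earring_top (?C {..<1/2})" "openin earring_top (?C {1/2<..})"
      by (rule openin_circle_part, simp)+
    ultimately show ?thesis by auto
  qed
  consider "i = j" | "i = 0" "j \<noteq> 0" | "i \<noteq> 0" "j = 0" | "i \<noteq> j" "i \<noteq> 0" "j \<noteq> 0" by metis
  then show ?thesis
  proof cases
    case 1
    have "word_chart i z w = word_chart i z w' \<longleftrightarrow> w = w'" for z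
      using bij_word_chart[of i z] w by (auto simp: bij_betw_def dest: inj_onD)
    then show ?thesis using openin_word_dom[of n i] 1 by (cases "w = w'") auto
  next
    case 2
    then show ?thesis using mixed[of j w w'] ij by (simp add: word_chart_def)
  next
    case 3
    have "{z \<in> word_dom n i \<inter> word_dom n j. word_chart i z w = word_chart j z w'}
      = {z \<in> word_dom n 0 \<inter> word_dom n i. w' = word_chart i z w}"
      using 3 by (auto simp: word_chart_def)
    then show ?thesis using mixed[of i w' w] ij 3 by simp
  next
    case 4
    then have "{z \<in> word_dom n i \<inter> word_dom n j. word_chart i z w = word_chart j z w'} = {}"
      by (auto simp: word_dom_def)
    then show ?thesis by (simp only: openin_empty)
  qed
qed

section \<open>The word along a lift of the loop\<close>

context earring_path
begin

text \<open>The function \<open>z\<close> abstracts the word coordinate of a lift of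
  \<open>\<beta>\<close> that starts at the empty word; \<open>z_sheet\<close> says that a connected
  piece over one chart domain stays in one sheet.\<close>

context
  fixes n :: nat and z :: "real \<Rightarrow> signed_letter list"
  assumes z0: "z 0 = []"
    and z_sheet: "i \<le> n \<Longrightarrow> connected J \<Longrightarrow> J \<subseteq> {0..1} \<Longrightarrow> \<beta> ` J \<subseteq> word_dom n i \<Longrightarrow>
       \<exists>w. reduced_word w \<and> (\<forall>t\<in>J. z t = word_chart i (\<beta> t) w)"
begin

lemma z_const:
  assumes "connected J" "J \<subseteq> {0..1}" "\<beta> ` J \<subseteq> word_dom n 0" "s \<in> J" "t \<in> J"
  shows "z s = z t"
proof -
  obtain w where "\<forall>t\<in>J. z t = word_chart 0 (\<beta> t) w"
    using z_sheet[OF _ assms(1-3)] by blast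
  then show ?thesis using assms(4,5) by (simp add: word_chart_def)
qed

definition crossings :: "(real \<times> real) set" where
  "crossings = {I \<in> big. lab I \<le> n}"

text \<open>A cut has angle 1/2, so the loop can meet one only during a big excursion on one of the
  first \<open>n\<close> circles.\<close>

lemma far_in_crossing:
  assumes t: "t \<in> {0..1}" and out: "\<And>I. I \<in> crossings \<Longrightarrow> t \<notin> {fst I<..<snd I}"
  shows "\<beta> t \<in> word_dom n 0"
proof -
  have "\<beta> t \<notin> far_points n"
  proof
    assume "\<beta> t \<in> far_points n"
    then have f: "\<beta> t \<noteq> 0" "circle_index (\<beta> t) \<le> n" "angle (\<beta> t) = 1/2"
      using far_point_iff[OF \<beta>_in[OF t]] by auto
    obtain I where I: "I \<in> excursions" "t \<in> {fst I<..<snd I}" using excursion_exists[OF t f(1)] .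
    have "I \<in> big" unfolding big_def using I f(3) by (auto intro!: bexI[of _ t])
    moreover have "lab I \<le> n" using circle_index_excursion[OF I] f(2) by simp
    ultimately show False using out[of I] I(2) by (simp add: crossings_def)
  qed
  then show ?thesis using \<beta>_in[OF t] by (simp add: word_dom_def)
qed

text \<open>The whole excursion lies in one sheet \<open>w\<close> over the open circle. At an
  endpoint the word is \<open>w\<close> on the low side of the cut and the pushed word on the high
  side; comparing the two endpoints gives the net effect.\<close>

lemma z_crossing:
  assumes I: "I \<in> crossings"
  shows "z (snd I) = (if I \<in> letters then push (letter I) (z (fst I)) else z (fst I))"
proof -
  have big: "I \<in> big" and le: "lab I \<le> n" using I by (auto simp: crossings_def)
  have ex: "I \<in> excursions" by (rule big_excursion[OF big])
  note exD = excursionD[OF ex]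
  have "\<beta> ` {fst I<..<snd I} \<subseteq> word_dom n (lab I)"
  proof (rule image_subsetI)
    fix t assume t: "t \<in> {fst I<..<snd I}"
    show "\<beta> t \<in> word_dom n (lab I)"
      using exD(8)[OF t] circle_index_excursion[OF ex t] lab_pos[OF ex] by (simp add: word_dom_def)
  qed
  moreover have "{fst I<..<snd I} \<subseteq> {0..1}" using exD(7) by blast
  ultimately obtain w where w: "reduced_word w" "\<forall>t\<in>{fst I<..<snd I}. z t = word_chart (lab I) (\<beta> t) w"
    using z_sheet[OF le] by (meson connected_Ioo)
  have nfar: "\<beta> t \<in> word_dom n 0" if "t \<in> {fst I<..<snd I}" "angle (\<beta> t) \<noteq> 1/2" for t
    using exD(8)[OF that(1)] that(2) far_point_iff[of "\<beta> t" n] by (simp add: word_dom_def)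
  have zero: "0 \<in> word_dom n 0" using far_point_iff[of 0 n] by (simp add: word_dom_def)
  have ne: "y \<noteq> 1/2" if "if B then y < 1/4 else y > 3/4" for y :: real and B
    using that by (auto split: if_splits)
  have lp: "lab I \<noteq> 0" using lab_pos[OF ex] by simp
  have endpoint: "z c = (if low_at c I then w else push (lab I, True) w)" if c: "c \<in> {fst I, snd I}" for c
  proof -
    obtain d where d: "d > 0" "\<forall>t\<in>{fst I<..<snd I}. \<bar>t - c\<bar> < d \<longrightarrow>
        (if low_at c I then angle (\<beta> t) < 1/4 else angle (\<beta> t) > 3/4)"
      by (rule endpoint_type[OF ex c])
    \<comment> \<open>The point \<open>m\<close> is so close to \<open>c\<close> that the angle
      stays on one side of the cut between them; domain 0 then carries the word unchanged from
      \<open>c\<close> to \<open>m\<close>.\<close>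
    define h where "h = min (d / 2) ((snd I - fst I) / 2)"
    define m where "m = (if c = fst I then c + h else c - h)"
    have h: "0 < h" "h < d" "h < snd I - fst I" using d(1) exD(2) by (auto simp: h_def min_def)
    have m: "m \<in> {fst I<..<snd I}" "\<bar>m - c\<bar> < d" using h c by (auto simp: m_def)
    have seg: "t = c \<or> t \<in> {fst I<..<snd I} \<and> \<bar>t - c\<bar> < d" if "t \<in> {min c m..max c m}" for t
      using that h c by (auto simp: m_def min_def max_def split: if_splits)
    have "z c = z m"
    proof (rule z_const[of "{min c m..max c m}"])
      show "\<beta> ` {min c m..max c m} \<subseteq> word_dom n 0"
      proof (rule image_subsetI)
        fix t assume "t \<in> {min c m..max c m}"
        from seg[OF this] show "\<beta> t \<in> word_dom n 0"
        proof
          assume "t = c" then show ?thesis using zero exD(4,5) c by auto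
        next
          assume t: "t \<in> {fst I<..<snd I} \<and> \<bar>t - c\<bar> < d"
          then have "angle (\<beta> t) \<noteq> 1/2" using ne d(2) by blast
          then show ?thesis using nfar t by blast
        qed
      qed
    qed (use m(1) c exD(1,3) in auto)
    also have "\<dots> = word_chart (lab I) (\<beta> m) w" using w(2) m(1) by blast
    also have "\<dots> = (if low_at c I then w else push (lab I, True) w)"
      using d(2)[rule_format, OF m] lp by (auto simp: word_chart_def split: if_splits)
    finally show ?thesis .
  qed
  have let_iff: "I \<in> letters \<longleftrightarrow> low_at (fst I) I \<noteq> low_at (snd I) I"
    using big by (auto simp: letters_def phase_at_def)
  \<comment> \<open>A passage from the high to the low side undoes \<open>(lab I, True)\<close>,
    which amounts to pushing \<open>(lab I, False)\<close>.\<close>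
  have "opposite (lab I, True) = (lab I, False)" by (simp add: opposite_def)
  then have "push (lab I, False) (push (lab I, True) w) = w" using push_opposite[OF w(1), of "(lab I, True)"] by simp
  then show ?thesis using endpoint[of "fst I"] endpoint[of "snd I"] let_iff
    by (cases "low_at (fst I) I"; cases "low_at (snd I) I") (simp_all add: letter_def)
qed

text \<open>Induction on the number of crossings completed by time \<open>t\<close>, which is finite
  by \<open>finite_big\<close>. The word is constant after the last of them has ended, and the
  induction hypothesis applies at its start.\<close>

lemma stack_state_at:
  assumes "t \<in> {0..1}" "\<And>I. I \<in> crossings \<Longrightarrow> t \<notin> {fst I<..<snd I}"
  shows "stack_state fst letter {I \<in> letters. lab I \<le> n \<and> snd I \<le> t} (z t)"
  using assms
proof (induction "card {I \<in> crossings. snd I \<le> t}" arbitrary: t rule: less_induct)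
  case less
  let ?S = "{I \<in> crossings. snd I \<le> t}"
  have fin: "finite ?S" by (rule finite_subset[OF _ finite_big[of n]]) (auto simp: crossings_def)
  have letter_crossing: "I \<in> crossings" if "I \<in> letters" "lab I \<le> n" for I
    using that by (simp add: letters_def crossings_def)
  have gap: "z b = z t" if b: "0 \<le> b" "b \<le> t" and up: "\<And>I. I \<in> ?S \<Longrightarrow> snd I \<le> b" for b
  proof (rule z_const[of "{b..t}"])
    show "\<beta> ` {b..t} \<subseteq> word_dom n 0"
    proof (rule image_subsetI, rule far_in_crossing)
      fix u assume u: "u \<in> {b..t}"
      then show "u \<in> {0..1}" using b less.prems(1) by auto
      fix I assume I: "I \<in> crossings"
      show "u \<notin> {fst I<..<snd I}"
      proof
        assume ui: "u \<in> {fst I<..<snd I}"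
        then have "snd I \<le> t" using less.prems(2)[OF I] u by auto
        then show False using up[of I] I ui u by auto
      qed
    qed
  qed (use b less.prems(1) in auto)
  show ?case
  proof (cases "?S = {}")
    case True
    then have "{I \<in> letters. lab I \<le> n \<and> snd I \<le> t} = {}" using letter_crossing by blast
    moreover have "z t = []" using gap[of 0] less.prems(1) True z0 by auto
    ultimately show ?thesis by (simp only: stack_state_empty)
  next
    case False
    have "\<exists>I\<in>?S. snd I = Max (snd ` ?S)" using Max_in[of "snd ` ?S"] fin False by fastforce
    then obtain I where I: "I \<in> ?S" "snd I = Max (snd ` ?S)" by blast
    have top: "snd J \<le> snd I" if "J \<in> ?S" for J using that fin I(2) by simp
    have Ic: "I \<in> crossings" "snd I \<le> t" using I(1) by auto
    have exc: "J \<in> excursions" if "J \<in> crossings" for J using that big_excursion by (auto simp: crossings_def)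
    have ex: "I \<in> excursions" by (rule exc[OF Ic(1)])
    note exD = excursionD[OF ex]
    have before: "snd J \<le> fst I" if J: "J \<in> ?S" "J \<noteq> I" for J
    proof -
      have exJ: "J \<in> excursions" using J(1) exc by blast
      show ?thesis using excursions_disjoint[OF exJ ex J(2)] top[OF J(1)] excursionD(2)[OF exJ] by linarith
    qed
    have Sa: "{J \<in> crossings. snd J \<le> fst I} = ?S - {I}"
      using before exD(2) Ic(2) by force
    have "z t = z (snd I)"
      using gap[of "snd I"] top exD(1,2) Ic(2) by auto
    also have "\<dots> = (if I \<in> letters then push (letter I) (z (fst I)) else z (fst I))"
      by (rule z_crossing[OF Ic(1)])
    finally have zt: "z t = (if I \<in> letters then push (letter I) (z (fst I)) else z (fst I))" .
    have IH: "stack_state fst letter {J \<in> letters. lab J \<le> n \<and> snd J \<le> fst I} (z (fst I))"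
    proof (rule less.hyps)
      show "card {J \<in> crossings. snd J \<le> fst I} < card ?S"
        unfolding Sa by (rule psubset_card_mono[OF fin]) (use I(1) in blast)
      show "fst I \<in> {0..1}" using exD(1-3) by auto
      show "fst I \<notin> {fst J<..<snd J}" if "J \<in> crossings" for J
        using excursionD(6)[OF exc[OF that]] exD(4) by blast
    qed
    have letS: "{J \<in> letters. lab J \<le> n \<and> snd J \<le> t} =
        {J \<in> letters. lab J \<le> n \<and> snd J \<le> fst I} \<union> (if I \<in> letters then {I} else {})"
    proof (intro set_eqI)
      fix J
      have "J \<in> letters \<Longrightarrow> lab J \<le> n \<Longrightarrow> snd J \<le> t \<Longrightarrow> J \<noteq> I \<Longrightarrow> snd J \<le> fst I"
        using before[of J] letter_crossing[of J] by blast
      moreover have "snd J \<le> fst I \<Longrightarrow> snd J \<le> t" using exD(2) Ic(2) by linarith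
      moreover have "lab I \<le> n" using Ic(1) by (simp add: crossings_def)
      ultimately show "J \<in> {J \<in> letters. lab J \<le> n \<and> snd J \<le> t} \<longleftrightarrow>
          J \<in> {J \<in> letters. lab J \<le> n \<and> snd J \<le> fst I} \<union> (if I \<in> letters then {I} else {})"
        using Ic(2) by auto
    qed
    show ?thesis
    proof (cases "I \<in> letters")
      case True
      have "stack_state fst letter (insert I {J \<in> letters. lab J \<le> n \<and> snd J \<le> fst I}) (push (letter I) (z (fst I)))"
      proof (rule stack_state_push[OF IH])
        fix J assume J: "J \<in> {J \<in> letters. lab J \<le> n \<and> snd J \<le> fst I}"
        then have "fst J < snd J" using excursionD(2) letter_excursion by blast
        then show "fst J < fst I" using J by auto
      qed
      then show ?thesis unfolding letS zt using True by simp
    next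
      case False
      then show ?thesis unfolding letS zt using IH by simp
    qed
  qed
qed

lemma matching_if_closed:
  assumes "z 1 = []"
  shows "\<exists>P. nc_matching fst letter {I \<in> letters. fst (letter I) \<le> n} P"
proof -
  have "1 \<notin> {fst I<..<snd I}" if "I \<in> crossings" for I
    using excursionD(3)[OF big_excursion, of I] that by (auto simp: crossings_def)
  then have "stack_state fst letter {I \<in> letters. lab I \<le> n \<and> snd I \<le> 1} (z 1)"
    by (intro stack_state_at) auto
  moreover have "{I \<in> letters. lab I \<le> n \<and> snd I \<le> 1} = {I \<in> letters. fst (letter I) \<le> n}"
    using excursionD(3)[OF letter_excursion] by (auto simp: letter_def)
  ultimately show ?thesis using assms by (auto dest: stack_state_Nil)
qed

end

end


section \<open>Separating essential loops\<close>

text \<open>An injection of reals and naturals into the reals: \<open>n\<close> becomes the integer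
  part, and the arctangent squeezes \<open>\<tau>\<close> into the fractional part. A point of the
  second covering is a torus point with a real level and a word, and it must again be a torus point
  with one real label.\<close>

definition pair_code :: "real \<Rightarrow> nat \<Rightarrow> real" where
  "pair_code \<tau> n = real n + (1/2 + arctan \<tau> / pi)"

definition pair_decode :: "real \<Rightarrow> real \<times> nat" where
  "pair_decode r = (tan (pi * (frac r - 1/2)), nat \<lfloor>r\<rfloor>)"

lemma pair_decode_code: "pair_decode (pair_code \<tau> n) = (\<tau>, n)"
proof -
  have b: "- (1/2) < arctan \<tau> / pi" "arctan \<tau> / pi < 1/2"
    using arctan_bounded[of \<tau>] by (auto simp: field_simps)
  have fl: "\<lfloor>pair_code \<tau> n\<rfloor> = int n" unfolding pair_code_def
  proof (rule floor_unique)
    show "real_of_int (int n) \<le> real n + (1/2 + arctan \<tau> / pi)" using b(1) by linarith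
    show "real n + (1/2 + arctan \<tau> / pi) < real_of_int (int n) + 1" using b(2) by linarith
  qed
  then have "pi * (frac (pair_code \<tau> n) - 1/2) = arctan \<tau>" by (simp add: frac_def pair_code_def)
  then show ?thesis using fl by (simp add: pair_decode_def tan_arctan)
qed

definition word_point :: "torus_point \<times> real \<Rightarrow> signed_letter list \<Rightarrow> cover_point" where
  "word_point e w = (fst e, pair_code (snd e) (to_nat w))"

definition point_word :: "cover_point \<Rightarrow> (torus_point \<times> real) \<times> signed_letter list" where
  "point_word e = ((fst e, fst (pair_decode (snd e))), from_nat (snd (pair_decode (snd e))))"

lemma point_word_point: "point_word (word_point e w) = (e, w)"
  by (simp add: point_word_def word_point_def pair_decode_code)

text \<open>Negative powers of the shift are powers of its left inverse. They are used above level
  \<open>K\<close>, from where reaching \<open>K\<close> means running the flow backwards.\<close>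

definition shift_power :: "int \<Rightarrow> real \<times> real \<Rightarrow> real \<times> real" where
  "shift_power j = (if j \<ge> 0 then earring_shift ^^ nat j else collapse ^^ nat (- j))"

lemma continuous_map_shift_power: "continuous_map earring_top earring_top (shift_power j)"
proof -
  interpret c: self_map earring_top collapse by standard (rule continuous_map_collapse)
  show ?thesis unfolding shift_power_def using torus.continuous_funpow c.continuous_funpow by simp
qed

text \<open>Compatibility at a seam, where (x, 1) is identified with (f x, 0) and one turn fewer
  remains to be made. A left inverse suffices because the shift is the map applied first.\<close>

lemma shift_power_shift:
  assumes x: "x \<in> earring" shows "shift_power (j - 1) (earring_shift x) = shift_power j x"
proof (cases "j \<ge> 1")
  case True
  define i where "i = nat (j - 1)"
  have "j = int (Suc i)" using True by (simp add: i_def)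
  then show ?thesis by (simp add: shift_power_def funpow_swap1 nat_add_distrib)
next
  case False
  define i where "i = nat (- j)"
  have j: "j = - int i" using False by (simp add: i_def)
  have "shift_power (j - 1) (earring_shift x) = (collapse ^^ Suc i) (earring_shift x)"
    by (simp add: shift_power_def j nat_add_distrib)
  also have "\<dots> = (collapse ^^ i) x"
    using collapse_shift[OF x] by (simp add: funpow_swap1)
  also have "\<dots> = shift_power j x" by (cases "i = 0") (simp_all add: shift_power_def j)
  finally show ?thesis .
qed

text \<open>Up to level \<open>K\<close> this is where the flow arrives at level \<open>K\<close>.
  Its extension to all higher levels is what allows coverings of the earring to be pulled back to
  the whole infinite cyclic covering.\<close>

definition to_level :: "nat \<Rightarrow> torus_point \<times> real \<Rightarrow> real \<times> real" where
  "to_level K e = shift_power (int K - \<lfloor>snd e\<rfloor>) (fst (torus.pt (fst e)))"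

lemma to_level_eq:
  assumes x: "x \<in> earring" and s: "0 \<le> s" "s \<le> 1"
  shows "to_level K (torus.h (x, s), s + of_int k) = shift_power (int K - k) x"
proof (cases "s = 1")
  case True
  have fl: "\<lfloor>1 + real_of_int k\<rfloor> = k + 1" by linarith
  have "torus.pt (torus.h (x, 1)) = (earring_shift x, 0)"
    using torus.pt_h[of "(x, 1)"] x by (simp add: torus.can_def)
  then have "to_level K (torus.h (x, s), s + of_int k) = shift_power (int K - (k + 1)) (earring_shift x)"
    by (simp only: to_level_def fst_conv snd_conv fl True)
  also have "int K - (k + 1) = int K - k - 1" by simp
  also have "shift_power (int K - k - 1) (earring_shift x) = shift_power (int K - k) x"
    by (rule shift_power_shift[OF x])
  finally show ?thesis .
next
  case False
  have "\<lfloor>s + real_of_int k\<rfloor> = k" using s False by (intro floor_unique) auto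
  moreover have "torus.pt (torus.h (x, s)) = (x, s)"
    using torus.pt_h[of "(x, s)"] x s False by (simp add: torus.can_def)
  ultimately show ?thesis by (simp add: to_level_def)
qed

lemma continuous_map_to_level: "continuous_map torus.Tele earring_top (to_level K)"
proof (rule torus.continuous_map_from_Tele)
  fix k
  have "continuous_map torus.cyl earring_top (shift_power (int K - k) \<circ> fst)"
    by (rule continuous_map_compose[OF continuous_map_fst continuous_map_shift_power])
  then show "continuous_map torus.cyl earring_top (\<lambda>(x, s). to_level K (torus.h (x, s), s + real_of_int k))"
    by (rule continuous_map_eq) (auto simp: to_level_eq)
qed

lemma shift_power_zero: "shift_power j 0 = 0"
proof -
  have "(earring_shift ^^ n) 0 = 0" "(collapse ^^ n) 0 = 0" for n by (induction n) auto
  then show ?thesis by (simp add: shift_power_def)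
qed

text \<open>An essential loop has no matching for some \<open>n\<close>. Pull the word covering for
  this \<open>n\<close> back along \<open>to_level K\<close>: along a closed lift of
  \<open>\<alpha>'\<close> the word would run from empty to empty, and the stack argument would
  produce such a matching.\<close>

lemma separating_cover:
  assumes path: "earring_path (to_level K \<circ> \<alpha>')" and \<alpha>': "pathin torus.Tele \<alpha>'"
    and ess: "\<not> null_homotopic_loop earring_top 0 (to_level K \<circ> \<alpha>')"
  shows "\<exists>(E\<^sub>2 :: cover_point topology) e\<^sub>2 p\<^sub>2.
           pointed_covering E\<^sub>2 e\<^sub>2 torus.Tele (\<alpha>' 0) p\<^sub>2 \<and>
           (\<forall>\<alpha>''. is_lift E\<^sub>2 e\<^sub>2 p\<^sub>2 \<alpha>' \<alpha>'' \<longrightarrow> \<alpha>'' 1 \<noteq> e\<^sub>2)"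
proof -
  let ?g = "to_level K"
  interpret b: earring_path "?g \<circ> \<alpha>'" by (rule path)
  obtain n where n: "\<nexists>P. nc_matching fst b.letter {I \<in> b.letters. fst (b.letter I) \<le> n} P"
    using b.null_homotopic_if_finite_matchings ess by blast
  let ?F = "{w. reduced_word w}"
  let ?U = "\<lambda>i. {e \<in> topspace torus.Tele. ?g e \<in> word_dom n i}"
  let ?c = "\<lambda>i e w. word_point e (word_chart i (?g e) w)"
  let ?p = "\<lambda>e. fst (point_word e)"
  let ?S = "{e. \<exists>x\<in>topspace torus.Tele. \<exists>w\<in>?F. e = word_point x w}"
  interpret cov: covering_charts torus.Tele ?F "{..n}" ?U ?c ?p ?S
  proof (rule covering_charts_pullback[OF continuous_map_to_level])
    show "openin earring_top {y \<in> word_dom n i \<inter> word_dom n j. word_chart i y w = word_chart j y w'}"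
      if "i \<in> {..n}" "j \<in> {..n}" "w \<in> ?F" "w' \<in> ?F" for i j w w'
      using word_chart_compat that by simp
    show "?F \<noteq> {}" using reduced_Nil by blast
  qed (use openin_word_dom word_dom_cover bij_word_chart point_word_point in auto)
  let ?e = "word_point (\<alpha>' 0) []"
  have \<alpha>'_in: "\<alpha>' t \<in> topspace torus.Tele" if "t \<in> {0..1}" for t
    using \<alpha>' that by (auto simp: pathin_def continuous_map_def)
  have "?e \<in> ?S"
    by (rule CollectI, rule bexI[of _ "\<alpha>' 0"], rule bexI[of _ "[]"]) (use \<alpha>'_in[of 0] in simp_all)
  then have "?e \<in> topspace cov.total_top" by (simp only: cov.topspace_total_top)
  then have pc: "pointed_covering cov.total_top ?e torus.Tele (\<alpha>' 0) ?p"
    unfolding pointed_covering_def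
    using cov.covering_projection_total_top by (simp only: point_word_point fst_conv simp_thms)
  moreover have "\<alpha>'' 1 \<noteq> ?e" if l: "is_lift cov.total_top ?e ?p \<alpha>' \<alpha>''" for \<alpha>''
  proof
    assume closed: "\<alpha>'' 1 = ?e"
    define z where "z t = snd (point_word (\<alpha>'' t))" for t
    have l1: "continuous_map (top_of_set {0..1}) cov.total_top \<alpha>''" "\<alpha>'' 0 = ?e"
      and l2: "\<And>t. t \<in> {0..1} \<Longrightarrow> ?p (\<alpha>'' t) = \<alpha>' t"
      using l by (auto simp: is_lift_def pathin_def)
    have S: "\<alpha>'' t \<in> ?S" if "t \<in> {0..1}" for t
    proof -
      have "\<alpha>'' t \<in> topspace cov.total_top" using l1(1) that by (auto simp: continuous_map_def)
      then show ?thesis by (simp only: cov.topspace_total_top)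
    qed
    have "\<exists>P. nc_matching fst b.letter {I \<in> b.letters. fst (b.letter I) \<le> n} P"
    proof (rule b.matching_if_closed[of z n])
      show "z 0 = []" using l1(2) by (simp add: z_def point_word_point)
      show "z 1 = []" using closed by (simp add: z_def point_word_point)
      fix i J
      assume i: "i \<le> n" and J: "connected J" "J \<subseteq> {0..1}" "(?g \<circ> \<alpha>') ` J \<subseteq> word_dom n i"
      show "\<exists>w. reduced_word w \<and> (\<forall>t\<in>J. z t = word_chart i ((?g \<circ> \<alpha>') t) w)"
      proof (cases "J = {}")
        case True
        then show ?thesis using reduced_Nil by blast
      next
        case False
        then obtain t0 where t0: "t0 \<in> J" by blast
        have U: "?p (\<alpha>'' t) \<in> ?U i" if "t \<in> J" for t
        proof -
          have t: "t \<in> {0..1}" using that J(2) by blast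
          have "?g (\<alpha>' t) \<in> word_dom n i" using that J(3) by auto
          then show ?thesis using \<alpha>'_in[OF t] by (simp only: l2[OF t] mem_Collect_eq simp_thms)
        qed
        have "\<alpha>'' t0 \<in> ?S" by (rule S) (use t0 J(2) in blast)
        then obtain w where w: "w \<in> ?F" "\<alpha>'' t0 = ?c i (?p (\<alpha>'' t0)) w"
          using cov.chart_surj[of i "\<alpha>'' t0"] i U[OF t0] by blast
        have "z t = word_chart i ((?g \<circ> \<alpha>') t) w" if t: "t \<in> J" for t
        proof -
          have "\<alpha>'' t = ?c i (?p (\<alpha>'' t)) w"
          proof (rule cov.connected_in_sheet[of "top_of_set J" \<alpha>'' i t0 w t])
            show "connected_space (top_of_set J)" by (rule connected_space_top_of_set[OF J(1)])
            show "continuous_map (top_of_set J) cov.total_top \<alpha>''"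
              by (rule continuous_map_from_subtopology_mono[OF l1(1) J(2)])
          qed (use i U t0 w t in auto)
          then show ?thesis using l2[of t] t J(2) by (auto simp: z_def point_word_point)
        qed
        then show ?thesis using w(1) by blast
      qed
    qed
    then show False using n by blast
  qed
  ultimately show ?thesis by blast
qed

theorem theorem4p1:
  shows "(\<forall>\<alpha>. loop_at earring_top (0, 0) \<alpha> \<longrightarrow>
            (\<forall>(E :: 'e topology) e p.
               pointed_covering E e earring_torus earring_torus_base p \<longrightarrow>
               (\<exists>\<alpha>'. is_lift E e p (earring_torus_incl \<circ> \<alpha>) \<alpha>') \<and>
               (\<forall>\<alpha>'. is_lift E e p (earring_torus_incl \<circ> \<alpha>) \<alpha>' \<longrightarrow> \<alpha>' 1 = e)))
       \<and> (\<forall>\<alpha>. loop_at earring_torus earring_torus_base \<alpha> \<and>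
               \<not> null_homotopic_loop earring_torus earring_torus_base \<alpha> \<longrightarrow>
            (\<exists>(E\<^sub>1 :: cover_point topology) e\<^sub>1 p\<^sub>1 (E\<^sub>2 :: cover_point topology) e\<^sub>2 p\<^sub>2.
               pointed_covering E\<^sub>1 e\<^sub>1 earring_torus earring_torus_base p\<^sub>1 \<and>
               pointed_covering E\<^sub>2 e\<^sub>2 E\<^sub>1 e\<^sub>1 p\<^sub>2 \<and>
               (\<exists>\<alpha>''. is_lift E\<^sub>2 e\<^sub>2 (p\<^sub>1 \<circ> p\<^sub>2) \<alpha> \<alpha>'') \<and>
               (\<forall>\<alpha>''. is_lift E\<^sub>2 e\<^sub>2 (p\<^sub>1 \<circ> p\<^sub>2) \<alpha> \<alpha>'' \<longrightarrow> \<alpha>'' 1 \<noteq> e\<^sub>2)))"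
proof (intro conjI allI impI)
  fix \<alpha> and E :: "'e topology" and e p
  assume \<alpha>: "loop_at earring_top (0, 0) \<alpha>" and p: "pointed_covering E e earring_torus earring_torus_base p"
  then have cov: "covering_projection E earring_torus p" "e \<in> topspace E" "p e = earring_torus_base"
    by (auto simp: pointed_covering_def)
  have "continuous_map earring_top torus.cyl (\<lambda>x. (x, 0))"
    by (intro continuous_map_pairedI) auto
  from continuous_map_compose[OF this torus.continuous_h]
  have "continuous_map earring_top earring_torus earring_torus_incl"
    by (simp add: o_def earring_torus_def earring_torus_incl_def[abs_def])
  then have "pathin earring_torus (earring_torus_incl \<circ> \<alpha>)"
    using \<alpha> by (auto simp: loop_at_def intro: pathin_compose)
  moreover have "p e = (earring_torus_incl \<circ> \<alpha>) 0"
    using \<alpha> cov(3) by (simp add: loop_at_def earring_torus_base_def)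
  ultimately show "\<exists>\<alpha>'. is_lift E e p (earring_torus_incl \<circ> \<alpha>) \<alpha>'"
    using path_lift_exists[OF cov(1) _ cov(2)] by metis
  show "\<alpha>' 1 = e" if "is_lift E e p (earring_torus_incl \<circ> \<alpha>) \<alpha>'" for \<alpha>'
    using loops_in_earring_lift_closed[OF cov(1) \<alpha> that] that by (simp add: is_lift_def)
next
  fix \<alpha>
  assume "loop_at earring_torus earring_torus_base \<alpha> \<and> \<not> null_homotopic_loop earring_torus earring_torus_base \<alpha>"
  moreover have T: "earring_torus = torus.T" and base: "earring_torus_base = torus.h (0, 0)"
    by (simp_all add: earring_torus_def earring_torus_base_def earring_torus_incl_def zero_prod_def)
  ultimately have \<alpha>: "pathin torus.T \<alpha>" "\<alpha> 0 = torus.h (0, 0)" "\<alpha> 1 = torus.h (0, 0)"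
    and ess: "\<not> null_homotopic_loop torus.T (torus.h (0, 0)) \<alpha>"
    by (auto simp: loop_at_def)
  let ?e = "(torus.h (0, 0), 0) :: cover_point"
  note cov = torus.tele.covering_projection_total_top
  have e: "?e \<in> topspace torus.Tele" using torus.h_in_tele[of 0 0 0] by simp
  have p1: "pointed_covering torus.Tele ?e earring_torus earring_torus_base fst"
    using cov e by (simp add: pointed_covering_def T base)
  have "fst ?e = \<alpha> 0" using \<alpha>(2) by simp
  then obtain \<alpha>' where \<alpha>': "is_lift torus.Tele ?e fst \<alpha> \<alpha>'"
    by (rule path_lift_exists[OF cov \<alpha>(1) e])
  have path: "pathin torus.Tele \<alpha>'" and \<alpha>'0: "\<alpha>' 0 = ?e" using \<alpha>' by (auto simp: is_lift_def)
  have uniq: "\<gamma> t = \<alpha>' t" if "is_lift torus.Tele ?e fst \<alpha> \<gamma>" "t \<in> {0..1}" for \<gamma> t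
    by (rule path_lift_unique[OF cov that(1) \<alpha>', of 0 t]) (use that \<alpha>'0 in \<open>auto simp: is_lift_def\<close>)
  have "\<exists>(E\<^sub>2 :: cover_point topology) e\<^sub>2 p\<^sub>2. pointed_covering E\<^sub>2 e\<^sub>2 torus.Tele ?e p\<^sub>2 \<and>
      (\<forall>\<alpha>''. is_lift E\<^sub>2 e\<^sub>2 p\<^sub>2 \<alpha>' \<alpha>'' \<longrightarrow> \<alpha>'' 1 \<noteq> e\<^sub>2)"
  proof (cases "\<alpha>' 1 = ?e")
    \<comment> \<open>The infinite cyclic covering already separates the loop, so the identity
      serves as the second covering.\<close>
    case False
    have "pointed_covering torus.Tele ?e torus.Tele ?e id"
      using e covering_projection_id by (simp add: pointed_covering_def)
    moreover have "\<gamma> 1 \<noteq> ?e" if "is_lift torus.Tele ?e id \<alpha>' \<gamma>" for \<gamma>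
      using that False by (auto simp: is_lift_def)
    ultimately show ?thesis by blast
  next
    case True
    \<comment> \<open>The level is bounded along the compact path, so some integer level
      \<open>K\<close> lies above all of it.\<close>
    have "continuous_map (top_of_set {0..1}) euclideanreal (snd \<circ> \<alpha>')"
      by (rule continuous_map_compose[OF path[unfolded pathin_def] torus.continuous_map_level])
    then have "continuous_on {0..1} (\<lambda>t. snd (\<alpha>' t))" by (simp add: o_def)
    then have "compact ((\<lambda>t. snd (\<alpha>' t)) ` {0..1})" by (rule compact_continuous_image) simp
    then have "bdd_above ((\<lambda>t. snd (\<alpha>' t)) ` {0..1})"
      by (intro bounded_imp_bdd_above compact_imp_bounded)
    then obtain B where "\<forall>r\<in>(\<lambda>t. snd (\<alpha>' t)) ` {0..1}. r \<le> B" unfolding bdd_above_def ..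
    then have B: "snd (\<alpha>' t) \<le> B" if "t \<in> {0..1}" for t using that by simp
    obtain K :: nat where K: "B \<le> real K" using real_arch_simple by blast
    have g0: "to_level K ?e = 0"
      using to_level_eq[of 0 0 K 0] shift_power_zero by simp
    have path_g: "pathin earring_top (to_level K \<circ> \<alpha>')"
      by (rule pathin_compose[OF path continuous_map_to_level])
    have ep: "earring_path (to_level K \<circ> \<alpha>')"
      by standard (use path_g g0 \<alpha>'0 True in \<open>auto simp: pathin_def\<close>)
    have "\<not> null_homotopic_loop earring_top 0 (to_level K \<circ> \<alpha>')"
    proof
      assume null: "null_homotopic_loop earring_top 0 (to_level K \<circ> \<alpha>')"
      have "null_homotopic_loop torus.T (torus.h (0, 0)) \<alpha>"
      proof (rule torus.null_homotopic_pushed[OF _ _ \<alpha>' True, where K = K and g = "to_level K"])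
        show "snd (\<alpha>' t) \<le> real K" if "t \<in> {0..1}" for t using B[OF that] K by linarith
        fix x :: "real \<times> real" and s :: real and k :: int
        assume x: "x \<in> topspace earring_top" and s: "0 \<le> s" "s < 1" "s + of_int k \<le> real K"
        have "k \<le> int K" using s by linarith
        then show "to_level K (torus.h (x, s), s + of_int k) = (earring_shift ^^ nat (int K - k)) x"
          using to_level_eq[of x s K k] x s by (simp add: shift_power_def)
      qed (use null in simp_all)
      then show False using ess by blast
    qed
    from separating_cover[OF ep path this] show ?thesis by (simp only: \<alpha>'0)
  qed
  then obtain E\<^sub>2 :: "cover_point topology" and e\<^sub>2 p\<^sub>2 where
    p2: "pointed_covering E\<^sub>2 e\<^sub>2 torus.Tele ?e p\<^sub>2" and open_lift: "\<forall>\<alpha>''. is_lift E\<^sub>2 e\<^sub>2 p\<^sub>2 \<alpha>' \<alpha>'' \<longrightarrow> \<alpha>'' 1 \<noteq> e\<^sub>2"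
    by blast
  have cov2: "covering_projection E\<^sub>2 torus.Tele p\<^sub>2" "e\<^sub>2 \<in> topspace E\<^sub>2" "p\<^sub>2 e\<^sub>2 = ?e"
    using p2 by (auto simp: pointed_covering_def)
  have "p\<^sub>2 e\<^sub>2 = \<alpha>' 0" using cov2(3) \<alpha>'0 by simp
  then obtain \<alpha>'' where l: "is_lift E\<^sub>2 e\<^sub>2 p\<^sub>2 \<alpha>' \<alpha>''"
    by (rule path_lift_exists[OF cov2(1) path cov2(2)])
  then have "is_lift E\<^sub>2 e\<^sub>2 (fst \<circ> p\<^sub>2) \<alpha> \<alpha>''" using \<alpha>' by (simp add: is_lift_def)
  moreover have "\<gamma> 1 \<noteq> e\<^sub>2" if \<gamma>: "is_lift E\<^sub>2 e\<^sub>2 (fst \<circ> p\<^sub>2) \<alpha> \<gamma>" for \<gamma>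
  proof -
    \<comment> \<open>Any lift along the composite projects to a lift in the first covering, which
      must be \<open>\<alpha>'\<close>; so it is a lift of \<open>\<alpha>'\<close> along
      \<open>p\<^sub>2\<close>.\<close>
    have "is_lift torus.Tele ?e fst \<alpha> (p\<^sub>2 \<circ> \<gamma>)"
      using \<gamma> cov2(3) pathin_compose[OF _ covering_projection_continuous[OF cov2(1)]] by (simp add: is_lift_def)
    from uniq[OF this] have "is_lift E\<^sub>2 e\<^sub>2 p\<^sub>2 \<alpha>' \<gamma>" using \<gamma> by (simp add: is_lift_def)
    then show ?thesis using open_lift by blast
  qed
  ultimately show "\<exists>(E\<^sub>1 :: cover_point topology) e\<^sub>1 p\<^sub>1 (E\<^sub>2 :: cover_point topology) e\<^sub>2 p\<^sub>2.
      pointed_covering E\<^sub>1 e\<^sub>1 earring_torus earring_torus_base p\<^sub>1 \<and> pointed_covering E\<^sub>2 e\<^sub>2 E\<^sub>1 e\<^sub>1 p\<^sub>2 \<and>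
      (\<exists>\<alpha>''. is_lift E\<^sub>2 e\<^sub>2 (p\<^sub>1 \<circ> p\<^sub>2) \<alpha> \<alpha>'') \<and> (\<forall>\<alpha>''. is_lift E\<^sub>2 e\<^sub>2 (p\<^sub>1 \<circ> p\<^sub>2) \<alpha> \<alpha>'' \<longrightarrow> \<alpha>'' 1 \<noteq> e\<^sub>2)"
    using p1 p2 by blast
qed

end
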